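(* Let $d\ge1$ be an integer and let $(X,T)$ be (topologically conjugate to) an inverse limit of minimal $d$-step nilsystems. Then its group of automorphisms $\mathrm{Aut}(X,T)$ is $d$-step nilpotent.
   Context: A topological dynamical system $(X,T)$ is a homeomorphism $T$ of a compact metric space $X$; it is minimal if every orbit is dense. $\mathrm{Aut}(X,T)$ is the group of homeomorphisms of $X$ commuting with $T$. For a group $G$, put $G_1=G$ and $G_{j+1}=[G,G_j]$ (the subgroup generated by commutators $ghg^{-1}h^{-1}$, $g\in G$, $h\in G_j$); $G$ is $d$-step nilpotent if $G_{d+1}$ is trivial. If $G$ is a $d$-step nilpotent Lie group, $\Gamma\le G$ a discrete cocompact subgroup, and $\tau\in G$, then the system $(G/\Gamma, x\mapsto \tau x)$ is a $d$-step nilsystem. In inverse limits of minimal $d$-step nilsystems the bonding maps are topological factor maps (continuous, onto, commuting with the transformations). *)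

theory Defs
  imports "HOL-Analysis.Analysis" "HOL-Algebra.Bij" "HOL-Algebra.Left_Coset" "HOL-Algebra.Generated_Groups"
begin

section \<open>Nilpotent groups\<close>

text \<open>Indices are shifted by one: \<open>lower_central G j\<close> is the term usually written $G_{j+1}$,
  so that a group is $d$-step nilpotent iff \<open>lower_central G d\<close> is trivial.\<close>

primrec lower_central :: "('a, 'b) monoid_scheme \<Rightarrow> nat \<Rightarrow> 'a set" where
  "lower_central G 0 = carrier G"
| "lower_central G (Suc j) =
     generate G (\<Union>g\<in>carrier G. \<Union>h\<in>lower_central G j.
       {g \<otimes>\<^bsub>G\<^esub> h \<otimes>\<^bsub>G\<^esub> inv\<^bsub>G\<^esub> g \<otimes>\<^bsub>G\<^esub> inv\<^bsub>G\<^esub> h})"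

definition nilpotent_group :: "nat \<Rightarrow> ('a, 'b) monoid_scheme \<Rightarrow> bool" where
  "nilpotent_group d G \<longleftrightarrow> group G \<and> lower_central G d = {\<one>\<^bsub>G\<^esub>}"


section \<open>Lie groups\<close>

text \<open>The dimension of a Lie group must be a term rather than a type, because the Lie groups in one
  inverse system have varying dimensions. So $\mathbb{R}^n$ is \<^const>\<open>Euclidean_space\<close>, whose
  points are the functions \<open>nat \<Rightarrow> real\<close> vanishing from index \<open>n\<close> on.\<close>

definition partial_deriv :: "nat \<Rightarrow> ((nat \<Rightarrow> real) \<Rightarrow> real) \<Rightarrow> (nat \<Rightarrow> real) \<Rightarrow> real" where
  "partial_deriv i f x = deriv (\<lambda>t. f (x(i := t))) (x i)"

text \<open>\<open>C_k_on n D k f\<close> is meant for \<open>D\<close> open in $\mathbb{R}^n$: all partial derivatives of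
  \<open>f\<close> of order at most \<open>k\<close> exist and are continuous on \<open>D\<close>.\<close>

primrec C_k_on ::
  "nat \<Rightarrow> (nat \<Rightarrow> real) set \<Rightarrow> nat \<Rightarrow> ((nat \<Rightarrow> real) \<Rightarrow> real) \<Rightarrow> bool" where
  "C_k_on n D 0 f \<longleftrightarrow> continuous_map (subtopology (Euclidean_space n) D) euclideanreal f"
| "C_k_on n D (Suc k) f \<longleftrightarrow>
     continuous_map (subtopology (Euclidean_space n) D) euclideanreal f \<and>
     (\<forall>i<n. (\<forall>x\<in>D. (\<lambda>t. f (x(i := t))) differentiable (at (x i))) \<and>
            C_k_on n D k (partial_deriv i f))"

definition smooth_on_Rn ::
  "nat \<Rightarrow> nat \<Rightarrow> (nat \<Rightarrow> real) set \<Rightarrow> ((nat \<Rightarrow> real) \<Rightarrow> nat \<Rightarrow> real) \<Rightarrow> bool" where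
  "smooth_on_Rn n m D f \<longleftrightarrow> (\<forall>j<m. \<forall>k. C_k_on n D k (\<lambda>x. f x j))"

type_synonym 'a chart = "'a set \<times> ('a \<Rightarrow> nat \<Rightarrow> real)"

definition smooth_atlas :: "nat \<Rightarrow> 'a topology \<Rightarrow> 'a chart set \<Rightarrow> bool" where
  "smooth_atlas n X \<A> \<longleftrightarrow>
     (\<Union>(U, \<phi>)\<in>\<A>. U) = topspace X \<and>
     (\<forall>(U, \<phi>)\<in>\<A>. openin X U \<and> openin (Euclidean_space n) (\<phi> ` U) \<and>
        homeomorphic_map (subtopology X U) (subtopology (Euclidean_space n) (\<phi> ` U)) \<phi>) \<and>
     (\<forall>(U, \<phi>)\<in>\<A>. \<forall>(V, \<psi>)\<in>\<A>. smooth_on_Rn n n (\<phi> ` (U \<inter> V)) (\<psi> \<circ> inv_into U \<phi>))"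

definition smooth_map ::
  "nat \<Rightarrow> 'a topology \<Rightarrow> 'a chart set \<Rightarrow> nat \<Rightarrow> 'b topology \<Rightarrow> 'b chart set
    \<Rightarrow> ('a \<Rightarrow> 'b) \<Rightarrow> bool" where
  "smooth_map n X \<A> m Y \<B> f \<longleftrightarrow>
     continuous_map X Y f \<and>
     (\<forall>(U, \<phi>)\<in>\<A>. \<forall>(V, \<psi>)\<in>\<B>.
        smooth_on_Rn n m (\<phi> ` {x \<in> U. f x \<in> V}) (\<psi> \<circ> f \<circ> inv_into U \<phi>))"

text \<open>The atlas of a product manifold, with $\mathbb{R}^n \times \mathbb{R}^m$ identified with
  $\mathbb{R}^{n+m}$ by concatenation.\<close>

definition prod_atlas :: "nat \<Rightarrow> 'a chart set \<Rightarrow> 'b chart set \<Rightarrow> ('a \<times> 'b) chart set" where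
  "prod_atlas n \<A> \<B> =
     (\<Union>(U, \<phi>)\<in>\<A>. \<Union>(V, \<psi>)\<in>\<B>. {(U \<times> V, \<lambda>(x, y) i. if i < n then \<phi> x i else \<psi> y (i - n))})"

definition lie_group :: "('g, 'b) monoid_scheme \<Rightarrow> 'g topology \<Rightarrow> bool" where
  "lie_group G \<tau>G \<longleftrightarrow>
     group G \<and> topspace \<tau>G = carrier G \<and> Hausdorff_space \<tau>G \<and> second_countable \<tau>G \<and>
     (\<exists>n \<A>. smooth_atlas n \<tau>G \<A> \<and>
        smooth_map (n + n) (prod_topology \<tau>G \<tau>G) (prod_atlas n \<A> \<A>) n \<tau>G \<A>
          (\<lambda>(x, y). x \<otimes>\<^bsub>G\<^esub> y) \<and>
        smooth_map n \<tau>G \<A> n \<tau>G \<A> (\<lambda>x. inv\<^bsub>G\<^esub> x))"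


section \<open>Topological dynamical systems\<close>

definition dynamical_system :: "'a topology \<Rightarrow> ('a \<Rightarrow> 'a) \<Rightarrow> bool" where
  "dynamical_system X T \<longleftrightarrow> compact_space X \<and> metrizable_space X \<and> homeomorphic_map X X T"

text \<open>Two-sided orbits: the second set contains the images under negative powers of \<open>T\<close>.\<close>

definition orbit_of :: "'a topology \<Rightarrow> ('a \<Rightarrow> 'a) \<Rightarrow> 'a \<Rightarrow> 'a set" where
  "orbit_of X T x = {(T ^^ n) x | n. True} \<union> {y \<in> topspace X. \<exists>n. (T ^^ n) y = x}"

definition minimal_system :: "'a topology \<Rightarrow> ('a \<Rightarrow> 'a) \<Rightarrow> bool" where
  "minimal_system X T \<longleftrightarrow> (\<forall>x\<in>topspace X. X closure_of orbit_of X T x = topspace X)"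

text \<open>As in \<^const>\<open>BijGroup\<close>, maps are normalised to be \<^const>\<open>undefined\<close> outside the space, so that
  equality in the group is equality of maps on the space.\<close>

definition Aut_group :: "'a topology \<Rightarrow> ('a \<Rightarrow> 'a) \<Rightarrow> ('a \<Rightarrow> 'a) monoid" where
  "Aut_group X T = (BijGroup (topspace X))
     \<lparr>carrier := {\<phi> \<in> extensional (topspace X).
        homeomorphic_map X X \<phi> \<and> (\<forall>x\<in>topspace X. \<phi> (T x) = T (\<phi> x))}\<rparr>"

definition factor_map ::
  "'a topology \<Rightarrow> ('a \<Rightarrow> 'a) \<Rightarrow> 'b topology \<Rightarrow> ('b \<Rightarrow> 'b) \<Rightarrow> ('a \<Rightarrow> 'b) \<Rightarrow> bool" where
  "factor_map X T Y S p \<longleftrightarrow>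
     continuous_map X Y p \<and> p ` topspace X = topspace Y \<and> (\<forall>x\<in>topspace X. p (T x) = S (p x))"

definition topologically_conjugate ::
  "'a topology \<Rightarrow> ('a \<Rightarrow> 'a) \<Rightarrow> 'b topology \<Rightarrow> ('b \<Rightarrow> 'b) \<Rightarrow> bool" where
  "topologically_conjugate X T Y S \<longleftrightarrow>
     (\<exists>h. homeomorphic_map X Y h \<and> (\<forall>x\<in>topspace X. h (T x) = S (h x)))"


section \<open>Nilsystems\<close>

text \<open>The quotient topology: a set \<open>\<U>\<close> of cosets is open iff its preimage \<open>\<Union>\<U>\<close> in the group is.\<close>

definition quotient_space :: "('g, 'b) monoid_scheme \<Rightarrow> 'g topology \<Rightarrow> 'g set \<Rightarrow> 'g set topology" where
  "quotient_space G \<tau>G \<Gamma> = topology (\<lambda>\<U>. \<U> \<subseteq> lcosets\<^bsub>G\<^esub> \<Gamma> \<and> openin \<tau>G (\<Union>\<U>))"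

lemma openin_quotient_space:
  assumes "group G" "subgroup \<Gamma> G"
  shows "openin (quotient_space G \<tau>G \<Gamma>) \<U> \<longleftrightarrow> \<U> \<subseteq> lcosets\<^bsub>G\<^esub> \<Gamma> \<and> openin \<tau>G (\<Union>\<U>)"
proof -
  interpret group G by fact
  have disj: "A = B" if "A \<in> lcosets\<^bsub>G\<^esub> \<Gamma>" "B \<in> lcosets\<^bsub>G\<^esub> \<Gamma>" "x \<in> A" "x \<in> B" for A B x
    using lcos_disjoint[OF assms(2)] that unfolding pairwise_def disjnt_def by blast
  have Int: "\<Union>(\<U> \<inter> \<V>) = \<Union>\<U> \<inter> \<Union>\<V>"
    if "\<U> \<subseteq> lcosets\<^bsub>G\<^esub> \<Gamma>" "\<V> \<subseteq> lcosets\<^bsub>G\<^esub> \<Gamma>" for \<U> \<V>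
    using disj that by blast
  have Un: "\<Union>(\<Union>\<K>) = (\<Union>\<U>\<in>\<K>. \<Union>\<U>)" for \<K> :: "'a set set set"
    by blast
  have "istopology (\<lambda>\<U>. \<U> \<subseteq> lcosets\<^bsub>G\<^esub> \<Gamma> \<and> openin \<tau>G (\<Union>\<U>))"
    unfolding istopology_def
  proof (intro conjI allI impI)
    fix \<U> \<V> assume "\<U> \<subseteq> lcosets\<^bsub>G\<^esub> \<Gamma> \<and> openin \<tau>G (\<Union>\<U>)" "\<V> \<subseteq> lcosets\<^bsub>G\<^esub> \<Gamma> \<and> openin \<tau>G (\<Union>\<V>)"
    then show "openin \<tau>G (\<Union>(\<U> \<inter> \<V>))" by (simp add: Int openin_Int)
  next
    fix \<K> assume *: "\<forall>K\<in>\<K>. K \<subseteq> lcosets\<^bsub>G\<^esub> \<Gamma> \<and> openin \<tau>G (\<Union>K)"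
    then show "openin \<tau>G (\<Union>(\<Union>\<K>))" unfolding Un by blast
  qed (auto 0 3)
  then show ?thesis
    by (simp add: quotient_space_def)
qed

definition nilsystem :: "nat \<Rightarrow> 'g set topology \<Rightarrow> ('g set \<Rightarrow> 'g set) \<Rightarrow> bool" where
  "nilsystem d X T \<longleftrightarrow>
     (\<exists>(G :: 'g monoid) \<tau>G \<Gamma> \<tau>.
        lie_group G \<tau>G \<and> nilpotent_group d G \<and>
        subgroup \<Gamma> G \<and> subtopology \<tau>G \<Gamma> = discrete_topology \<Gamma> \<and>
        compact_space (quotient_space G \<tau>G \<Gamma>) \<and> \<tau> \<in> carrier G \<and>
        X = quotient_space G \<tau>G \<Gamma> \<and> (\<forall>C\<in>topspace X. T C = \<tau> <#\<^bsub>G\<^esub> C))"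


section \<open>Inverse limits of systems\<close>

text \<open>Systems are indexed by a directed ordered type; sequences are the case \<^typ>\<open>nat\<close>.
  The bonding map \<open>p i j\<close>, for \<open>i \<le> j\<close>, goes from the \<open>j\<close>-th to the \<open>i\<close>-th system.\<close>

definition inverse_system ::
  "('i::order \<Rightarrow> 'a topology) \<Rightarrow> ('i \<Rightarrow> 'a \<Rightarrow> 'a) \<Rightarrow> ('i \<Rightarrow> 'i \<Rightarrow> 'a \<Rightarrow> 'a) \<Rightarrow> bool" where
  "inverse_system Y S p \<longleftrightarrow>
     (\<forall>i j::'i. \<exists>k. i \<le> k \<and> j \<le> k) \<and>
     (\<forall>i j. i \<le> j \<longrightarrow> factor_map (Y j) (S j) (Y i) (S i) (p i j)) \<and>
     (\<forall>i. \<forall>y\<in>topspace (Y i). p i i y = y) \<and>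
     (\<forall>i j k. i \<le> j \<longrightarrow> j \<le> k \<longrightarrow> (\<forall>y\<in>topspace (Y k). p i j (p j k y) = p i k y))"

definition inverse_limit ::
  "('i::order \<Rightarrow> 'a topology) \<Rightarrow> ('i \<Rightarrow> 'i \<Rightarrow> 'a \<Rightarrow> 'a) \<Rightarrow> ('i \<Rightarrow> 'a) topology" where
  "inverse_limit Y p =
     subtopology (product_topology Y UNIV) {y. \<forall>i j. i \<le> j \<longrightarrow> p i j (y j) = y i}"

definition inverse_limit_map :: "('i \<Rightarrow> 'a \<Rightarrow> 'a) \<Rightarrow> ('i \<Rightarrow> 'a) \<Rightarrow> 'i \<Rightarrow> 'a" where
  "inverse_limit_map S y = (\<lambda>i. S i (y i))"

end

theory Submission
  imports Defs "HOL-Algebra.Zassenhaus"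
begin

text \<open>The proof uses Host--Kra cubes. An automorphism \<open>\<phi>\<close> acting on one face of a cube of points
  commutes with the face actions of \<open>T\<close>, and by minimality \<open>\<phi> x\<close> is a limit of points \<open>T\<^sup>n x\<close>; hence it
  preserves the closure of the orbit of the constant cube \<open>x\<close> under the face actions of \<open>T\<close>. The
  commutator of two face actions is the action of the commutator on the intersection of the faces.
  So if \<open>\<phi>\<close> is a \<open>(d + 1)\<close>-fold iterated commutator of automorphisms, then the cube of dimension
  \<open>d + 1\<close> with last vertex \<open>\<phi> x\<close> and all other vertices \<open>x\<close> lies in that closure. This survives the
  projection to each nilsystem of the inverse limit, where it forces \<open>\<phi> x = x\<close>: for a compact
  quotient of a \<open>d\<close>-step nilpotent group by \<open>\<Gamma>\<close>, every limit of cubes lifts to a cube of the group,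
  whose last vertex lies in \<open>\<Gamma>\<close> as soon as all the others do.

  The lift exists because each \<open>G\<^sub>j\<close> is the product of a compact set and \<open>\<Gamma> \<inter> G\<^sub>j\<close>. Modulo \<open>G\<^sub>j\<^sub>+\<^sub>1\<close>,
  iterated commutators are multilinear, so those with all entries but one taken from a finite set of
  generators of \<open>\<Gamma>\<close> form finitely many homomorphic images of \<open>G\<close>, each compact modulo \<open>\<Gamma>\<close>. An
  entry \<open>g\<close> near the identity has arbitrarily small roots \<open>u\<^sup>m = g\<close>; moving the exponent to another
  entry \<open>h\<close> and writing \<open>h\<^sup>m = k \<gamma>\<close> with \<open>k\<close> in a compact set replaces \<open>h\<close> by \<open>\<gamma>\<close> up to an arbitrarily
  small error, so all iterated commutators are reached.\<close>

section \<open>Commutators and the lower central series\<close>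

text \<open>A limit of cubes in a compact quotient lifts only if the factors of the approximating
  cubes can be kept in compact sets, and this requires every term of the lower central series, not
  just the group, to be cocompact modulo \<open>\<Gamma>\<close>. For connected, simply connected
  groups this belongs to Malcev's theory; here the Lie group may be disconnected and need not even
  be compactly generated. Minimality is the remedy: because the orbit is dense,
  \<open>\<tau>\<close> and a small compact neighbourhood of the identity generate an open subgroup
  that is still transitive on the quotient. In that subgroup every generator except
  \<open>\<tau>\<close> has small roots, and a commutator of at least two entries, all equal to
  \<open>\<tau>\<close>, is trivial; so the root argument always finds a divisible entry.
  Differentiability is used once, for square roots near the identity. The dimension
  \<open>d + 1\<close> is chosen so that the factor of a cube belonging to its last vertex lies in a
  trivial term.\<close>

declare lower_central.simps(2) [simp del]

definition commutator :: "('a, 'b) monoid_scheme \<Rightarrow> 'a \<Rightarrow> 'a \<Rightarrow> 'a" where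
  "commutator G x y = x \<otimes>\<^bsub>G\<^esub> y \<otimes>\<^bsub>G\<^esub> inv\<^bsub>G\<^esub> x \<otimes>\<^bsub>G\<^esub> inv\<^bsub>G\<^esub> y"

context group
begin

lemma mult_inv_cancel: "x \<in> carrier G \<Longrightarrow> y \<in> carrier G \<Longrightarrow> x \<otimes> (inv x \<otimes> y) = y"
  by (simp add: m_assoc [symmetric])

lemma inv_mult_cancel: "x \<in> carrier G \<Longrightarrow> y \<in> carrier G \<Longrightarrow> inv x \<otimes> (x \<otimes> y) = y"
  by (simp add: m_assoc [symmetric])

lemmas word_simps = m_assoc inv_mult_group mult_inv_cancel inv_mult_cancel commutator_def

abbreviation "comm \<equiv> commutator G"

lemma commutator_closed [intro, simp]:
  "x \<in> carrier G \<Longrightarrow> y \<in> carrier G \<Longrightarrow> comm x y \<in> carrier G"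
  by (simp add: commutator_def)

lemma inv_commutator:
  "x \<in> carrier G \<Longrightarrow> y \<in> carrier G \<Longrightarrow> inv (comm x y) = comm y x"
  by (simp add: word_simps)

lemma commutator_one_left [simp]: "x \<in> carrier G \<Longrightarrow> comm \<one> x = \<one>"
  and commutator_one_right [simp]: "x \<in> carrier G \<Longrightarrow> comm x \<one> = \<one>"
  by (simp_all add: commutator_def)

lemma commutator_mult_left:
  "x \<in> carrier G \<Longrightarrow> y \<in> carrier G \<Longrightarrow> z \<in> carrier G \<Longrightarrow>
    comm (x \<otimes> y) z = x \<otimes> comm y z \<otimes> inv x \<otimes> comm x z"
  by (simp add: word_simps)

lemma commutator_mult_right:
  "x \<in> carrier G \<Longrightarrow> y \<in> carrier G \<Longrightarrow> z \<in> carrier G \<Longrightarrow>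
    comm x (y \<otimes> z) = comm x y \<otimes> (y \<otimes> comm x z \<otimes> inv y)"
  by (simp add: word_simps)

text \<open>The Hall--Witt identity, solved for one of its three factors.\<close>

lemma commutator_commutator:
  assumes "g \<in> carrier G" "x \<in> carrier G" "z \<in> carrier G"
  shows "comm (comm g x) z =
    g \<otimes> inv ((z \<otimes> comm (comm (inv z) (inv g)) x \<otimes> inv z) \<otimes>
             (x \<otimes> comm (comm (inv x) z) (inv g) \<otimes> inv x)) \<otimes> inv g"
  using assms by (simp add: word_simps)

abbreviation "lc \<equiv> lower_central G"

lemma lc_Suc_alt:
  "lc (Suc j) = generate G {comm g h |g h. g \<in> carrier G \<and> h \<in> lc j}"
proof -
  have "(\<Union>g\<in>carrier G. \<Union>h\<in>lc j. {g \<otimes> h \<otimes> inv g \<otimes> inv h}) =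
      {comm g h |g h. g \<in> carrier G \<and> h \<in> lc j}"
    by (auto simp: commutator_def)
  then show ?thesis by (simp add: lower_central.simps(2))
qed

lemma subgroup_lc: "subgroup (lc j) G"
proof (induction j)
  case 0
  then show ?case by (simp add: subgroup_self)
next
  case (Suc j)
  then have "lc j \<subseteq> carrier G" by (rule subgroup.subset)
  then show ?case
    unfolding lc_Suc_alt by (intro generate_is_subgroup) auto
qed

lemma lc_closed: "x \<in> lc j \<Longrightarrow> x \<in> carrier G"
  using subgroup_lc subgroup.mem_carrier by fast

lemma lc_mult: "x \<in> lc j \<Longrightarrow> y \<in> lc j \<Longrightarrow> x \<otimes> y \<in> lc j"
  and lc_inv: "x \<in> lc j \<Longrightarrow> inv x \<in> lc j"
  and lc_one: "\<one> \<in> lc j"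
  using subgroup_lc [of j] by (auto simp: subgroup_def)

lemma commutator_in_lc_Suc:
  "g \<in> carrier G \<Longrightarrow> h \<in> lc j \<Longrightarrow> comm g h \<in> lc (Suc j)"
  unfolding lc_Suc_alt by (blast intro: generate.incl)

text \<open>A conjugate \<open>g x g^-1\<close> is \<open>[g, x] x\<close>, and
  \<open>[g, x]\<close> lies one term deeper, so normality of a term follows from its containing the
  next one. One induction therefore carries both claims.\<close>

lemma lc_Suc_subset_and_conj:
  "lc (Suc j) \<subseteq> lc j \<and> (\<forall>g\<in>carrier G. \<forall>x\<in>lc j. g \<otimes> x \<otimes> inv g \<in> lc j)"
proof (induction j)
  case 0
  then show ?case using lc_closed [of _ "Suc 0"] by auto
next
  case (Suc j)
  have sub: "lc (Suc (Suc j)) \<subseteq> lc (Suc j)"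
    unfolding lc_Suc_alt [of "Suc j"]
    using Suc commutator_in_lc_Suc subgroup_lc by (intro generate_subgroup_incl) auto
  have "g \<otimes> x \<otimes> inv g \<in> lc (Suc j)" if "g \<in> carrier G" "x \<in> lc (Suc j)" for g x
  proof -
    have "g \<otimes> x \<otimes> inv g = comm g x \<otimes> x"
      using that by (simp add: word_simps lc_closed)
    then show ?thesis
      using that sub commutator_in_lc_Suc [of g x "Suc j"] lc_mult by auto
  qed
  then show ?case using sub by blast
qed

lemma lc_Suc_subset: "lc (Suc j) \<subseteq> lc j"
  using lc_Suc_subset_and_conj by blast

lemma lc_conj: "g \<in> carrier G \<Longrightarrow> x \<in> lc j \<Longrightarrow> g \<otimes> x \<otimes> inv g \<in> lc j"
  using lc_Suc_subset_and_conj by blast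

lemma lc_conj': "g \<in> carrier G \<Longrightarrow> x \<in> lc j \<Longrightarrow> inv g \<otimes> x \<otimes> g \<in> lc j"
  using lc_conj [of "inv g"] by simp

lemma lc_antimono: "i \<le> j \<Longrightarrow> lc j \<subseteq> lc i"
  using lc_Suc_subset by (rule lift_Suc_antimono_le)

text \<open>Up to inverses and conjugation, Hall--Witt trades \<open>[[g, x], z]\<close> for a
  commutator of \<open>x \<in> lc i\<close> with an element of \<open>lc (Suc j)\<close> and one of
  \<open>inv g\<close> with an element of \<open>lc (Suc (i + j))\<close>. Hence \<open>j\<close>
  has to vary in the induction on \<open>i\<close>. The outer \<open>Suc\<close> comes from the
  shifted indices.\<close>

lemma commutator_in_lc: "x \<in> lc i \<Longrightarrow> y \<in> lc j \<Longrightarrow> comm x y \<in> lc (Suc (i + j))"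
proof (induction i arbitrary: x j y)
  case 0
  then show ?case by (simp add: commutator_in_lc_Suc)
next
  case (Suc i)
  let ?N = "lc (Suc (Suc i + j))"
  have gen: "comm (comm g x) z \<in> ?N"
    if "g \<in> carrier G" "x \<in> lc i" "z \<in> lc j" for g x z
  proof -
    have c: "x \<in> carrier G" "z \<in> carrier G" using that lc_closed by auto
    have "inv (comm (inv g) (inv z)) \<in> lc (Suc j)"
      using that by (intro lc_inv commutator_in_lc_Suc) auto
    then have "comm x (comm (inv z) (inv g)) \<in> lc (Suc (i + Suc j))"
      using that c by (intro Suc.IH) (simp_all add: inv_commutator)
    then have "inv (comm x (comm (inv z) (inv g))) \<in> ?N"
      by (intro lc_inv) simp
    then have "comm (comm (inv z) (inv g)) x \<in> ?N"
      using that c by (simp add: inv_commutator)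
    moreover have "inv (comm (inv g) (comm (inv x) z)) \<in> lc (Suc (Suc (i + j)))"
      using that by (intro lc_inv commutator_in_lc_Suc Suc.IH) auto
    then have "comm (comm (inv x) z) (inv g) \<in> ?N"
      using that c by (simp add: inv_commutator)
    ultimately show ?thesis
      unfolding commutator_commutator [OF that(1) c]
      by (intro lc_conj [OF that(1)] lc_inv lc_mult lc_conj [OF c(1)] lc_conj [OF c(2)])
  qed
  let ?S = "{x \<in> carrier G. \<forall>z\<in>lc j. comm x z \<in> ?N}"
  have "subgroup ?S G"
  proof (rule subgroup.intro)
    show "x \<otimes> y \<in> ?S" if "x \<in> ?S" "y \<in> ?S" for x y
      using that by (simp add: commutator_mult_left lc_closed lc_mult lc_conj)
    show "inv x \<in> ?S" if x: "x \<in> ?S" for x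
    proof -
      have "comm (inv x) z = inv x \<otimes> inv (comm x z) \<otimes> inv (inv x)"
        if "z \<in> lc j" for z
        using that x by (simp add: word_simps lc_closed)
      moreover have "inv x \<otimes> inv (comm x z) \<otimes> inv (inv x) \<in> ?N" if "z \<in> lc j" for z
        using that x by (intro lc_conj lc_inv) auto
      ultimately show ?thesis using x by simp
    qed
  qed (auto simp: lc_one lc_closed)
  then have "lc (Suc i) \<subseteq> ?S"
    unfolding lc_Suc_alt [of i]
    using gen by (intro generate_subgroup_incl) (auto simp: lc_closed)
  then show ?case using Suc.prems by blast
qed

end

lemma lower_central_subgroup_subset:
  assumes "group G" "subgroup H G"
  shows "lower_central (G\<lparr>carrier := H\<rparr>) j \<subseteq> lower_central G j"
proof (induction j)
  interpret group G by fact
  case 0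
  then show ?case using subgroup.subset [OF assms(2)] by simp
next
  interpret group G by fact
  interpret H: group "G\<lparr>carrier := H\<rparr>" using subgroup_imp_group [OF assms(2)] .
  case (Suc j)
  have eq: "commutator (G\<lparr>carrier := H\<rparr>) g h = comm g h" if "g \<in> H" "h \<in> H" for g h
    using that assms(2) by (simp add: commutator_def)
  have sub: "H.lc j \<subseteq> H" using H.lc_closed by auto
  let ?A = "{commutator (G\<lparr>carrier := H\<rparr>) g h |g h. g \<in> carrier (G\<lparr>carrier := H\<rparr>) \<and> h \<in> H.lc j}"
  have "?A \<subseteq> H" using H.commutator_closed sub by fastforce
  then have "H.lc (Suc j) = generate G ?A"
    unfolding H.lc_Suc_alt using generate_consistent [OF _ assms(2)] by blast
  also have "\<dots> \<subseteq> lc (Suc j)"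
    unfolding lc_Suc_alt using eq Suc sub subgroup.subset [OF assms(2)]
    by (intro mono_generate) (fastforce simp: subset_eq)
  finally show ?case .
qed

section \<open>Iterated commutators\<close>

fun iterated_commutator :: "('a, 'b) monoid_scheme \<Rightarrow> 'a list \<Rightarrow> 'a" where
  "iterated_commutator G [] = \<one>\<^bsub>G\<^esub>"
| "iterated_commutator G [x] = x"
| "iterated_commutator G (x # y # ys) = commutator G x (iterated_commutator G (y # ys))"

context group
begin

abbreviation "itc \<equiv> iterated_commutator G"

lemma itc_Cons: "xs \<noteq> [] \<Longrightarrow> itc (x # xs) = comm x (itc xs)"
  by (cases xs) auto

lemma itc_in_lc: "set xs \<subseteq> carrier G \<Longrightarrow> xs \<noteq> [] \<Longrightarrow> itc xs \<in> lc (length xs - 1)"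
proof (induction xs)
  case (Cons x xs)
  show ?case
  proof (cases "xs = []")
    case False
    then show ?thesis
      using Cons commutator_in_lc_Suc [of x "itc xs" "length xs - 1"] by (simp add: itc_Cons)
  qed (use Cons in auto)
qed simp

lemma itc_closed: "set xs \<subseteq> carrier G \<Longrightarrow> itc xs \<in> carrier G"
  by (cases "xs = []") (auto dest: itc_in_lc lc_closed)

lemma itc_one: "set xs \<subseteq> carrier G \<Longrightarrow> \<one> \<in> set xs \<Longrightarrow> itc xs = \<one>"
proof (induction xs)
  case (Cons x xs)
  show ?case
  proof (cases "xs = []")
    case False
    then show ?thesis using Cons itc_closed [of xs] by (auto simp: itc_Cons)
  qed (use Cons in auto)
qed simp

lemma itc_mem_subgroup:
  assumes "subgroup H G" "set xs \<subseteq> H"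
  shows "itc xs \<in> H"
  using assms(2)
proof (induction xs)
  case Nil
  then show ?case using subgroup.one_closed [OF assms(1)] by simp
next
  case (Cons x xs)
  then show ?case
    using subgroup.m_closed [OF assms(1)] subgroup.m_inv_closed [OF assms(1)]
    by (cases "xs = []") (auto simp: itc_Cons commutator_def)
qed

text \<open>A homomorphism into the abelian quotient of \<open>lc j\<close> by
  \<open>lc (Suc j)\<close>, encoded by representatives in \<open>lc j\<close>. Keeping
  representatives makes it possible to speak of continuity and of values in
  \<open>\<Gamma>\<close>.\<close>

definition hom_mod :: "nat \<Rightarrow> ('a \<Rightarrow> 'a) \<Rightarrow> bool" where
  "hom_mod j f \<longleftrightarrow> f \<in> carrier G \<rightarrow> lc j \<and>
    (\<forall>x\<in>carrier G. \<forall>y\<in>carrier G. \<exists>l\<in>lc (Suc j). f (x \<otimes> y) = f x \<otimes> f y \<otimes> l)"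

lemma hom_modD:
  assumes "hom_mod j f" "x \<in> carrier G"
  shows "f x \<in> lc j" "y \<in> carrier G \<Longrightarrow> \<exists>l\<in>lc (Suc j). f (x \<otimes> y) = f x \<otimes> f y \<otimes> l"
  using assms unfolding hom_mod_def by blast+

lemma hom_mod_one:
  assumes "hom_mod j f"
  shows "f \<one> \<in> lc (Suc j)"
proof -
  obtain l where l: "l \<in> lc (Suc j)" "f (\<one> \<otimes> \<one>) = f \<one> \<otimes> f \<one> \<otimes> l"
    using hom_modD(2) [OF assms one_closed one_closed] by blast
  have c: "f \<one> \<in> carrier G" "l \<in> carrier G"
    using hom_modD(1) [OF assms one_closed] l lc_closed by blast+
  then have "f \<one> \<otimes> (f \<one> \<otimes> l) = f \<one> \<otimes> \<one>" using l by (simp add: m_assoc)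
  then have "f \<one> = inv l" using c by (metis Units_eq Units_l_cancel inv_equality m_closed one_closed)
  then show ?thesis using l lc_inv by simp
qed

lemma hom_mod_inv:
  assumes "hom_mod j f" "x \<in> carrier G"
  shows "\<exists>l\<in>lc (Suc j). f (inv x) = inv (f x) \<otimes> l"
proof -
  obtain l where l: "l \<in> lc (Suc j)" "f (x \<otimes> inv x) = f x \<otimes> f (inv x) \<otimes> l"
    using hom_modD(2) [OF assms] assms by blast
  have c: "f x \<in> carrier G" "f (inv x) \<in> carrier G" "l \<in> carrier G" "f \<one> \<in> carrier G"
    using hom_modD(1) [OF assms(1)] assms l lc_closed by (blast intro: one_closed inv_closed)+
  have "f (inv x) = inv (f x) \<otimes> (f \<one> \<otimes> inv l)"
    using l(2) c assms by (simp add: word_simps)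
  then show ?thesis using l(1) hom_mod_one [OF assms(1)] by (blast intro: lc_mult lc_inv)
qed

text \<open>Together with multilinearity this moves an exponent from one entry of an iterated
  commutator to another.\<close>

lemma hom_mod_pow:
  assumes "hom_mod j f" "x \<in> carrier G"
  shows "\<exists>l\<in>lc (Suc j). f (x [^] (m :: nat)) = f x [^] m \<otimes> l"
proof (induction m)
  case 0
  then show ?case using hom_mod_one [OF assms(1)] lc_closed by (intro bexI [of _ "f \<one>"]) auto
next
  case (Suc m)
  then obtain l where l: "l \<in> lc (Suc j)" "f (x [^] m) = f x [^] m \<otimes> l" by blast
  obtain k where k: "k \<in> lc (Suc j)" "f (x [^] m \<otimes> x) = f (x [^] m) \<otimes> f x \<otimes> k"
    using hom_modD(2) [OF assms(1), of "x [^] m" x] assms by auto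
  have c: "f x \<in> carrier G" "l \<in> carrier G" "k \<in> carrier G"
    using hom_modD(1) [OF assms] l k lc_closed by blast+
  have "f (x [^] Suc m) = f x [^] Suc m \<otimes> ((inv (f x) \<otimes> l \<otimes> f x) \<otimes> k)"
    using k(2) l(2) c by (simp add: word_simps)
  then show ?case using l(1) k(1) c lc_mult lc_conj' by blast
qed

text \<open>Lets membership of the values in \<open>R\<close> be checked on generators of the
  domain, since \<open>R\<close> absorbs the error terms.\<close>

lemma subgroup_vimage_hom_mod:
  assumes "hom_mod j f" "subgroup R G" "lc (Suc j) \<subseteq> R"
  shows "subgroup {x \<in> carrier G. f x \<in> R} G"
proof (rule subgroup.intro)
  note R = subgroup.m_closed [OF assms(2)] subgroup.m_inv_closed [OF assms(2)]
  show "x \<otimes> y \<in> {x \<in> carrier G. f x \<in> R}"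
    if "x \<in> {x \<in> carrier G. f x \<in> R}" "y \<in> {x \<in> carrier G. f x \<in> R}" for x y
    using hom_modD(2) [OF assms(1), of x y] that R assms(3) by fastforce
  show "inv x \<in> {x \<in> carrier G. f x \<in> R}" if "x \<in> {x \<in> carrier G. f x \<in> R}" for x
    using hom_mod_inv [OF assms(1), of x] that R assms(3) by fastforce
  show "\<one> \<in> {x \<in> carrier G. f x \<in> R}" using hom_mod_one [OF assms(1)] assms(3) by auto
qed auto

lemma hom_mod_commutator_left:
  assumes "m \<in> lc j"
  shows "hom_mod (Suc j) (\<lambda>x. comm x m)"
  unfolding hom_mod_def
proof (intro conjI ballI)
  fix x y assume xy: "x \<in> carrier G" "y \<in> carrier G"
  let ?c = "comm y m" and ?e = "comm x m"
  have m: "m \<in> carrier G" using assms lc_closed by blast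
  have "comm (inv ?c) (inv ?e \<otimes> x) \<in> lc (Suc (Suc j))"
    using commutator_in_lc [of "inv ?c" "Suc j" "inv ?e \<otimes> x" 0] xy m assms
      lc_inv commutator_in_lc_Suc by auto
  moreover have "comm (x \<otimes> y) m = ?e \<otimes> ?c \<otimes> comm (inv ?c) (inv ?e \<otimes> x)"
    using xy m by (simp add: word_simps)
  ultimately show "\<exists>l\<in>lc (Suc (Suc j)). comm (x \<otimes> y) m = ?e \<otimes> ?c \<otimes> l" by blast
qed (use assms commutator_in_lc_Suc in blast)

lemma hom_mod_commutator_right:
  assumes "h \<in> carrier G" "hom_mod j f"
  shows "hom_mod (Suc j) (\<lambda>x. comm h (f x))"
  unfolding hom_mod_def
proof (intro conjI ballI)
  fix x y assume xy: "x \<in> carrier G" "y \<in> carrier G"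
  obtain l where l: "l \<in> lc (Suc j)" "f (x \<otimes> y) = f x \<otimes> f y \<otimes> l"
    using hom_modD(2) [OF assms(2) xy] by blast
  note f = hom_modD(1) [OF assms(2)]
  have c: "f x \<in> carrier G" "f y \<in> carrier G" "l \<in> carrier G" using f xy l lc_closed by blast+
  let ?p = "comm h (f x)" and ?q = "comm h (f y)"
  let ?l = "comm (inv ?q) (f x) \<otimes>
    ((f x \<otimes> f y) \<otimes> comm h l \<otimes> inv (f x \<otimes> f y))"
  have "comm (inv ?q) (f x) \<in> lc (Suc (Suc j))"
    using commutator_in_lc [of "inv ?q" "Suc j" "f x" 0] xy c assms f
      lc_inv commutator_in_lc_Suc by auto
  moreover have "comm h l \<in> lc (Suc (Suc j))"
    using commutator_in_lc_Suc assms l by blast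
  ultimately have "?l \<in> lc (Suc (Suc j))" using c by (intro lc_mult lc_conj) auto
  moreover have "comm h (f (x \<otimes> y)) = ?p \<otimes> ?q \<otimes> ?l"
    unfolding l(2) using assms c by (simp add: word_simps)
  ultimately show "\<exists>l\<in>lc (Suc (Suc j)). comm h (f (x \<otimes> y)) = ?p \<otimes> ?q \<otimes> l" by blast
qed (use assms commutator_in_lc_Suc hom_modD(1) in blast)

lemma hom_mod_id: "hom_mod 0 (\<lambda>x. x)"
  unfolding hom_mod_def by (auto intro!: bexI [OF _ lc_one])

text \<open>This is multilinearity modulo the next term, one entry at a time. The outermost entry is
  covered by \<open>hom_mod_commutator_left\<close>; a deeper entry is wrapped once more by
  \<open>hom_mod_commutator_right\<close>.\<close>

lemma hom_mod_itc:
  assumes "set hs \<subseteq> carrier G" "i < length hs"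
  shows "hom_mod (length hs - 1) (\<lambda>x. itc (hs[i := x]))"
  using assms
proof (induction hs arbitrary: i)
  case (Cons h hs)
  show ?case
  proof (cases "hs = []")
    case True
    then show ?thesis using Cons.prems hom_mod_id by simp
  next
    case False
    then have len: "length (h # hs) - 1 = Suc (length hs - 1)" by simp
    show ?thesis
    proof (cases i)
      case 0
      then show ?thesis
        unfolding len using hom_mod_commutator_left [OF itc_in_lc [of hs]] Cons.prems False
        by (simp add: itc_Cons)
    next
      case (Suc k)
      then show ?thesis
        unfolding len using hom_mod_commutator_right [OF _ Cons.IH [of k], of h] Cons.prems False
        by (simp add: itc_Cons)
    qed
  qed
qed simp

text \<open>Multilinearity reduces membership in \<open>R\<close> to commutators with entries from a
  generating set. The induction lets \<open>R\<close> vary: its step descends to the elements of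
  \<open>lc j\<close> whose commutators with all of \<open>G\<close> fall into
  \<open>R\<close>.\<close>

lemma subgroup_lc_le:
  assumes "subgroup R G" "lc (Suc j) \<subseteq> R" "S \<subseteq> carrier G" "carrier G = generate G S"
    and "\<And>ss. set ss \<subseteq> S \<Longrightarrow> length ss = Suc j \<Longrightarrow> itc ss \<in> R"
  shows "lc j \<subseteq> R"
  using assms(1,2,5)
proof (induction j arbitrary: R)
  case 0
  have "S \<subseteq> R"
  proof
    fix s assume "s \<in> S"
    then show "s \<in> R" using "0.prems"(3) [of "[s]"] by simp
  qed
  then show ?case using generate_subgroup_incl "0.prems"(1) assms(4) by simp
next
  case (Suc j)
  let ?R = "{h \<in> lc j. \<forall>g\<in>carrier G. comm g h \<in> R}"
  have R1: "x \<otimes> y \<in> R" if "x \<in> R" "y \<in> R" for x y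
    using subgroup.m_closed [OF Suc.prems(1)] that by blast
  have R2: "inv x \<in> R" if "x \<in> R" for x
    using subgroup.m_inv_closed [OF Suc.prems(1)] that by blast
  have conj: "g \<otimes> x \<otimes> inv g \<in> R" if "g \<in> carrier G" "x \<in> R" "x \<in> lc (Suc j)" for g x
  proof -
    have "g \<otimes> x \<otimes> inv g = comm g x \<otimes> x"
      using that by (simp add: word_simps lc_closed)
    then show ?thesis using that R1 Suc.prems(2) commutator_in_lc_Suc by (metis subsetD)
  qed
  have "subgroup ?R G"
  proof (rule subgroup.intro)
    show "x \<otimes> y \<in> ?R" if "x \<in> ?R" "y \<in> ?R" for x y
    proof -
      have "x \<in> carrier G" "y \<in> carrier G" using that lc_closed by blast+
      moreover have "x \<otimes> comm g y \<otimes> inv x \<in> R" if "g \<in> carrier G" for g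
        using that \<open>x \<in> ?R\<close> \<open>y \<in> ?R\<close> by (intro conj commutator_in_lc_Suc) (auto simp: lc_closed)
      ultimately show ?thesis using that by (simp add: commutator_mult_right R1 lc_mult)
    qed
    show "inv x \<in> ?R" if x: "x \<in> ?R" for x
    proof -
      have xc: "x \<in> carrier G" using x lc_closed by blast
      have "comm g (inv x) \<in> R" if g: "g \<in> carrier G" for g
      proof -
        have "comm g (inv x) = inv x \<otimes> inv (comm g x) \<otimes> inv (inv x)"
          using g xc by (simp add: word_simps)
        moreover have "inv (comm g x) \<in> R" "inv (comm g x) \<in> lc (Suc j)"
          using x g R2 lc_inv commutator_in_lc_Suc by blast+
        ultimately show ?thesis using conj [of "inv x"] xc by simp
      qed
      then show ?thesis using x lc_inv by simp
    qed
    show "\<one> \<in> ?R" using lc_one subgroup.one_closed [OF Suc.prems(1)] by simp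
  qed (use lc_closed in blast)
  moreover have "lc (Suc j) \<subseteq> ?R"
    using lc_Suc_subset commutator_in_lc_Suc Suc.prems(2) by blast
  moreover have "itc ss \<in> ?R" if ss: "set ss \<subseteq> S" "length ss = Suc j" for ss
  proof -
    have ne: "ss \<noteq> []" using ss by auto
    have itc: "itc ss \<in> lc j" using itc_in_lc [of ss] ss assms(3) ne by auto
    have "S \<subseteq> {g \<in> carrier G. comm g (itc ss) \<in> R}"
    proof
      fix s assume "s \<in> S"
      then show "s \<in> {g \<in> carrier G. comm g (itc ss) \<in> R}"
        using Suc.prems(3) [of "s # ss"] ss ne assms(3) by (auto simp: itc_Cons)
    qed
    then have "generate G S \<subseteq> {g \<in> carrier G. comm g (itc ss) \<in> R}"
      using subgroup_vimage_hom_mod [OF hom_mod_commutator_left [OF itc] Suc.prems(1,2)]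
      by (rule generate_subgroup_incl)
    then show ?thesis using itc assms(4) by blast
  qed
  ultimately have "lc j \<subseteq> ?R" using Suc.IH by blast
  then have "{comm g h |g h. g \<in> carrier G \<and> h \<in> lc j} \<subseteq> R" by blast
  then show ?case
    unfolding lc_Suc_alt using Suc.prems(1) by (rule generate_subgroup_incl)
qed

end

section \<open>Topological groups\<close>

locale topological_group = group G for G :: "('a, 'b) monoid_scheme" (structure) +
  fixes T :: "'a topology"
  assumes topspace_eq: "topspace T = carrier G"
    and continuous_mult: "continuous_map (prod_topology T T) T (\<lambda>(x, y). x \<otimes> y)"
    and continuous_inv: "continuous_map T T (\<lambda>x. inv x)"
begin

lemma continuous_map_mult:
  assumes "continuous_map Z T f" "continuous_map Z T g"
  shows "continuous_map Z T (\<lambda>z. f z \<otimes> g z)"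
  using continuous_map_compose [OF _ continuous_mult, of Z "\<lambda>z. (f z, g z)"] assms
  by (simp add: continuous_map_pairedI comp_def)

lemma continuous_map_inv:
  assumes "continuous_map Z T f"
  shows "continuous_map Z T (\<lambda>z. inv (f z))"
  using continuous_map_compose [OF assms continuous_inv] by (simp add: comp_def)

lemma compactin_subset_carrier: "compactin T A \<Longrightarrow> A \<subseteq> carrier G"
  using compactin_subset_topspace topspace_eq by blast

lemma compactin_set_mult:
  assumes "compactin T A" "compactin T B"
  shows "compactin T (A <#> B)"
proof -
  have "A <#> B = (\<lambda>(x, y). x \<otimes> y) ` (A \<times> B)" by (force simp: set_mult_def)
  then show ?thesis
    using image_compactin [OF _ continuous_mult] compactin_Times assms by metis
qed

lemma compactin_m_inv: "compactin T A \<Longrightarrow> compactin T (m_inv G ` A)"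
  using image_compactin [OF _ continuous_inv] by blast

text \<open>The preimage of \<open>B\<close> under \<open>(a, y) \<mapsto> inv a \<otimes> y\<close>
  is closed in \<open>A \<times> G\<close>, and projecting away the compact factor \<open>A\<close>
  is a closed map.\<close>

lemma closedin_compact_set_mult:
  assumes "compactin T A" "closedin T B"
  shows "closedin T (A <#> B)"
proof -
  let ?Z = "prod_topology (subtopology T A) T"
  let ?S = "{z \<in> topspace ?Z. inv (fst z) \<otimes> snd z \<in> B}"
  have A: "A \<subseteq> carrier G" using compactin_subset_carrier assms by blast
  have B: "B \<subseteq> carrier G" using closedin_subset assms topspace_eq by metis
  have "continuous_map ?Z T (\<lambda>z. inv (fst z) \<otimes> snd z)"
    by (intro continuous_map_mult continuous_map_inv)
      (use continuous_map_fst continuous_map_snd continuous_map_into_fulltopology in blast)+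
  then have "closedin ?Z ?S"
    using assms(2) by (rule closedin_continuous_map_preimage)
  moreover have "closed_map ?Z T snd"
    using assms(1) by (intro closed_map_snd) (simp add: compactin_subspace)
  ultimately have "closedin T (snd ` ?S)" unfolding closed_map_def by blast
  moreover have "snd ` ?S = A <#> B"
  proof (intro equalityI subsetI)
    fix y assume "y \<in> snd ` ?S"
    then obtain x where x: "x \<in> A" "y \<in> carrier G" "inv x \<otimes> y \<in> B"
      using topspace_eq by auto
    then have "y = x \<otimes> (inv x \<otimes> y)" using A by (auto simp: mult_inv_cancel)
    then show "y \<in> A <#> B" using x unfolding set_mult_def by blast
  next
    fix y assume "y \<in> A <#> B"
    then obtain x b where x: "x \<in> A" "b \<in> B" "y = x \<otimes> b" unfolding set_mult_def by blast
    then have "(x, y) \<in> ?S" using A B topspace_eq by (auto simp: inv_mult_cancel subset_eq)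
    then show "y \<in> snd ` ?S" by force
  qed
  ultimately show ?thesis by simp
qed

lemma openin_l_coset:
  assumes "openin T U" "g \<in> carrier G"
  shows "openin T (g <# U)"
proof -
  have U: "U \<subseteq> carrier G" using openin_subset assms topspace_eq by metis
  have "g <# U = {x \<in> topspace T. inv g \<otimes> x \<in> U}"
  proof (intro equalityI subsetI)
    fix x assume "x \<in> {x \<in> topspace T. inv g \<otimes> x \<in> U}"
    then have "inv g \<otimes> x \<in> U" "x = g \<otimes> (inv g \<otimes> x)"
      using assms topspace_eq by (auto simp: mult_inv_cancel)
    then show "x \<in> g <# U" unfolding l_coset_def by blast
  next
    fix x assume "x \<in> g <# U"
    then obtain u where "u \<in> U" "x = g \<otimes> u" unfolding l_coset_def by blast
    then show "x \<in> {x \<in> topspace T. inv g \<otimes> x \<in> U}"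
      using U assms(2) by (simp add: subsetD topspace_eq inv_mult_cancel)
  qed
  moreover have "continuous_map T T (\<lambda>x. inv g \<otimes> x)"
    by (intro continuous_map_mult) (use assms topspace_eq in \<open>auto simp: continuous_map_const\<close>)
  ultimately show ?thesis by (simp add: openin_continuous_map_preimage [OF _ assms(1)])
qed

lemma openin_r_coset:
  assumes "openin T U" "g \<in> carrier G"
  shows "openin T (U #> g)"
proof -
  have U: "U \<subseteq> carrier G" using openin_subset assms topspace_eq by metis
  have "U #> g = {x \<in> topspace T. x \<otimes> inv g \<in> U}"
  proof (intro equalityI subsetI)
    fix x assume "x \<in> {x \<in> topspace T. x \<otimes> inv g \<in> U}"
    then have "x \<otimes> inv g \<in> U" "x = (x \<otimes> inv g) \<otimes> g"
      using assms topspace_eq by (auto simp: m_assoc)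
    then show "x \<in> U #> g" unfolding r_coset_def by blast
  next
    fix x assume "x \<in> U #> g"
    then obtain u where "u \<in> U" "x = u \<otimes> g" unfolding r_coset_def by blast
    then show "x \<in> {x \<in> topspace T. x \<otimes> inv g \<in> U}"
      using U assms(2) by (simp add: subsetD topspace_eq m_assoc)
  qed
  moreover have "continuous_map T T (\<lambda>x. x \<otimes> inv g)"
    by (intro continuous_map_mult) (use assms topspace_eq in \<open>auto simp: continuous_map_const\<close>)
  ultimately show ?thesis by (simp add: openin_continuous_map_preimage [OF _ assms(1)])
qed

lemma openin_set_mult_left:
  assumes "openin T U" "A \<subseteq> carrier G"
  shows "openin T (U <#> A)"
proof -
  have "U <#> A = (\<Union>a\<in>A. U #> a)" by (auto simp: set_mult_def r_coset_def)
  then show ?thesis using openin_r_coset assms by (auto intro!: openin_Union)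
qed

lemma openin_set_mult_right:
  assumes "openin T U" "A \<subseteq> carrier G"
  shows "openin T (A <#> U)"
proof -
  have "A <#> U = (\<Union>a\<in>A. a <# U)" by (auto simp: set_mult_def l_coset_def)
  then show ?thesis using openin_l_coset assms by (auto intro!: openin_Union)
qed

lemma openin_subgroup:
  assumes "subgroup H G" "openin T U" "\<one> \<in> U" "U \<subseteq> H"
  shows "openin T H"
proof -
  have "H = H <#> U"
  proof
    show "H \<subseteq> H <#> U"
    proof
      fix h assume "h \<in> H"
      then have "h = h \<otimes> \<one>" using subgroup.mem_carrier [OF assms(1)] by simp
      then show "h \<in> H <#> U" using \<open>h \<in> H\<close> assms(3) unfolding set_mult_def by blast
    qed
    show "H <#> U \<subseteq> H"
      using assms subgroup.m_closed [OF assms(1)] by (auto simp: set_mult_def)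
  qed
  then show ?thesis using openin_set_mult_right assms subgroup.subset by metis
qed

lemma topological_group_subgroup:
  assumes "subgroup H G"
  shows "topological_group (G\<lparr>carrier := H\<rparr>) (subtopology T H)"
proof -
  interpret H: group "G\<lparr>carrier := H\<rparr>" using subgroup_imp_group [OF assms] .
  have sub: "H \<subseteq> carrier G" using assms subgroup.subset by blast
  have "continuous_map (prod_topology (subtopology T H) (subtopology T H)) (subtopology T H)
      (\<lambda>(x, y). x \<otimes> y)"
    unfolding continuous_map_in_subtopology subtopology_Times
    using continuous_map_from_subtopology [OF continuous_mult] subgroup.m_closed [OF assms]
    by (auto simp: subtopology_Times [symmetric])
  moreover have "continuous_map (subtopology T H) (subtopology T H) (\<lambda>x. inv x)"
    unfolding continuous_map_in_subtopology
    using continuous_map_from_subtopology [OF continuous_inv] subgroup.m_inv_closed [OF assms]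
    by auto
  then have "continuous_map (subtopology T H) (subtopology T H) (\<lambda>x. inv\<^bsub>G\<lparr>carrier := H\<rparr>\<^esub> x)"
    by (rule continuous_map_eq) (simp add: assms topspace_eq)
  ultimately show ?thesis
    by unfold_locales (use sub topspace_eq in auto)
qed

text \<open>Two points of \<open>\<Gamma>\<close> close to \<open>x\<close> have a quotient close to
  the identity, hence trivial; so a small neighbourhood of \<open>x\<close> meets \<open>B\<close>
  at most once, and that point can be removed. Arbitrary \<open>B\<close> are allowed because
  \<open>closedin_bounded_mod\<close> needs \<open>\<Gamma> \<inter> A\<close> to be closed before
  \<open>A\<close> is known to be.\<close>

lemma closedin_subset_discrete:
  assumes "Hausdorff_space T" "subgroup \<Gamma> G" "subtopology T \<Gamma> = discrete_topology \<Gamma>" "B \<subseteq> \<Gamma>"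
  shows "closedin T B"
proof -
  have \<Gamma>: "\<Gamma> \<subseteq> carrier G" by (rule subgroup.subset [OF assms(2)])
  have "openin (subtopology T \<Gamma>) {\<one>}"
    unfolding assms(3) using subgroup.one_closed [OF assms(2)] by simp
  then obtain W where W: "openin T W" "W \<inter> \<Gamma> = {\<one>}"
    by (auto simp: openin_subtopology)
  let ?P = "{z \<in> topspace (prod_topology T T). fst z \<otimes> inv (snd z) \<in> W}"
  have cont: "continuous_map (prod_topology T T) T (\<lambda>z. fst z \<otimes> inv (snd z))"
    by (intro continuous_map_mult continuous_map_inv continuous_map_fst continuous_map_snd)
  have P: "openin (prod_topology T T) ?P"
    using openin_continuous_map_preimage [OF cont W(1)] .
  have "\<exists>V. openin T V \<and> x \<in> V \<and> V \<subseteq> topspace T - B" if x: "x \<in> topspace T - B" for x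
  proof -
    have "(x, x) \<in> ?P" using x topspace_eq W by auto
    then have "\<exists>U V. openin T U \<and> openin T V \<and> x \<in> U \<and> x \<in> V \<and> U \<times> V \<subseteq> ?P"
      by (rule openin_prod_topology_alt [THEN iffD1, OF P, rule_format])
    then obtain U V where UV: "openin T U" "openin T V" "x \<in> U" "x \<in> V" "U \<times> V \<subseteq> ?P"
      by (elim exE conjE)
    have uniq: "a = b" if "a \<in> U \<inter> V \<inter> B" "b \<in> U \<inter> V \<inter> B" for a b
    proof -
      have "a \<otimes> inv b \<in> W" using that UV(5) by auto
      moreover have "a \<otimes> inv b \<in> \<Gamma>"
        using that assms(4) subgroup.m_closed [OF assms(2)] subgroup.m_inv_closed [OF assms(2)]
        by blast
      ultimately have "a \<otimes> inv b = \<one>" using W by blast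
      moreover have "a \<in> carrier G" "b \<in> carrier G" using that assms(4) \<Gamma> by blast+
      ultimately show ?thesis by (metis inv_equality inv_inv inv_closed)
    qed
    show ?thesis
    proof (cases "U \<inter> V \<inter> B = {}")
      case True
      then show ?thesis
        using UV(1-4) openin_subset [OF UV(1)] by (intro exI [of _ "U \<inter> V"]) auto
    next
      case False
      then obtain b where b: "b \<in> U \<inter> V \<inter> B" by blast
      have "b \<in> topspace T" using b openin_subset [OF UV(1)] by blast
      then have "closedin T {b}" by (rule closedin_Hausdorff_singleton [OF assms(1)])
      then have "openin T (U \<inter> V - {b})" using UV(1,2) by (intro openin_diff openin_Int)
      moreover have "x \<in> U \<inter> V - {b}" using x UV(3,4) b by blast
      moreover have "U \<inter> V - {b} \<subseteq> topspace T - B"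
        using openin_subset [OF UV(1)] uniq [OF _ b] by blast
      ultimately show ?thesis by (intro exI conjI)
    qed
  qed
  then have "openin T (topspace T - B)" by (subst openin_subopen) blast
  then show ?thesis using \<Gamma> assms(4) topspace_eq by (auto simp: closedin_def)
qed

lemma finite_compact_Int_discrete:
  assumes "Hausdorff_space T" "subgroup \<Gamma> G" "subtopology T \<Gamma> = discrete_topology \<Gamma>"
    and "compactin T A"
  shows "finite (A \<inter> \<Gamma>)"
proof -
  have "compactin T (\<Gamma> \<inter> A)"
    using closed_Int_compactin [OF closedin_subset_discrete [OF assms(1-3) subset_refl] assms(4)] .
  moreover have "subtopology T (\<Gamma> \<inter> A) = discrete_topology (\<Gamma> \<inter> A)"
    unfolding subtopology_subtopology [symmetric] assms(3) by simp
  ultimately have "compact_space (discrete_topology (\<Gamma> \<inter> A))"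
    by (simp add: compactin_subspace)
  then show ?thesis
    by (simp add: compact_space_discrete_topology Int_commute)
qed

lemma continuous_map_itc:
  assumes "\<And>f. f \<in> set fs \<Longrightarrow> continuous_map Z T f"
  shows "continuous_map Z T (\<lambda>z. itc (map (\<lambda>f. f z) fs))"
  using assms
proof (induction fs)
  case (Cons f fs)
  show ?case
  proof (cases "fs = []")
    case False
    then show ?thesis
      using Cons by (simp add: itc_Cons commutator_def continuous_map_mult continuous_map_inv)
  qed (use Cons in simp)
qed (simp add: topspace_eq)

end

section \<open>Cocompactness of the lower central series\<close>

text \<open>A model of the subgroup generated by \<open>\<tau>\<close> and a compact neighbourhood
  \<open>C\<close> of the identity; \<open>translation_rigidity\<close> builds the instance. Every
  generator but \<open>\<tau>\<close> has arbitrarily small roots that lie in \<open>C\<close>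
  again, and a single exceptional generator is harmless since it commutes with itself.\<close>

locale cocompact_lattice = topological_group G T
  for G :: "('a, 'b) monoid_scheme" (structure) and T +
  fixes F K C :: "'a set" and \<tau> :: 'a
  assumes finite_F: "finite F" and F_carrier: "F \<subseteq> carrier G"
    and discrete: "\<And>B. B \<subseteq> generate G F \<Longrightarrow> closedin T B"
    and compact_K: "compactin T K" and cocompact: "carrier G \<subseteq> K <#> generate G F"
    and compact_C: "compactin T C" and \<tau>: "\<tau> \<in> carrier G"
    and generates: "generate G (insert \<tau> C) = carrier G"
    and divisible: "\<And>g V. g \<in> C \<Longrightarrow> openin T V \<Longrightarrow> \<one> \<in> V \<Longrightarrow>
      \<exists>u\<in>V \<inter> C. \<exists>m::nat. u [^] m = g"
begin

abbreviation "\<Gamma> \<equiv> generate G F"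

lemma K_carrier: "K \<subseteq> carrier G" and C_carrier: "C \<subseteq> carrier G"
  using compact_K compact_C compactin_subset_carrier by blast+

lemma subgroup_\<Gamma>: "subgroup \<Gamma> G"
  using generate_is_subgroup F_carrier by blast

lemma \<Gamma>_carrier: "\<Gamma> \<subseteq> carrier G"
  using subgroup.subset subgroup_\<Gamma> by blast

lemma \<Gamma>_mult: "x \<in> \<Gamma> \<Longrightarrow> y \<in> \<Gamma> \<Longrightarrow> x \<otimes> y \<in> \<Gamma>"
  using subgroup.m_closed [OF subgroup_\<Gamma>] by blast

text \<open>For a subgroup \<open>A\<close> this is compactness of \<open>A\<close> modulo
  \<open>A \<inter> \<Gamma>\<close>: demanding \<open>B \<subseteq> A\<close> forces the factors
  from \<open>\<Gamma>\<close> into \<open>A\<close>.\<close>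

definition bounded_mod :: "'a set \<Rightarrow> bool" where
  "bounded_mod A \<longleftrightarrow> (\<exists>B. compactin T B \<and> B \<subseteq> A \<and> A \<subseteq> B <#> \<Gamma>)"

lemma bounded_modE:
  assumes "bounded_mod A"
  obtains B where "compactin T B" "B \<subseteq> A" "B \<subseteq> carrier G"
    "\<And>a. a \<in> A \<Longrightarrow> \<exists>b\<in>B. \<exists>\<gamma>\<in>\<Gamma>. a = b \<otimes> \<gamma>"
proof -
  obtain B where B: "compactin T B" "B \<subseteq> A" "A \<subseteq> B <#> \<Gamma>"
    using assms unfolding bounded_mod_def by blast
  then have "\<exists>b\<in>B. \<exists>\<gamma>\<in>\<Gamma>. a = b \<otimes> \<gamma>" if "a \<in> A" for a
    using that unfolding set_mult_def by blast
  then show ?thesis using that B(1,2) compactin_subset_carrier [OF B(1)] by blast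
qed

text \<open>The pieces from which \<open>lc j\<close> is assembled, as preimages of subgroups of its
  quotient by \<open>lc (Suc j)\<close>. Containing \<open>lc (Suc j)\<close> absorbs the error
  terms of multilinearity; \<open>bounded_mod\<close> makes a layer closed.\<close>

definition layer :: "nat \<Rightarrow> 'a set \<Rightarrow> bool" where
  "layer j A \<longleftrightarrow> subgroup A G \<and> lc (Suc j) \<subseteq> A \<and> A \<subseteq> lc j \<and> bounded_mod A"

lemma layerD:
  assumes "layer j A"
  shows "subgroup A G" "lc (Suc j) \<subseteq> A" "A \<subseteq> lc j" "bounded_mod A"
  using assms by (auto simp: layer_def)

text \<open>Here \<open>A\<close> is the product of the compact set \<open>B\<close> and the closed
  set \<open>\<Gamma> \<inter> A\<close>.\<close>

lemma closedin_bounded_mod: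
  assumes "subgroup A G" "bounded_mod A"
  shows "closedin T A"
proof -
  obtain B where B: "compactin T B" "B \<subseteq> A" "B \<subseteq> carrier G"
    "\<And>a. a \<in> A \<Longrightarrow> \<exists>b\<in>B. \<exists>\<gamma>\<in>\<Gamma>. a = b \<otimes> \<gamma>"
    using assms(2) by (rule bounded_modE) blast
  have "A = B <#> (\<Gamma> \<inter> A)"
  proof (intro equalityI subsetI)
    fix a assume a: "a \<in> A"
    then obtain b \<gamma> where b: "b \<in> B" "\<gamma> \<in> \<Gamma>" "a = b \<otimes> \<gamma>" using B(4) by blast
    then have "\<gamma> = inv b \<otimes> a" using B(3) \<Gamma>_carrier by (auto simp: inv_mult_cancel subset_eq)
    then have "\<gamma> \<in> A"
      using a b(1) B(2) subgroup.m_closed [OF assms(1)] subgroup.m_inv_closed [OF assms(1)] by blast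
    then show "a \<in> B <#> (\<Gamma> \<inter> A)" using b unfolding set_mult_def by blast
  next
    fix a assume "a \<in> B <#> (\<Gamma> \<inter> A)"
    then show "a \<in> A"
      using B(2) subgroup.m_closed [OF assms(1)] unfolding set_mult_def by blast
  qed
  moreover have "closedin T (B <#> (\<Gamma> \<inter> A))"
    using B(1) discrete by (intro closedin_compact_set_mult) auto
  ultimately show ?thesis by simp
qed

text \<open>The quotient of \<open>lc j\<close> by \<open>lc (Suc j)\<close> is central in that of
  \<open>G\<close>, which makes every subgroup in between normal.\<close>

lemma normal_layer:
  assumes "subgroup A G" "lc (Suc j) \<subseteq> A" "A \<subseteq> lc j"
  shows "A \<lhd> G"
proof (rule normal_invI [OF assms(1)])
  fix g x assume gx: "g \<in> carrier G" "x \<in> A"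
  then have "comm g x \<in> A" "x \<in> carrier G"
    using assms(2,3) commutator_in_lc_Suc [of g x j] subgroup.mem_carrier [OF assms(1)] by auto
  moreover have "g \<otimes> x \<otimes> inv g = comm g x \<otimes> x"
    using gx \<open>x \<in> carrier G\<close> by (simp add: word_simps)
  ultimately show "g \<otimes> x \<otimes> inv g \<in> A"
    using gx subgroup.m_closed [OF assms(1)] by simp
qed

text \<open>With \<open>p = k \<gamma>\<close> and \<open>q = k' \<gamma>'\<close>, moving
  \<open>\<gamma>\<close> past \<open>k'\<close> costs a commutator in \<open>lc (Suc j)\<close>.
  Its compact part goes into \<open>N'\<close>; this is why cocompactness is proved starting from
  the deepest term.\<close>

lemma layer_mult:
  assumes A: "layer j A" and B: "layer j B" and N: "bounded_mod (lc (Suc j))"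
  shows "layer j (A <#> B)"
proof -
  note a = layerD [OF A] and b = layerD [OF B]
  have sub: "A <#> B \<subseteq> lc j" using a(3) b(3) lc_mult unfolding set_mult_def by blast
  have "lc (Suc j) \<subseteq> A <#> B"
  proof
    fix x assume "x \<in> lc (Suc j)"
    then have "x \<in> A" "x = x \<otimes> \<one>" using a(2) lc_closed by auto
    then show "x \<in> A <#> B" using subgroup.one_closed [OF b(1)] unfolding set_mult_def by blast
  qed
  moreover have "subgroup (A <#> B) G"
    by (rule mult_norm_subgroup [OF normal_layer [OF a(1-3)] b(1)])
  moreover have "bounded_mod (A <#> B)"
  proof -
    obtain A' where A': "compactin T A'" "A' \<subseteq> A" "A' \<subseteq> carrier G"
      "\<And>x. x \<in> A \<Longrightarrow> \<exists>b\<in>A'. \<exists>\<gamma>\<in>\<Gamma>. x = b \<otimes> \<gamma>" using a(4) by (rule bounded_modE) blast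
    obtain B' where B': "compactin T B'" "B' \<subseteq> B" "B' \<subseteq> carrier G"
      "\<And>x. x \<in> B \<Longrightarrow> \<exists>b\<in>B'. \<exists>\<gamma>\<in>\<Gamma>. x = b \<otimes> \<gamma>" using b(4) by (rule bounded_modE) blast
    obtain N' where N': "compactin T N'" "N' \<subseteq> lc (Suc j)" "N' \<subseteq> carrier G"
      "\<And>x. x \<in> lc (Suc j) \<Longrightarrow> \<exists>b\<in>N'. \<exists>\<gamma>\<in>\<Gamma>. x = b \<otimes> \<gamma>" using N by (rule bounded_modE) blast
    let ?K = "(A' <#> B') <#> N'"
    have "compactin T ?K" by (intro compactin_set_mult A' B' N')
    moreover have "?K \<subseteq> A <#> B"
    proof
      fix x assume "x \<in> ?K"
      then obtain p q n where x: "p \<in> A'" "q \<in> B'" "n \<in> N'" "x = p \<otimes> q \<otimes> n"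
        unfolding set_mult_def by blast
      then have "x = p \<otimes> (q \<otimes> n)" using A' B' N' by (auto simp: m_assoc subset_eq)
      moreover have "q \<otimes> n \<in> B" using x B' N' b(2) subgroup.m_closed [OF b(1)] by blast
      ultimately show "x \<in> A <#> B" using x A' unfolding set_mult_def by blast
    qed
    moreover have "A <#> B \<subseteq> ?K <#> \<Gamma>"
    proof
      fix x assume "x \<in> A <#> B"
      then obtain p q where pq: "p \<in> A" "q \<in> B" "x = p \<otimes> q" unfolding set_mult_def by blast
      obtain k \<gamma> where k: "k \<in> A'" "\<gamma> \<in> \<Gamma>" "p = k \<otimes> \<gamma>" using A'(4) pq by blast
      obtain k' \<gamma>' where k': "k' \<in> B'" "\<gamma>' \<in> \<Gamma>" "q = k' \<otimes> \<gamma>'" using B'(4) pq by blast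
      have c: "k \<in> carrier G" "k' \<in> carrier G" "\<gamma> \<in> carrier G" "\<gamma>' \<in> carrier G"
        using k k' A' B' \<Gamma>_carrier by auto
      have "comm (inv k') \<gamma> \<in> lc (Suc j)"
        using commutator_in_lc [of "inv k'" j \<gamma> 0] c k' B' b(3) lc_inv by auto
      then obtain n \<gamma>'' where n: "n \<in> N'" "\<gamma>'' \<in> \<Gamma>" "comm (inv k') \<gamma> = n \<otimes> \<gamma>''"
        using N'(4) by blast
      have c': "n \<in> carrier G" "\<gamma>'' \<in> carrier G" using n N' \<Gamma>_carrier by auto
      have "x = k \<otimes> k' \<otimes> comm (inv k') \<gamma> \<otimes> (\<gamma> \<otimes> \<gamma>')"
        using pq k k' c by (simp add: word_simps)
      also have "\<dots> = k \<otimes> k' \<otimes> n \<otimes> (\<gamma>'' \<otimes> (\<gamma> \<otimes> \<gamma>'))"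
        unfolding n using c c' by (simp add: m_assoc)
      finally have "x = k \<otimes> k' \<otimes> n \<otimes> (\<gamma>'' \<otimes> (\<gamma> \<otimes> \<gamma>'))" .
      moreover have "\<gamma>'' \<otimes> (\<gamma> \<otimes> \<gamma>') \<in> \<Gamma>" using n k k' \<Gamma>_mult by blast
      ultimately show "x \<in> ?K <#> \<Gamma>" using k k' n unfolding set_mult_def by blast
    qed
    ultimately show ?thesis unfolding bounded_mod_def by blast
  qed
  ultimately show ?thesis using sub by (simp add: layer_def)
qed

lemma layer_join:
  assumes "finite \<E>" "\<And>A. A \<in> \<E> \<Longrightarrow> layer j A" "bounded_mod (lc (Suc j))"
  shows "\<exists>R. layer j R \<and> \<Union>\<E> \<subseteq> R"
  using assms(1,2)
proof (induction \<E>)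
  case empty
  have "layer j (lc (Suc j))" using assms(3) subgroup_lc lc_Suc_subset by (simp add: layer_def)
  then show ?case by blast
next
  case (insert A \<E>)
  then obtain R where R: "layer j R" "\<Union>\<E> \<subseteq> R" by auto
  have A: "layer j A" using insert by simp
  have sub: "A \<subseteq> A <#> R" "R \<subseteq> A <#> R"
    using subgroup.one_closed [OF layerD(1) [OF A]] subgroup.one_closed [OF layerD(1) [OF R(1)]]
      subgroup.mem_carrier [OF layerD(1) [OF A]] subgroup.mem_carrier [OF layerD(1) [OF R(1)]]
    unfolding set_mult_def by force+
  then show ?case using layer_mult [OF A R(1) assms(3)] R(2) by blast
qed

text \<open>As \<open>G = K \<Gamma>\<close> and \<open>f\<close> maps \<open>\<Gamma>\<close> into
  itself, the image of the compact \<open>K\<close> is enough modulo \<open>\<Gamma>\<close>. The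
  error terms in \<open>lc (Suc j)\<close> are conjugated past \<open>f \<gamma>\<close> and then
  split by the cocompactness of that term.\<close>

lemma layer_hom_mod:
  assumes f: "hom_mod j f" "continuous_map T T f" "\<And>\<gamma>. \<gamma> \<in> \<Gamma> \<Longrightarrow> f \<gamma> \<in> \<Gamma>"
    and N: "bounded_mod (lc (Suc j))"
  shows "layer j (f ` carrier G <#> lc (Suc j))"
proof -
  let ?A = "f ` carrier G <#> lc (Suc j)"
  note fc = hom_modD(1) [OF f(1)] 
  have f_carrier: "f x \<in> carrier G" if "x \<in> carrier G" for x using fc that lc_closed by blast
  have mem: "f x \<otimes> n \<in> ?A" if "x \<in> carrier G" "n \<in> lc (Suc j)" for x n
    using that unfolding set_mult_def by blast
  have sub: "?A \<subseteq> lc j" using fc lc_Suc_subset lc_mult unfolding set_mult_def by blast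
  have "subgroup ?A G"
  proof (rule subgroup.intro)
    show "?A \<subseteq> carrier G" using sub lc_closed by blast
    have "f \<one> \<otimes> inv (f \<one>) \<in> ?A" using hom_mod_one [OF f(1)] lc_inv by (intro mem) auto
    then show "\<one> \<in> ?A" using f_carrier by simp
    fix a b assume ab: "a \<in> ?A" 
    then obtain x n where a: "x \<in> carrier G" "n \<in> lc (Suc j)" "a = f x \<otimes> n"
      unfolding set_mult_def by blast
    obtain l where l: "l \<in> lc (Suc j)" "f (inv x) = inv (f x) \<otimes> l"
      using hom_mod_inv [OF f(1) a(1)] by blast
    have c: "n \<in> carrier G" "l \<in> carrier G" "f x \<in> carrier G" using a l lc_closed f_carrier by blast+
    have "inv a = f (inv x) \<otimes> (inv l \<otimes> (f x \<otimes> inv n \<otimes> inv (f x)))"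
      unfolding a l using c by (simp add: word_simps)
    moreover have "inv l \<otimes> (f x \<otimes> inv n \<otimes> inv (f x)) \<in> lc (Suc j)"
      by (intro lc_mult lc_inv lc_conj a l c)
    ultimately show "inv a \<in> ?A" using mem [OF inv_closed [OF a(1)]] by simp
    assume "b \<in> ?A"
    then obtain y m where b: "y \<in> carrier G" "m \<in> lc (Suc j)" "b = f y \<otimes> m"
      unfolding set_mult_def by blast
    obtain k where k: "k \<in> lc (Suc j)" "f (x \<otimes> y) = f x \<otimes> f y \<otimes> k"
      using hom_modD(2) [OF f(1) a(1) b(1)] by blast
    have c': "m \<in> carrier G" "k \<in> carrier G" "f y \<in> carrier G" using b k lc_closed f_carrier by blast+
    have "a \<otimes> b = f (x \<otimes> y) \<otimes> (inv k \<otimes> ((inv (f y) \<otimes> n \<otimes> f y) \<otimes> m))"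
      unfolding a b k using c c' by (simp add: word_simps)
    moreover have "inv k \<otimes> ((inv (f y) \<otimes> n \<otimes> f y) \<otimes> m) \<in> lc (Suc j)"
      by (intro lc_mult lc_inv lc_conj' a b k c c')
    ultimately show "a \<otimes> b \<in> ?A" using mem [OF m_closed [OF a(1) b(1)]] by simp
  qed
  moreover have "lc (Suc j) \<subseteq> ?A"
  proof
    fix n assume n: "n \<in> lc (Suc j)"
    then have "n = f \<one> \<otimes> (inv (f \<one>) \<otimes> n)" using f_carrier lc_closed by (simp add: mult_inv_cancel)
    moreover have "inv (f \<one>) \<otimes> n \<in> lc (Suc j)"
      using n hom_mod_one [OF f(1)] lc_inv lc_mult by blast
    ultimately show "n \<in> ?A" using mem [OF one_closed] by fastforce
  qed
  moreover have "bounded_mod ?A"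
  proof -
    obtain N' where N': "compactin T N'" "N' \<subseteq> lc (Suc j)" "N' \<subseteq> carrier G"
      "\<And>x. x \<in> lc (Suc j) \<Longrightarrow> \<exists>b\<in>N'. \<exists>\<gamma>\<in>\<Gamma>. x = b \<otimes> \<gamma>" using N by (rule bounded_modE) blast
    have "compactin T (f ` K <#> N')"
      using compactin_set_mult image_compactin compact_K f(2) N'(1) by blast
    moreover have "f ` K <#> N' \<subseteq> ?A"
      using K_carrier N'(2) unfolding set_mult_def by blast
    moreover have "?A \<subseteq> (f ` K <#> N') <#> \<Gamma>"
    proof
      fix a assume "a \<in> ?A"
      then obtain x n where a: "x \<in> carrier G" "n \<in> lc (Suc j)" "a = f x \<otimes> n"
        unfolding set_mult_def by blast
      obtain k \<gamma> where k: "k \<in> K" "\<gamma> \<in> \<Gamma>" "x = k \<otimes> \<gamma>"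
        using cocompact a(1) unfolding set_mult_def by blast
      have kc: "k \<in> carrier G" "\<gamma> \<in> carrier G" using k K_carrier \<Gamma>_carrier by auto
      obtain l where l: "l \<in> lc (Suc j)" "f x = f k \<otimes> f \<gamma> \<otimes> l"
        using hom_modD(2) [OF f(1) kc] k by blast
      have c: "f k \<in> carrier G" "f \<gamma> \<in> carrier G" "l \<in> carrier G" "n \<in> carrier G"
        using kc f_carrier l a lc_closed by blast+
      have "f \<gamma> \<otimes> (l \<otimes> n) \<otimes> inv (f \<gamma>) \<in> lc (Suc j)" by (intro lc_mult lc_conj c l a)
      then obtain m \<gamma>' where m: "m \<in> N'" "\<gamma>' \<in> \<Gamma>" "f \<gamma> \<otimes> (l \<otimes> n) \<otimes> inv (f \<gamma>) = m \<otimes> \<gamma>'"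
        using N'(4) by blast
      have mc: "m \<in> carrier G" "\<gamma>' \<in> carrier G" using m N' \<Gamma>_carrier by auto
      have "a = f k \<otimes> (f \<gamma> \<otimes> (l \<otimes> n) \<otimes> inv (f \<gamma>)) \<otimes> f \<gamma>"
        unfolding a l using c by (simp add: word_simps)
      also have "\<dots> = f k \<otimes> m \<otimes> (\<gamma>' \<otimes> f \<gamma>)" unfolding m using c mc by (simp add: m_assoc)
      finally have "a = f k \<otimes> m \<otimes> (\<gamma>' \<otimes> f \<gamma>)" .
      moreover have "\<gamma>' \<otimes> f \<gamma> \<in> \<Gamma>" using m k f(3) \<Gamma>_mult by blast
      ultimately show "a \<in> (f ` K <#> N') <#> \<Gamma>" using k m unfolding set_mult_def by blast
    qed
    ultimately show ?thesis unfolding bounded_mod_def by blast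
  qed
  ultimately show ?thesis using sub by (simp add: layer_def)
qed

end

section \<open>Iterated commutators with entries in generating sets\<close>

context group
begin

lemma itc_replicate: "x \<in> carrier G \<Longrightarrow> itc (replicate (Suc (Suc n)) x) = \<one>"
proof (induction n)
  case (Suc n)
  then show ?case using itc_Cons [of "replicate (Suc (Suc n)) x" x] by simp
qed (simp add: commutator_def m_assoc)

end

context cocompact_lattice
begin

lemma continuous_map_itc_update:
  assumes "set hs \<subseteq> carrier G" "continuous_map Z T f"
  shows "continuous_map Z T (\<lambda>z. itc (hs[i := f z]))"
proof -
  let ?fs = "(map (\<lambda>h z. h) hs)[i := f]"
  have "continuous_map Z T g" if "g \<in> set ?fs" for g
    using set_update_subset_insert [of "map (\<lambda>h z. h) hs" i f] that assms
    by (auto simp: topspace_eq subset_eq)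
  then have "continuous_map Z T (\<lambda>z. itc (map (\<lambda>g. g z) ?fs))" by (rule continuous_map_itc)
  then show ?thesis by (simp add: map_update comp_def)
qed

lemma continuous_map_itc_update2:
  assumes "set hs \<subseteq> carrier G" "continuous_map Z T f" "continuous_map Z T f'"
  shows "continuous_map Z T (\<lambda>z. itc (hs[i := f z, i' := f' z]))"
proof -
  let ?fs = "(map (\<lambda>h z. h) hs)[i := f, i' := f']"
  have "set ?fs \<subseteq> insert f' (insert f (set (map (\<lambda>h z. h) hs)))"
    by (meson insert_mono order_trans set_update_subset_insert)
  then have "continuous_map Z T g" if "g \<in> set ?fs" for g
    using that assms by (auto simp: topspace_eq subset_eq)
  then have "continuous_map Z T (\<lambda>z. itc (map (\<lambda>g. g z) ?fs))" by (rule continuous_map_itc)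
  then show ?thesis by (simp add: map_update comp_def)
qed

text \<open>There are finitely many ways to fill all slots but one from the finite set
  \<open>F\<close>, and each gives a homomorphic image of \<open>G\<close> modulo
  \<open>lc (Suc j)\<close>; \<open>R\<close> is a common upper bound of these layers.\<close>

lemma layer_one_free_slot:
  assumes "bounded_mod (lc (Suc j))"
  shows "\<exists>R. layer j R \<and> (\<forall>hs i. length hs = Suc j \<longrightarrow> set hs \<subseteq> carrier G \<longrightarrow> i < Suc j \<longrightarrow>
    (\<forall>i'<Suc j. i' \<noteq> i \<longrightarrow> hs ! i' \<in> F) \<longrightarrow> itc hs \<in> R)"
proof -
  define A where "A = (\<lambda>(fs, i). (\<lambda>x. itc (fs[i := x])) ` carrier G <#> lc (Suc j))"
  let ?I = "{fs. set fs \<subseteq> insert \<one> F \<and> length fs = Suc j} \<times> {..j}"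
  have F\<Gamma>: "insert \<one> F \<subseteq> \<Gamma>" using generate.incl generate.one by (metis insert_subset subsetI)
  have "layer j (A z)" if z: "z \<in> ?I" for z
  proof -
    obtain fs i where fs: "z = (fs, i)" "set fs \<subseteq> insert \<one> F" "length fs = Suc j" "i < Suc j"
      using z by auto
    have carr: "set fs \<subseteq> carrier G" using fs(2) F_carrier by auto
    have "hom_mod j (\<lambda>x. itc (fs[i := x]))" using hom_mod_itc [OF carr, of i] fs by simp
    moreover have "continuous_map T T (\<lambda>x. itc (fs[i := x]))"
      using carr by (intro continuous_map_itc_update) auto
    moreover have "itc (fs[i := \<gamma>]) \<in> \<Gamma>" if "\<gamma> \<in> \<Gamma>" for \<gamma>
      using itc_mem_subgroup [OF subgroup_\<Gamma>] set_update_subset_insert [of fs i \<gamma>] that fs F\<Gamma> by blast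
    ultimately show ?thesis unfolding A_def fs prod.case by (rule layer_hom_mod [OF _ _ _ assms])
  qed
  moreover have "finite ?I"
    using finite_lists_length_eq [of "insert \<one> F" "Suc j"] finite_F by blast
  ultimately obtain R where R: "layer j R" "\<Union>(A ` ?I) \<subseteq> R"
    using layer_join [of "A ` ?I" j] assms by blast
  have "itc hs \<in> R" if hs: "length hs = Suc j" "set hs \<subseteq> carrier G" "i < Suc j"
    "\<And>i'. i' < Suc j \<Longrightarrow> i' \<noteq> i \<Longrightarrow> hs ! i' \<in> F" for hs i
  proof -
    let ?fs = "hs[i := \<one>]"
    have "?fs ! k \<in> insert \<one> F" if "k < Suc j" for k
      using hs that by (cases "k = i") auto
    then have "set ?fs \<subseteq> insert \<one> F" using hs(1) by (auto simp: set_conv_nth)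
    then have "A (?fs, i) \<subseteq> R" using R(2) hs by (intro order_trans [OF _ R(2)] UN_upper) auto
    moreover have "itc hs = itc (?fs[i := hs ! i]) \<otimes> \<one>"
      using itc_closed [OF hs(2)] by simp
    moreover have "hs ! i \<in> carrier G" using hs nth_mem by auto
    ultimately show ?thesis
      using lc_one unfolding A_def prod.case set_mult_def by blast
  qed
  then show ?thesis using R(1) by blast
qed

text \<open>Induction on the number of slots besides \<open>i\<close> that hold no element of
  \<open>F\<close>. As \<open>R\<close> is closed, it suffices to reach \<open>itc hs\<close> up to
  arbitrarily small errors; this is phrased as a contradiction. The error is the commutator with
  \<open>u\<close> in slot \<open>i\<close> and \<open>k\<close> in slot \<open>i'\<close>, small
  for \<open>u\<close> near \<open>\<one>\<close>. The root \<open>u\<close> lies in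
  \<open>C\<close> again, so the induction hypothesis keeps applying to slot
  \<open>i\<close>.\<close>

lemma itc_mem_layer:
  assumes R: "layer j R"
    and one_slot: "\<And>hs i. length hs = Suc j \<Longrightarrow> set hs \<subseteq> carrier G \<Longrightarrow> i < Suc j \<Longrightarrow>
      (\<And>i'. i' < Suc j \<Longrightarrow> i' \<noteq> i \<Longrightarrow> hs ! i' \<in> F) \<Longrightarrow> itc hs \<in> R"
    and hs: "length hs = Suc j" "set hs \<subseteq> carrier G" "i < Suc j" "hs ! i \<in> C"
  shows "itc hs \<in> R"
  using hs
proof (induction "card {i'. i' < Suc j \<and> i' \<noteq> i \<and> hs ! i' \<notin> F}" arbitrary: hs)
  case 0
  then have "{i'. i' < Suc j \<and> i' \<noteq> i \<and> hs ! i' \<notin> F} = {}" by simp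
  then show ?case using one_slot 0 by blast
next
  case (Suc n)
  note hs = Suc.prems
  note R_sub = layerD(1) [OF R] and R_N = layerD(2) [OF R]
  have "{i'. i' < Suc j \<and> i' \<noteq> i \<and> hs ! i' \<notin> F} \<noteq> {}" using Suc.hyps(2) by force
  then obtain i' where i': "i' < Suc j" "i' \<noteq> i" "hs ! i' \<notin> F" by blast
  let ?g = "hs ! i" and ?h = "hs ! i'" and ?c = "itc hs"
  have h: "?h \<in> carrier G" "?g \<in> carrier G" using hs i' nth_mem by auto
  have c: "?c \<in> carrier G" using itc_closed hs by blast
  show ?case
  proof (rule ccontr)
    assume "?c \<notin> R"
    let ?Z = "prod_topology T T"
    \<comment> \<open>The pairs whose error term differs from \<open>?c\<close> modulo
      \<open>R\<close>; an open set because \<open>R\<close> is closed.\<close>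
    let ?W = "{z \<in> topspace ?Z. inv ?c \<otimes> itc (hs[i := fst z, i' := snd z]) \<in> topspace T - R}"
    have cont: "continuous_map ?Z T (\<lambda>z. inv ?c \<otimes> itc (hs[i := fst z, i' := snd z]))"
      using hs(2) c
      by (intro continuous_map_mult continuous_map_itc_update2 continuous_map_fst continuous_map_snd)
        (simp_all add: topspace_eq)
    have op: "openin T (topspace T - R)"
      using closedin_bounded_mod [OF R_sub layerD(4) [OF R]] by blast
    have W: "openin ?Z ?W" using openin_continuous_map_preimage [OF cont op] .
    have "(\<one>, k) \<in> ?W" if "k \<in> K" for k
    proof -
      have k: "k \<in> carrier G" using that K_carrier by blast
      have "\<one> \<in> set (hs[i := \<one>, i' := k])"
        using hs i' by (subst list_update_swap) (auto intro: set_update_memI)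
      moreover have "set (hs[i := \<one>, i' := k]) \<subseteq> carrier G"
        using hs(2) k by (meson insert_subset one_closed order_trans set_update_subset_insert)
      ultimately have "itc (hs[i := \<one>, i' := k]) = \<one>" using itc_one by blast
      moreover have "inv ?c \<notin> R"
        using \<open>?c \<notin> R\<close> subgroup.m_inv_closed [OF R_sub, of "inv ?c"] c by auto
      ultimately show ?thesis using k c by (simp add: topspace_eq)
    qed
    then have "{\<one>} \<times> K \<subseteq> ?W" by blast
    \<comment> \<open>The element \<open>k\<close> arises from \<open>?h [^] m\<close> and so
      depends on the root \<open>u\<close>, which is chosen before it. The tube lemma gives the
      required uniformity over \<open>K\<close>.\<close>
    then obtain U V where UV: "openin T U" "\<one> \<in> U" "K \<subseteq> V" "U \<times> V \<subseteq> ?W"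
      using tube_lemma_right [OF W compact_K, of \<one>] topspace_eq by auto
    obtain u m where u: "u \<in> U" "u \<in> C" "u [^] (m::nat) = ?g"
      using divisible [OF hs(4) UV(1,2)] by blast
    have uc: "u \<in> carrier G" using u C_carrier by blast
    let ?f1 = "\<lambda>x. itc (hs[i := x])" and ?f2 = "\<lambda>y. itc (hs[i := u, i' := y])"
    have hs': "set (hs[i := u]) \<subseteq> carrier G"
      using hs(2) uc by (meson insert_subset order_trans set_update_subset_insert)
    have f1: "hom_mod j ?f1" using hom_mod_itc [OF hs(2), of i] hs by simp
    have f2: "hom_mod j ?f2" using hom_mod_itc [OF hs', of i'] hs i' by simp
    have f1f2: "?f1 u = ?f2 ?h"
      using i' hs by (simp add: list_update_swap [of i i' hs])
    obtain l1 where l1: "l1 \<in> lc (Suc j)" "?c = ?f1 u [^] m \<otimes> l1"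
      using hom_mod_pow [OF f1 uc, of m] u(3) by auto
    obtain l2 where l2: "l2 \<in> lc (Suc j)" "?f2 (?h [^] m) = ?f2 ?h [^] m \<otimes> l2"
      using hom_mod_pow [OF f2 h(1), of m] by auto
    obtain k \<gamma> where k: "k \<in> K" "\<gamma> \<in> \<Gamma>" "?h [^] m = k \<otimes> \<gamma>"
      using cocompact nat_pow_closed [OF h(1), of m] unfolding set_mult_def by blast
    have kc: "k \<in> carrier G" "\<gamma> \<in> carrier G" using k K_carrier \<Gamma>_carrier by auto
    obtain l3 where l3: "l3 \<in> lc (Suc j)" "?f2 (k \<otimes> \<gamma>) = ?f2 k \<otimes> ?f2 \<gamma> \<otimes> l3"
      using hom_modD(2) [OF f2 kc] by blast
    \<comment> \<open>An element of \<open>F\<close> in slot \<open>i'\<close> lowers the induction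
      measure, and multilinearity extends membership in \<open>R\<close> from \<open>F\<close> to
      all of \<open>\<Gamma>\<close>.\<close>
    have "F \<subseteq> {y \<in> carrier G. ?f2 y \<in> R}"
    proof
      fix y assume y: "y \<in> F"
      let ?hs = "hs[i := u, i' := y]"
      have "{k. k < Suc j \<and> k \<noteq> i \<and> hs ! k \<notin> F} =
          insert i' {k. k < Suc j \<and> k \<noteq> i \<and> ?hs ! k \<notin> F}"
        using i' hs y by (auto simp: nth_list_update)
      moreover have "i' \<notin> {k. k < Suc j \<and> k \<noteq> i \<and> ?hs ! k \<notin> F}"
        using i' hs y by simp
      ultimately have "n = card {k. k < Suc j \<and> k \<noteq> i \<and> ?hs ! k \<notin> F}"
        using Suc.hyps(2) by simp
      moreover have "set ?hs \<subseteq> carrier G"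
        using hs' y F_carrier by (meson insert_subset order_trans set_update_subset_insert subsetD)
      ultimately have "itc ?hs \<in> R" using Suc.hyps(1) [of ?hs] hs i' u by simp
      then show "y \<in> {y \<in> carrier G. ?f2 y \<in> R}" using y F_carrier by blast
    qed
    then have "\<Gamma> \<subseteq> {y \<in> carrier G. ?f2 y \<in> R}"
      by (rule generate_subgroup_incl [OF _ subgroup_vimage_hom_mod [OF f2 R_sub R_N]])
    then have \<gamma>R: "?f2 \<gamma> \<in> R" using k by blast
    have cl: "l1 \<in> carrier G" "l2 \<in> carrier G" "l3 \<in> carrier G" "?f2 k \<in> carrier G"
      "?f2 \<gamma> \<in> carrier G" "?f2 ?h \<in> carrier G"
      using l1 l2 l3 hom_modD(1) [OF f2] kc h lc_closed by blast+
    let ?r = "?f2 \<gamma> \<otimes> (l3 \<otimes> (inv l2 \<otimes> l1))"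
    have r: "?r \<in> R"
      using \<gamma>R l1 l2 l3 R_N lc_mult lc_inv subgroup.m_closed [OF R_sub] by (meson subsetD)
    \<comment> \<open>Modulo \<open>lc (Suc j)\<close> the exponent \<open>m\<close> leaves slot
      \<open>i\<close> and enters slot \<open>i'\<close>, where \<open>?h [^] m\<close> splits into
      \<open>k\<close> and \<open>\<gamma>\<close>.\<close>
    have "?c = (?f2 ?h [^] m \<otimes> l2) \<otimes> (inv l2 \<otimes> l1)"
      unfolding l1(2) f1f2 using cl by (simp add: m_assoc mult_inv_cancel)
    also have "?f2 ?h [^] m \<otimes> l2 = ?f2 k \<otimes> ?f2 \<gamma> \<otimes> l3"
      using l2(2) l3(2) k(3) by simp
    also have "\<dots> \<otimes> (inv l2 \<otimes> l1) = ?f2 k \<otimes> ?r"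
      using cl by (simp add: m_assoc)
    finally have "inv ?c \<otimes> ?f2 k = inv ?r"
      using cl by (simp add: word_simps)
    then have "inv ?c \<otimes> ?f2 k \<in> R" using r subgroup.m_inv_closed [OF R_sub] by simp
    moreover have "(u, k) \<in> ?W" using UV(3,4) u(1) k(1) by blast
    ultimately show False by simp
  qed
qed

text \<open>The commutators of generators concerned here have at least two entries: either one of
  them lies in \<open>C\<close> and is divisible, or all are \<open>\<tau>\<close> and the
  commutator is trivial.\<close>

lemma bounded_mod_lc_step:
  assumes "bounded_mod (lc (Suc (Suc j)))"
  shows "bounded_mod (lc (Suc j))"
proof -
  obtain R where R: "layer (Suc j) R" and one_slot:
    "\<And>hs i. length hs = Suc (Suc j) \<Longrightarrow> set hs \<subseteq> carrier G \<Longrightarrow> i < Suc (Suc j) \<Longrightarrow>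
      (\<And>i'. i' < Suc (Suc j) \<Longrightarrow> i' \<noteq> i \<Longrightarrow> hs ! i' \<in> F) \<Longrightarrow> itc hs \<in> R"
    using layer_one_free_slot [OF assms] by blast
  have "itc ss \<in> R" if ss: "set ss \<subseteq> insert \<tau> C" "length ss = Suc (Suc j)" for ss
  proof (cases "\<exists>i < Suc (Suc j). ss ! i \<in> C")
    case True
    then obtain i where i: "i < Suc (Suc j)" "ss ! i \<in> C" by blast
    have "set ss \<subseteq> carrier G" using ss(1) C_carrier \<tau> by auto
    then show ?thesis by (intro itc_mem_layer [OF R one_slot ss(2) _ i])
  next
    case False
    have "y = \<tau>" if y: "y \<in> set ss" for y
    proof -
      obtain i where "i < length ss" "y = ss ! i" using y by (auto simp: in_set_conv_nth)
      then have "y \<notin> C" using False ss(2) by simp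
      then show ?thesis using y ss(1) by blast
    qed
    then have "ss = replicate (Suc (Suc j)) \<tau>"
      by (intro replicate_eqI ss(2))
    then have "itc ss = \<one>" using itc_replicate [OF \<tau>, of j] by simp
    then show ?thesis using subgroup.one_closed [OF layerD(1) [OF R]] by simp
  qed
  moreover have "insert \<tau> C \<subseteq> carrier G" using C_carrier \<tau> by simp
  ultimately have "lc (Suc j) \<subseteq> R"
    using subgroup_lc_le [OF layerD(1,2) [OF R]] generates by metis
  then have "R = lc (Suc j)" using layerD(3) [OF R] by blast
  then show ?thesis using layerD(4) [OF R] by simp
qed

theorem bounded_mod_lc:
  assumes "lc d = {\<one>}"
  shows "bounded_mod (lc j)"
proof -
  have triv: "bounded_mod (lc j)" if "d \<le> j" for j
  proof -
    have "lc j = {\<one>}" using lc_antimono [OF that] assms lc_one by blast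
    moreover have "\<one> \<otimes> \<one> \<in> {\<one>} <#> \<Gamma>"
      using subgroup.one_closed [OF subgroup_\<Gamma>] unfolding set_mult_def by blast
    ultimately show ?thesis
      unfolding bounded_mod_def by (intro exI [of _ "{\<one>}"]) (simp add: topspace_eq)
  qed
  have Suc: "bounded_mod (lc (Suc i))" for i
  proof (cases "d \<le> Suc i")
    case False
    then have "Suc i \<le> d" by simp
    then show ?thesis
    proof (induction rule: inc_induct)
      case base
      then show ?case using triv by simp
    next
      case (step n)
      then show ?case using bounded_mod_lc_step by (metis Suc_le_D)
    qed
  qed (use triv in blast)
  show ?thesis
  proof (cases j)
    \<comment> \<open>For the whole group cocompactness is an assumption. The descent ends one term
      before, since a commutator with one entry may be \<open>\<tau>\<close> itself.\<close>
    case 0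
    then show ?thesis
      unfolding bounded_mod_def using compact_K cocompact K_carrier by auto
  qed (use Suc in blast)
qed

end

section \<open>Host--Kra cubes\<close>

text \<open>A cube of dimension \<open>k\<close> is a function of the subsets \<open>I\<close> of \<open>{..<k}\<close>, the vertices;
  it is extended to all \<open>I\<close> so as to depend only on \<open>I \<inter> {..<k}\<close>.\<close>

definition face_join :: "('a, 'b) monoid_scheme \<Rightarrow> nat \<Rightarrow> (nat set \<Rightarrow> 'a) \<Rightarrow> (nat set \<Rightarrow> 'a) \<Rightarrow> nat set \<Rightarrow> 'a"
  where "face_join G k a b = (\<lambda>I. a I \<otimes>\<^bsub>G\<^esub> (if k \<in> I then b I else \<one>\<^bsub>G\<^esub>))"

text \<open>Unwound, a cube is an ordered product of factors
  \<open>g_J \<in> A (i + card J)\<close>, one for each \<open>J \<subseteq> {..<k}\<close>, where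
  \<open>g_J\<close> acts on the vertices \<open>I\<close> containing \<open>J\<close>. The
  \<open>A i\<close> are arbitrary sets so that the same recursion, fed with compact sets, gives the
  compact part of a cube.\<close>

primrec cubes :: "('a, 'b) monoid_scheme \<Rightarrow> (nat \<Rightarrow> 'a set) \<Rightarrow> nat \<Rightarrow> nat \<Rightarrow> (nat set \<Rightarrow> 'a) set" where
  "cubes G A 0 i = (\<lambda>g I. g) ` A i"
| "cubes G A (Suc k) i = {face_join G k a b |a b. a \<in> cubes G A k i \<and> b \<in> cubes G A k (Suc i)}"

lemma cubes_SucI: "a \<in> cubes G A k i \<Longrightarrow> b \<in> cubes G A k (Suc i) \<Longrightarrow> face_join G k a b \<in> cubes G A (Suc k) i"
  by auto

lemma cubes_mono:
  assumes "\<And>i. A i \<subseteq> B i"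
  shows "cubes G A k i \<subseteq> cubes G B k i"
proof (induction k arbitrary: i)
  case 0
  then show ?case using assms by auto
next
  case (Suc k)
  show ?case
  proof
    fix x assume "x \<in> cubes G A (Suc k) i"
    then obtain a b where "x = face_join G k a b" "a \<in> cubes G A k i" "b \<in> cubes G A k (Suc i)"
      by auto
    then show "x \<in> cubes G B (Suc k) i" using Suc.IH by (blast intro: cubes_SucI)
  qed
qed

lemma cubes_local: "x \<in> cubes G A k i \<Longrightarrow> I \<inter> {..<k} = I' \<inter> {..<k} \<Longrightarrow> x I = x I'"
proof (induction k arbitrary: i x)
  case (Suc k)
  then obtain a b where x: "x = face_join G k a b" "a \<in> cubes G A k i" "b \<in> cubes G A k (Suc i)"
    by auto
  have "I \<inter> {..<k} = I' \<inter> {..<k}" "k \<in> I \<longleftrightarrow> k \<in> I'"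
    using Suc.prems(2) by (auto simp: set_eq_iff less_Suc_eq)
  then show ?case using Suc.IH [OF x(2)] Suc.IH [OF x(3)] by (simp add: x(1) face_join_def)
qed auto

section \<open>Group structure, corners and decomposition of cubes\<close>

context group
begin

definition filtration :: "(nat \<Rightarrow> 'a set) \<Rightarrow> bool" where
  "filtration A \<longleftrightarrow> (\<forall>i. subgroup (A i) G) \<and> (\<forall>i. A (Suc i) \<subseteq> A i) \<and>
    (\<forall>i j. \<forall>x\<in>A i. \<forall>y\<in>A j. comm x y \<in> A (i + j))"

lemma filtrationD:
  assumes "filtration A"
  shows "subgroup (A i) G" "A (Suc i) \<subseteq> A i"
    "x \<in> A i \<Longrightarrow> y \<in> A j \<Longrightarrow> comm x y \<in> A (i + j)"
  using assms unfolding filtration_def by blast+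

lemma cubes_closed:
  assumes "\<And>i. A i \<subseteq> carrier G" "x \<in> cubes G A k i"
  shows "x I \<in> carrier G"
  using assms(2)
proof (induction k arbitrary: i x)
  case (Suc k)
  then show ?case by (fastforce simp: face_join_def)
qed (use assms(1) in auto)

lemma cubes_mem_subgroup:
  assumes "subgroup H G" "\<And>i. A i \<subseteq> H" "x \<in> cubes G A k i"
  shows "x I \<in> H"
  using assms(3)
proof (induction k arbitrary: i x)
  case (Suc k)
  then obtain a b where x: "x = face_join G k a b" "a \<in> cubes G A k i" "b \<in> cubes G A k (Suc i)"
    by auto
  then show ?case
    using Suc.IH subgroup.m_closed [OF assms(1)] subgroup.one_closed [OF assms(1)]
    by (auto simp: face_join_def)
qed (use assms(2) in auto)

context
  fixes A assumes filt: "filtration A"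
begin

lemma filt_carrier: "A i \<subseteq> carrier G"
  using filtrationD(1) [OF filt] subgroup.subset by blast

lemma cube_carrier: "x \<in> cubes G A k i \<Longrightarrow> x I \<in> carrier G"
  using cubes_closed filt_carrier by blast

lemma const_cube: "g \<in> A i \<Longrightarrow> (\<lambda>I. g) \<in> cubes G A k i"
proof (induction k arbitrary: i g)
  case (Suc k)
  have "(\<lambda>I. g) = face_join G k (\<lambda>I. g) (\<lambda>I. \<one>)"
    using Suc.prems filt_carrier [of i] by (auto simp: face_join_def fun_eq_iff)
  moreover have "\<one> \<in> A (Suc i)"
    by (rule subgroup.one_closed [OF filtrationD(1) [OF filt]])
  ultimately show ?case using cubes_SucI [OF Suc.IH [OF Suc.prems] Suc.IH [of "\<one>" "Suc i"]] by simp
qed auto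

lemma cubes_Suc_subset: "cubes G A k (Suc i) \<subseteq> cubes G A k i"
proof (induction k arbitrary: i)
  case 0
  then show ?case using filtrationD(2) [OF filt] by auto
next
  case (Suc k)
  show ?case
  proof
    fix x assume "x \<in> cubes G A (Suc k) (Suc i)"
    then obtain a b where "x = face_join G k a b" "a \<in> cubes G A k (Suc i)" "b \<in> cubes G A k (Suc (Suc i))"
      by auto
    then show "x \<in> cubes G A (Suc k) i" using Suc.IH by (blast intro: cubes_SucI)
  qed
qed

lemma cubes_antimono: "i \<le> j \<Longrightarrow> cubes G A k j \<subseteq> cubes G A k i"
  using cubes_Suc_subset by (rule lift_Suc_antimono_le)

text \<open>Normalising a product conjugates the upper-face factor \<open>b\<close> by
  \<open>c\<close>, which costs a commutator of cubes of one dimension less; normalising a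
  commutator in turn uses products and inverses. The three claims therefore go through one induction
  in which \<open>i\<close> and \<open>j\<close> vary.\<close>

lemma cubes_group:
  shows cube_mult: "x \<in> cubes G A k i \<Longrightarrow> y \<in> cubes G A k i \<Longrightarrow> (\<lambda>I. x I \<otimes> y I) \<in> cubes G A k i"
    and cube_inv: "x \<in> cubes G A k i \<Longrightarrow> (\<lambda>I. inv (x I)) \<in> cubes G A k i"
    and cube_commutator: "x \<in> cubes G A k i \<Longrightarrow> y \<in> cubes G A k j \<Longrightarrow>
      (\<lambda>I. comm (x I) (y I)) \<in> cubes G A k (i + j)"
proof (induction k arbitrary: i j x y)
  case 0
  {
    case 1
    then show ?case using subgroup.m_closed [OF filtrationD(1) [OF filt]] by auto
  next
    case 2
    then show ?case using subgroup.m_inv_closed [OF filtrationD(1) [OF filt]] by auto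
  next
    case 3
    then show ?case using filtrationD(3) [OF filt] by auto
  }
next
  case (Suc k)
  note mult = Suc.IH(1) and inv = Suc.IH(2) and comm = Suc.IH(3)
  have conj: "(\<lambda>I. g I \<otimes> x I \<otimes> inv (g I)) \<in> cubes G A k i"
    if g: "g \<in> cubes G A k j" and x: "x \<in> cubes G A k i" for g x i j
  proof -
    have "(\<lambda>I. comm (g I) (x I)) \<in> cubes G A k i"
      using comm [OF g x] cubes_antimono [of i "j + i"] by auto
    from mult [OF this x] show ?thesis
      using cube_carrier [OF g] cube_carrier [OF x] by (simp add: word_simps)
  qed
  have conj': "(\<lambda>I. inv (g I) \<otimes> x I \<otimes> g I) \<in> cubes G A k i"
    if g: "g \<in> cubes G A k j" and x: "x \<in> cubes G A k i" for g x i j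
    using conj [OF inv [OF g] x] cube_carrier [OF g] by simp
  {
    case 1
    then obtain a b c d where
      x: "x = face_join G k a b" "a \<in> cubes G A k i" "b \<in> cubes G A k (Suc i)" and
      y: "y = face_join G k c d" "c \<in> cubes G A k i" "d \<in> cubes G A k (Suc i)" by auto
    note c = x(2,3)[THEN cube_carrier] y(2,3)[THEN cube_carrier]
    have "(\<lambda>I. x I \<otimes> y I) =
      face_join G k (\<lambda>I. a I \<otimes> c I) (\<lambda>I. (inv (c I) \<otimes> b I \<otimes> c I) \<otimes> d I)"
      using c by (simp add: x y face_join_def fun_eq_iff word_simps)
    then show ?case using cubes_SucI [OF mult [OF x(2) y(2)] mult [OF conj' [OF y(2) x(3)] y(3)]] by simp
  next
    case 2
    then obtain a b where
      x: "x = face_join G k a b" "a \<in> cubes G A k i" "b \<in> cubes G A k (Suc i)" by auto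
    note c = x(2,3)[THEN cube_carrier]
    have "(\<lambda>I. inv (x I)) =
      face_join G k (\<lambda>I. inv (a I)) (\<lambda>I. a I \<otimes> inv (b I) \<otimes> inv (a I))"
      using c by (simp add: x face_join_def fun_eq_iff word_simps)
    then show ?case using cubes_SucI [OF inv [OF x(2)] conj [OF x(2) inv [OF x(3)]]] by simp
  next
    case 3
    then obtain a b c d where
      x: "x = face_join G k a b" "a \<in> cubes G A k i" "b \<in> cubes G A k (Suc i)" and
      y: "y = face_join G k c d" "c \<in> cubes G A k j" "d \<in> cubes G A k (Suc j)" by auto
    note c = x(2,3)[THEN cube_carrier] y(2,3)[THEN cube_carrier]
    define u where "u = (\<lambda>I. comm (b I) (c I \<otimes> d I))"
    define v where "v = (\<lambda>I. comm (a I) (d I))"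
    define w where "w = (\<lambda>I. comm (a I) (c I))"
    have "d \<in> cubes G A k j" using y(3) cubes_Suc_subset by blast
    then have u: "u \<in> cubes G A k (Suc (i + j))"
      using comm [OF x(3) mult [OF y(2)]] unfolding u_def by simp
    have v: "v \<in> cubes G A k (Suc (i + j))"
      using comm [OF x(2) y(3)] unfolding v_def by simp
    have w: "w \<in> cubes G A k (i + j)"
      using comm [OF x(2) y(2)] unfolding w_def by simp
    \<comment> \<open>Expanding both arguments gives
      \<open>[a b, c d] = a u a^-1 w c v c^-1\<close>; then \<open>w\<close>, the commutator on the
      lower face, is moved to the front.\<close>
    let ?e = "\<lambda>I. (inv (w I) \<otimes> (a I \<otimes> u I \<otimes> inv (a I)) \<otimes> w I) \<otimes> (c I \<otimes> v I \<otimes> inv (c I))"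
    have e: "?e \<in> cubes G A k (Suc (i + j))"
      by (rule mult [OF conj' [OF w conj [OF x(2) u]] conj [OF y(2) v]])
    have "(\<lambda>I. comm (x I) (y I)) = face_join G k w ?e"
      using c by (simp add: x y u_def v_def w_def face_join_def fun_eq_iff word_simps)
    then show ?case using cubes_SucI [OF w e] by simp
  }
qed

lemma cube_conj:
  assumes g: "g \<in> cubes G A k j" and x: "x \<in> cubes G A k i"
  shows "(\<lambda>I. g I \<otimes> x I \<otimes> inv (g I)) \<in> cubes G A k i"
proof -
  have "(\<lambda>I. comm (g I) (x I)) \<in> cubes G A k i"
    using cube_commutator [OF g x] cubes_antimono [of i "j + i"] by auto
  from cube_mult [OF this x] show ?thesis
    using cube_carrier [OF g] cube_carrier [OF x] by (simp add: word_simps)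
qed

text \<open>Once the lower face lies in \<open>H\<close>, dividing it out of the upper face leaves a
  cube of one dimension less, for the filtration shifted by one, with all vertices but the last in
  \<open>H\<close>. Repetition ends at a single factor from \<open>A (i + k)\<close>.\<close>

lemma cube_last_vertex:
  assumes "subgroup H G" "A (i + k) \<subseteq> H" "x \<in> cubes G A k i"
    and "\<And>I. I \<subset> {..<k} \<Longrightarrow> x I \<in> H"
  shows "x {..<k} \<in> H"
  using assms(2-4)
proof (induction k arbitrary: i x)
  case (Suc k)
  then obtain a b where x: "x = face_join G k a b" "a \<in> cubes G A k i" "b \<in> cubes G A k (Suc i)"
    by auto
  note c = x(2,3)[THEN cube_carrier]
  have ins: "a (insert k I) = a I" "b (insert k I) = b I" for I
    using cubes_local [OF x(2), of "insert k I" I] cubes_local [OF x(3), of "insert k I" I] by auto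
  have a: "a I \<in> H" if "I \<subseteq> {..<k}" for I
  proof -
    have "k \<notin> I" "I \<subset> {..<Suc k}" using that by (auto simp: lessThan_Suc)
    then show ?thesis using Suc.prems(3) [of I] c by (simp add: x face_join_def)
  qed
  have eq: "b I = inv (a I) \<otimes> x (insert k I)" for I
    using c by (simp add: x face_join_def ins inv_mult_cancel)
  have "b I \<in> H" if "I \<subset> {..<k}" for I
  proof -
    have "insert k I \<subset> {..<Suc k}" using that by (auto simp: lessThan_Suc)
    then show ?thesis
      using Suc.prems(3) [of "insert k I"] a [of I] that eq
        subgroup.m_closed [OF assms(1)] subgroup.m_inv_closed [OF assms(1)] by auto
  qed
  then have "b {..<k} \<in> H" using Suc.IH [of "Suc i" b] Suc.prems(1) x by simp
  moreover have "x {..<Suc k} = a {..<k} \<otimes> b {..<k}"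
    by (simp add: x face_join_def lessThan_Suc ins)
  ultimately show ?case using a subgroup.m_closed [OF assms(1)] by simp
qed auto

text \<open>Each \<open>\<tau> [^] n j\<close> acts on the codimension-one face of the vertices
  containing \<open>j\<close>; factors for such faces come from \<open>A 1\<close>.\<close>

lemma power_cube:
  assumes "\<tau> \<in> A 1" 
  shows "(\<lambda>I. \<tau> [^] (\<Sum>j\<in>I \<inter> {..<k}. n j :: int)) \<in> cubes G A k 0"
proof (induction k)
  case 0
  then show ?case using const_cube [of \<one> 0 0] subgroup.one_closed [OF filtrationD(1) [OF filt]] by simp
next
  case (Suc k)
  have \<tau>: "\<tau> \<in> carrier G" using assms filt_carrier by blast
  have "\<tau> [^] (\<Sum>j\<in>I \<inter> {..<Suc k}. n j) =
    \<tau> [^] (\<Sum>j\<in>I \<inter> {..<k}. n j) \<otimes> (if k \<in> I then \<tau> [^] n k else \<one>)" for I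
  proof -
    have "I \<inter> {..<Suc k} = (if k \<in> I then insert k (I \<inter> {..<k}) else I \<inter> {..<k})"
      by (auto simp: lessThan_Suc)
    then have "(\<Sum>j\<in>I \<inter> {..<Suc k}. n j) = (\<Sum>j\<in>I \<inter> {..<k}. n j) + (if k \<in> I then n k else 0)"
      by simp
    then show ?thesis using \<tau> by (simp add: int_pow_mult)
  qed
  then have "(\<lambda>I. \<tau> [^] (\<Sum>j\<in>I \<inter> {..<Suc k}. n j)) =
    face_join G k (\<lambda>I. \<tau> [^] (\<Sum>j\<in>I \<inter> {..<k}. n j)) (\<lambda>I. \<tau> [^] n k)"
    by (simp add: face_join_def fun_eq_iff)
  moreover have "\<tau> [^] n k \<in> A (Suc 0)"
    using subgroup_int_pow_closed [OF filtrationD(1) [OF filt]] assms by simp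
  ultimately show ?case using cubes_SucI [OF Suc const_cube] by simp
qed

end

text \<open>The filtration \<open>G_0 = G_1 = G\<close> of Host and Kra, back in the usual
  numbering: \<open>lc_filtration j\<close> is \<open>G_j\<close>, so that commutators add indices
  without a shift.\<close>

definition lc_filtration :: "nat \<Rightarrow> 'a set" where
  "lc_filtration i = (case i of 0 \<Rightarrow> carrier G | Suc j \<Rightarrow> lc j)"

lemma lc_filtration_simps [simp]: "lc_filtration 0 = carrier G" "lc_filtration (Suc j) = lc j"
  by (simp_all add: lc_filtration_def)

lemma filtration_lc: "filtration lc_filtration"
  unfolding filtration_def
proof (intro conjI allI ballI)
  show "subgroup (lc_filtration i) G" for i
    using subgroup_lc subgroup_self by (cases i) simp_all
  show "lc_filtration (Suc i) \<subseteq> lc_filtration i" for i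
    using lc_closed lc_Suc_subset by (cases i) auto
  show "comm x y \<in> lc_filtration (i + j)"
    if xy: "x \<in> lc_filtration i" "y \<in> lc_filtration j" for i j x y
  proof (cases i)
    case 0
    show ?thesis
    proof (cases j)
      case (Suc j')
      then have "comm x y \<in> lc (Suc j')" using xy 0 by (simp add: commutator_in_lc_Suc)
      then show ?thesis using 0 Suc lc_Suc_subset by auto
    qed (use 0 xy in simp)
  next
    case (Suc i')
    then have x: "x \<in> lc i'" "x \<in> carrier G" using xy lc_closed by auto
    show ?thesis
    proof (cases j)
      case 0
      then have "comm x y \<in> lc (Suc (i' + 0))"
        using xy x by (intro commutator_in_lc) simp_all
      then show ?thesis using 0 Suc lc_Suc_subset by auto
    next
      case (Suc j')
      then have "comm x y \<in> lc (Suc (i' + j'))"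
        using xy x by (intro commutator_in_lc) simp_all
      then show ?thesis using \<open>i = Suc i'\<close> Suc by simp
    qed
  qed
qed

lemma filtration_Int:
  assumes "filtration A" "subgroup H G"
  shows "filtration (\<lambda>i. A i \<inter> H)"
  unfolding filtration_def
proof (intro conjI allI ballI)
  show "subgroup (A i \<inter> H) G" for i
    using filtrationD(1) [OF assms(1)] assms(2) by (rule subgroups_Inter_pair)
  show "A (Suc i) \<inter> H \<subseteq> A i \<inter> H" for i
    using filtrationD(2) [OF assms(1)] by blast
  show "comm x y \<in> A (i + j) \<inter> H" if "x \<in> A i \<inter> H" "y \<in> A j \<inter> H" for i j x y
    using that filtrationD(3) [OF assms(1)] subgroup.m_closed [OF assms(2)]
      subgroup.m_inv_closed [OF assms(2)] by (simp add: commutator_def)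
qed

text \<open>On the upper face the cube is \<open>a b = \<kappa> \<gamma> b\<close>, where
  \<open>\<gamma>\<close> separates \<open>\<kappa>\<close> from the compact part of
  \<open>b\<close>. So \<open>\<gamma> b \<gamma>^-1\<close> is decomposed instead, as
  \<open>\<kappa>' \<gamma>'\<close>, which turns \<open>a b\<close> into
  \<open>\<kappa> \<kappa>' \<gamma>' \<gamma>\<close>; and
  \<open>\<gamma>' \<gamma> = \<gamma> ?\<delta>\<close>, where \<open>?\<delta>\<close> is again a
  cube in \<open>H\<close>.\<close>

lemma cube_decompose:
  assumes A: "filtration A" and H: "subgroup H G" and B: "\<And>i. B i \<subseteq> A i"
    and dec: "\<And>i. A i \<subseteq> B i <#> H"
    and x: "x \<in> cubes G A k i"
  shows "\<exists>\<kappa>\<in>cubes G B k i. \<exists>\<gamma>\<in>cubes G (\<lambda>i. A i \<inter> H) k i. x = (\<lambda>I. \<kappa> I \<otimes> \<gamma> I)"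
  using x
proof (induction k arbitrary: i x)
  case 0
  then obtain g where g: "g \<in> A i" "x = (\<lambda>I. g)" by auto
  then obtain b h where b: "b \<in> B i" "h \<in> H" "g = b \<otimes> h" using dec unfolding set_mult_def by blast
  have Ai: "subgroup (A i) G" using filtrationD(1) [OF A] .
  have bA: "b \<in> A i" using b B by blast
  have "h = inv b \<otimes> g"
    using b bA subgroup.mem_carrier [OF Ai] subgroup.mem_carrier [OF H] by (simp add: inv_mult_cancel)
  then have "h \<in> A i" using g bA subgroup.m_closed [OF Ai] subgroup.m_inv_closed [OF Ai] by simp
  then show ?case using b g by auto
next
  case (Suc k)
  let ?AH = "\<lambda>i. A i \<inter> H"
  have AH: "filtration ?AH" using filtration_Int [OF A H] .
  have AH_A: "cubes G ?AH k i \<subseteq> cubes G A k i" and B_A: "cubes G B k i \<subseteq> cubes G A k i" for i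
    using B by (intro cubes_mono; blast)+
  obtain a b where x: "x = face_join G k a b" "a \<in> cubes G A k i" "b \<in> cubes G A k (Suc i)"
    using Suc.prems by auto
  obtain \<kappa> \<gamma> where a: "\<kappa> \<in> cubes G B k i" "\<gamma> \<in> cubes G ?AH k i" "a = (\<lambda>I. \<kappa> I \<otimes> \<gamma> I)"
    using Suc.IH [OF x(2)] by blast
  have \<gamma>A: "\<gamma> \<in> cubes G A k i" using a AH_A by blast
  have "(\<lambda>I. \<gamma> I \<otimes> b I \<otimes> inv (\<gamma> I)) \<in> cubes G A k (Suc i)"
    by (rule cube_conj [OF A \<gamma>A x(3)])
  then obtain \<kappa>' \<gamma>' where b: "\<kappa>' \<in> cubes G B k (Suc i)" "\<gamma>' \<in> cubes G ?AH k (Suc i)"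
    "(\<lambda>I. \<gamma> I \<otimes> b I \<otimes> inv (\<gamma> I)) = (\<lambda>I. \<kappa>' I \<otimes> \<gamma>' I)"
    using Suc.IH by blast
  let ?\<delta> = "\<lambda>I. inv (\<gamma> I) \<otimes> \<gamma>' I \<otimes> inv (inv (\<gamma> I))"
  have c: "b I \<in> carrier G" "\<kappa> I \<in> carrier G" "\<gamma> I \<in> carrier G"
    "\<kappa>' I \<in> carrier G" "\<gamma>' I \<in> carrier G" for I
    using x a b AH_A B_A cube_carrier [OF A] by blast+
  have "a I \<otimes> b I = \<kappa> I \<otimes> \<kappa>' I \<otimes> (\<gamma> I \<otimes> ?\<delta> I)" for I
  proof -
    have "a I \<otimes> b I = \<kappa> I \<otimes> (\<gamma> I \<otimes> b I \<otimes> inv (\<gamma> I)) \<otimes> \<gamma> I"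
      using c by (simp add: a word_simps)
    also have "\<gamma> I \<otimes> b I \<otimes> inv (\<gamma> I) = \<kappa>' I \<otimes> \<gamma>' I" using b(3) by meson
    finally show ?thesis using c by (simp add: word_simps)
  qed
  then have "x = (\<lambda>I. face_join G k \<kappa> \<kappa>' I \<otimes> face_join G k \<gamma> ?\<delta> I)"
    using c by (auto simp: x face_join_def fun_eq_iff a(3))
  moreover have "?\<delta> \<in> cubes G ?AH k (Suc i)"
    by (rule cube_conj [OF AH cube_inv [OF AH a(2)] b(2)])
  ultimately show ?case using cubes_SucI [OF a(1) b(1)] cubes_SucI [OF a(2)] by blast
qed

end

section \<open>Compactness of cubes and lifting of limit cubes\<close>

context topological_group
begin

lemma compactin_cubes:
  assumes "\<And>i. compactin T (B i)"
  shows "compactin (product_topology (\<lambda>_. T) UNIV) (cubes G B k i)"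
proof (induction k arbitrary: i)
  case 0
  have "continuous_map T (product_topology (\<lambda>_. T) UNIV) (\<lambda>g I. g)"
    by (simp add: continuous_map_componentwise_UNIV)
  then show ?case using image_compactin [OF assms] by simp
next
  case (Suc k)
  let ?P = "product_topology (\<lambda>_. T) (UNIV :: nat set set)"
  let ?f = "\<lambda>z. face_join G k (fst z) (snd z)"
  have proj: "continuous_map (prod_topology ?P ?P) T (\<lambda>z. fst z I)"
    "continuous_map (prod_topology ?P ?P) T (\<lambda>z. snd z I)" for I
    using continuous_map_fst [of ?P ?P] continuous_map_snd [of ?P ?P]
    unfolding continuous_map_componentwise_UNIV by blast+
  have "continuous_map (prod_topology ?P ?P) T (\<lambda>z. ?f z I)" for I
    unfolding face_join_def
    by (cases "k \<in> I") (simp_all add: continuous_map_mult proj topspace_eq)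
  then have cont: "continuous_map (prod_topology ?P ?P) ?P ?f"
    by (simp add: continuous_map_componentwise_UNIV)
  have "compactin (prod_topology ?P ?P) (cubes G B k i \<times> cubes G B k (Suc i))"
    using Suc by (simp add: compactin_Times)
  then have "compactin ?P (?f ` (cubes G B k i \<times> cubes G B k (Suc i)))"
    using cont by (rule image_compactin)
  moreover have "?f ` (cubes G B k i \<times> cubes G B k (Suc i)) = cubes G B (Suc k) i"
  proof (intro equalityI subsetI)
    fix x assume "x \<in> cubes G B (Suc k) i"
    then obtain a b where "x = ?f (a, b)" "(a, b) \<in> cubes G B k i \<times> cubes G B k (Suc i)" by auto
    then show "x \<in> ?f ` (cubes G B k i \<times> cubes G B k (Suc i))" by (rule image_eqI)
  qed (auto intro: cubes_SucI simp del: cubes.simps)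
  ultimately show ?case by simp
qed

text \<open>A basic open set constrains only finitely many coordinates, so one neighbourhood
  \<open>W\<close> can serve them all.\<close>

lemma nbhd_of_one_function:
  assumes "openin (product_topology (\<lambda>_. T) UNIV) O'" "(\<lambda>_. \<one>) \<in> O'"
  shows "\<exists>W. openin T W \<and> \<one> \<in> W \<and> (\<forall>w. (\<forall>i. w i \<in> W) \<longrightarrow> w \<in> O')"
proof -
  obtain U where U: "finite {i. U i \<noteq> topspace T}" "\<And>i. openin T (U i)"
    "\<And>i. \<one> \<in> U i" "(\<Pi>\<^sub>E i\<in>UNIV. U i) \<subseteq> O'"
    using assms unfolding openin_product_topology_alt by (fastforce simp: PiE_iff)
  let ?W = "topspace T \<inter> \<Inter>(U ` {i. U i \<noteq> topspace T})"
  have "openin T ?W"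
  proof (cases "{i. U i \<noteq> topspace T} = {}")
    case False
    then have "openin T (\<Inter>(U ` {i. U i \<noteq> topspace T}))" using U by blast
    then show ?thesis by blast
  qed simp
  moreover have "\<one> \<in> ?W" using U(3) topspace_eq by simp
  moreover have "w \<in> O'" if "\<And>i. w i \<in> ?W" for w
  proof -
    have "w i \<in> U i" for i using that [of i] by (cases "U i = topspace T") auto
    then show ?thesis using U(4) by auto
  qed
  ultimately show ?thesis by blast
qed

end

context cocompact_lattice
begin

text \<open>By \<open>approx\<close>, the corner with \<open>y\<close> at its last vertex is a limit
  of orbit cubes modulo \<open>\<Gamma>'\<close>. Orbit cubes have compact parts, and compactness
  yields a genuine cube with the vertices of the corner modulo \<open>\<Gamma>'\<close>, to which
  \<open>cube_last_vertex\<close> applies. The finitely generated \<open>\<Gamma>\<close> supplies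
  cocompactness but may be smaller than \<open>\<Gamma>'\<close>, the group of interest.\<close>

lemma cube_rigidity:
  assumes d: "lc d = {\<one>}"
    and \<Gamma>': "subgroup \<Gamma>' G" "closedin T \<Gamma>'" "\<Gamma> \<subseteq> \<Gamma>'" and y: "y \<in> carrier G"
    and approx: "\<And>W. openin T W \<Longrightarrow> \<one> \<in> W \<Longrightarrow> \<exists>n :: nat \<Rightarrow> int. \<forall>I\<subseteq>{..<Suc d}. \<exists>w\<in>W. \<exists>\<gamma>\<in>\<Gamma>'.
      \<tau> [^] (\<Sum>j\<in>I. n j) = w \<otimes> (if I = {..<Suc d} then y else \<one>) \<otimes> \<gamma>"
  shows "y \<in> \<Gamma>'"
proof -
  note [simp del] = cubes.simps(2)
  let ?k = "Suc d"
  let ?A = lc_filtration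
  have \<Gamma>'_carrier: "\<Gamma>' \<subseteq> carrier G" using subgroup.subset [OF \<Gamma>'(1)] .
  have "\<exists>B. compactin T B \<and> B \<subseteq> ?A i \<and> ?A i \<subseteq> B <#> \<Gamma>" for i
    using bounded_mod_lc [OF d, of 0] bounded_mod_lc [OF d]
    unfolding bounded_mod_def by (cases i) auto
  then obtain B where B: "\<And>i. compactin T (B i)" "\<And>i. B i \<subseteq> ?A i" "\<And>i. ?A i \<subseteq> B i <#> \<Gamma>"
    by metis
  define v where "v = (\<lambda>I. if I = {..<?k} then y else \<one>)"
  have v: "v I \<in> carrier G" for I using y by (simp add: v_def)
  let ?P = "product_topology (\<lambda>_. T) (UNIV :: nat set set)"
  let ?\<K> = "cubes G B ?k 0"
  let ?Z = "prod_topology (subtopology ?P ?\<K>) ?P"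
  let ?S = "\<Inter>I\<in>Pow {..<?k}. {z \<in> topspace ?Z. inv (v I) \<otimes> inv (snd z I) \<otimes> fst z I \<in> \<Gamma>'}"
  have \<K>: "compactin ?P ?\<K>" using compactin_cubes B by blast
  have \<K>_A: "?\<K> \<subseteq> cubes G ?A ?k 0" using cubes_mono B(2) by blast
  have \<K>_top: "\<kappa> \<in> topspace ?P" if "\<kappa> \<in> ?\<K>" for \<kappa>
    using that \<K> compactin_subset_topspace by blast
  have proj: "continuous_map ?Z T (\<lambda>z. fst z I)" "continuous_map ?Z T (\<lambda>z. snd z I)" for I
  proof -
    have "continuous_map ?Z ?P fst" "continuous_map ?Z ?P snd"
      using continuous_map_fst continuous_map_snd continuous_map_into_fulltopology by blast+
    then show "continuous_map ?Z T (\<lambda>z. fst z I)" "continuous_map ?Z T (\<lambda>z. snd z I)"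
      unfolding continuous_map_componentwise_UNIV by blast+
  qed
  have "closedin ?Z {z \<in> topspace ?Z. inv (v I) \<otimes> inv (snd z I) \<otimes> fst z I \<in> \<Gamma>'}" for I
  proof (rule closedin_continuous_map_preimage [OF _ \<Gamma>'(2)])
    show "continuous_map ?Z T (\<lambda>z. inv (v I) \<otimes> inv (snd z I) \<otimes> fst z I)"
      using proj v by (intro continuous_map_mult continuous_map_inv) (simp_all add: topspace_eq)
  qed
  then have "closedin ?Z ?S" by (intro closedin_INT) auto
  moreover have "closed_map ?Z ?P snd"
    using \<K> by (intro closed_map_snd) (simp add: compactin_subspace)
  \<comment> \<open>The perturbations \<open>w\<close> for which \<open>w v\<close> agrees with a
    cube from the compact set modulo \<open>\<Gamma>'\<close>; a projection along that compact set,
    hence closed.\<close>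
  moreover define Q where "Q = snd ` ?S"
  ultimately have closed: "closedin ?P Q" unfolding closed_map_def by blast
  have Q_I: "w \<in> Q" if "\<kappa> \<in> ?\<K>" "w \<in> topspace ?P"
    "\<And>I. I \<subseteq> {..<?k} \<Longrightarrow> inv (v I) \<otimes> inv (w I) \<otimes> \<kappa> I \<in> \<Gamma>'" for \<kappa> w
  proof -
    have "(\<kappa>, w) \<in> ?S" using that \<K>_top by simp
    then show ?thesis unfolding Q_def by (rule image_eqI [rotated]) simp
  qed
  have Q_E: "\<exists>\<kappa>\<in>?\<K>. \<forall>I\<subseteq>{..<?k}. inv (v I) \<otimes> inv (w I) \<otimes> \<kappa> I \<in> \<Gamma>'" if "w \<in> Q" for w
  proof -
    obtain z where z: "z \<in> ?S" "w = snd z" using \<open>w \<in> Q\<close> unfolding Q_def by blast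
    have "fst z \<in> ?\<K>" using INT_D [OF z(1) Pow_bottom] by auto
    moreover have "\<forall>I\<subseteq>{..<?k}. inv (v I) \<otimes> inv (w I) \<otimes> fst z I \<in> \<Gamma>'"
      using INT_D [OF z(1)] z(2) by blast
    ultimately show ?thesis by blast
  qed
  have "(\<lambda>_. \<one>) \<in> Q"
  proof (rule ccontr)
    assume "(\<lambda>_. \<one>) \<notin> Q"
    then have "(\<lambda>_. \<one>) \<in> topspace ?P - Q" by (simp add: topspace_eq PiE_iff)
    moreover have "openin ?P (topspace ?P - Q)" using closed by blast
    ultimately have "\<exists>W. openin T W \<and> \<one> \<in> W \<and> (\<forall>w. (\<forall>I. w I \<in> W) \<longrightarrow> w \<in> topspace ?P - Q)"
      by (intro nbhd_of_one_function)
    then obtain W where W: "openin T W" "\<one> \<in> W"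
      "\<And>w. (\<And>I. w I \<in> W) \<Longrightarrow> w \<in> topspace ?P - Q"
      by blast
    obtain n :: "nat \<Rightarrow> int" where n: "\<And>I. I \<subseteq> {..<?k} \<Longrightarrow>
      \<exists>w\<in>W. \<exists>\<gamma>\<in>\<Gamma>'. \<tau> [^] (\<Sum>j\<in>I. n j) = w \<otimes> v I \<otimes> \<gamma>"
      using approx [OF W(1,2)] unfolding v_def by blast
    have "\<exists>w. w \<in> W \<and> (I \<subseteq> {..<?k} \<longrightarrow> (\<exists>\<gamma>\<in>\<Gamma>'. \<tau> [^] (\<Sum>j\<in>I. n j) = w \<otimes> v I \<otimes> \<gamma>))" for I
      using n [of I] W(2) by blast
    then obtain w where w: "\<And>I. w I \<in> W"
      "\<And>I. I \<subseteq> {..<?k} \<Longrightarrow> \<exists>\<gamma>\<in>\<Gamma>'. \<tau> [^] (\<Sum>j\<in>I. n j) = w I \<otimes> v I \<otimes> \<gamma>"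
      by metis
    have wc: "w I \<in> carrier G" for I using w(1) openin_subset [OF W(1)] topspace_eq by blast
    have "(\<lambda>I. \<tau> [^] (\<Sum>j\<in>I \<inter> {..<?k}. n j)) \<in> cubes G ?A ?k 0"
      using power_cube [OF filtration_lc] \<tau> by simp
    from cube_decompose [OF filtration_lc subgroup_\<Gamma> B(2,3) this]
    obtain \<kappa> \<gamma> where \<kappa>: "\<kappa> \<in> ?\<K>" "\<gamma> \<in> cubes G (\<lambda>i. ?A i \<inter> \<Gamma>) ?k 0"
      "\<And>I. \<tau> [^] (\<Sum>j\<in>I \<inter> {..<?k}. n j) = \<kappa> I \<otimes> \<gamma> I" by meson
    have "inv (v I) \<otimes> inv (w I) \<otimes> \<kappa> I \<in> \<Gamma>'" if I: "I \<subseteq> {..<?k}" for I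
    proof -
      obtain \<gamma>' where \<gamma>': "\<gamma>' \<in> \<Gamma>'" "\<tau> [^] (\<Sum>j\<in>I. n j) = w I \<otimes> v I \<otimes> \<gamma>'"
        using w(2) [OF I] by blast
      have \<gamma>\<Gamma>: "\<gamma> I \<in> \<Gamma>'"
        using cubes_mem_subgroup [OF subgroup_\<Gamma> _ \<kappa>(2)] \<Gamma>'(3) by blast
      have "\<kappa> I \<otimes> \<gamma> I = w I \<otimes> v I \<otimes> \<gamma>'" using \<kappa>(3) [of I] \<gamma>' I by (simp add: Int_absorb2)
      moreover have c: "\<kappa> I \<in> carrier G" "\<gamma> I \<in> carrier G" "\<gamma>' \<in> carrier G"
        using cube_carrier [OF filtration_lc] \<kappa>(1) \<K>_A \<gamma>\<Gamma> \<gamma>' \<Gamma>'_carrier by blast+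
      ultimately have "\<kappa> I = w I \<otimes> v I \<otimes> \<gamma>' \<otimes> inv (\<gamma> I)"
        using v wc by (metis inv_solve_right m_closed)
      then have "inv (v I) \<otimes> inv (w I) \<otimes> \<kappa> I = \<gamma>' \<otimes> inv (\<gamma> I)"
        using c v wc by (simp add: word_simps)
      then show ?thesis
        using \<gamma>' \<gamma>\<Gamma> subgroup.m_closed [OF \<Gamma>'(1)] subgroup.m_inv_closed [OF \<Gamma>'(1)] by simp
    qed
    then have "w \<in> Q" using wc by (intro Q_I [OF \<kappa>(1)]) (simp_all add: topspace_eq PiE_iff)
    then show False using W(3) [of w] w(1) by blast
  qed
  then obtain \<kappa> where \<kappa>: "\<kappa> \<in> ?\<K>"
    "\<And>I. I \<subseteq> {..<?k} \<Longrightarrow> inv (v I) \<otimes> inv \<one> \<otimes> \<kappa> I \<in> \<Gamma>'"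
    using Q_E by blast
  have \<kappa>A: "\<kappa> \<in> cubes G ?A ?k 0" using \<kappa>(1) \<K>_A by blast
  have \<kappa>c: "\<kappa> I \<in> carrier G" for I using cube_carrier [OF filtration_lc \<kappa>A] .
  \<comment> \<open>The factor at the last vertex has filtration index \<open>Suc d\<close>, that
    is, it lies in \<open>lc d\<close>, which is trivial.\<close>
  have "\<kappa> {..<?k} \<in> \<Gamma>'"
  proof (rule cube_last_vertex [OF filtration_lc \<Gamma>'(1) _ \<kappa>A])
    show "?A (0 + ?k) \<subseteq> \<Gamma>'" using d subgroup.one_closed [OF \<Gamma>'(1)] by simp
    show "\<kappa> I \<in> \<Gamma>'" if "I \<subset> {..<?k}" for I
    proof -
      have "I \<subseteq> {..<?k}" "I \<noteq> {..<?k}" using that by auto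
      then show ?thesis using \<kappa>(2) [of I] \<kappa>c by (simp add: v_def)
    qed
  qed
  moreover have "inv y \<otimes> \<kappa> {..<?k} \<in> \<Gamma>'" using \<kappa>(2) [of "{..<?k}"] y by (simp add: v_def)
  ultimately have "\<kappa> {..<?k} \<otimes> inv (inv y \<otimes> \<kappa> {..<?k}) \<in> \<Gamma>'"
    using subgroup.m_closed [OF \<Gamma>'(1)] subgroup.m_inv_closed [OF \<Gamma>'(1)] by blast
  then show ?thesis using y \<kappa>c by (simp add: word_simps)
qed

end

section \<open>Minimal translations of compact quotients\<close>

context topological_group
begin

lemma topspace_quotient_space:
  assumes "subgroup \<Gamma> G"
  shows "topspace (quotient_space G T \<Gamma>) = lcosets \<Gamma>"
proof -
  have "openin (quotient_space G T \<Gamma>) (lcosets \<Gamma>)"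
    using openin_topspace [of T]
    by (simp add: openin_quotient_space [OF is_group assms] lcosets_part_G [OF assms] topspace_eq)
  then show ?thesis
    using openin_subset openin_quotient_space [OF is_group assms] by (metis openin_topspace subset_antisym)
qed

lemma lcosets_translation:
  assumes "subgroup \<Gamma> G" "\<tau> \<in> carrier G" "C \<in> lcosets \<Gamma>"
  shows "\<tau> <# C \<in> lcosets \<Gamma>" "inv \<tau> <# (\<tau> <# C) = C"
proof -
  obtain g where g: "g \<in> carrier G" "C = g <# \<Gamma>" using assms(3) unfolding LCOSETS_def by blast
  note \<Gamma> = subgroup.subset [OF assms(1)]
  have eq: "\<tau> <# C = (\<tau> \<otimes> g) <# \<Gamma>" unfolding g(2) by (rule lcos_m_assoc [OF \<Gamma> assms(2) g(1)])
  then show "\<tau> <# C \<in> lcosets \<Gamma>" using assms(2) g(1) unfolding LCOSETS_def by auto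
  show "inv \<tau> <# (\<tau> <# C) = C"
    unfolding eq using assms(2) g lcos_m_assoc [OF \<Gamma>, of "inv \<tau>" "\<tau> \<otimes> g"] by (simp add: inv_mult_cancel)
qed

lemma l_coset_in_image_iff:
  assumes "subgroup \<Gamma> G" "U \<subseteq> carrier G" "x \<in> carrier G"
  shows "x <# \<Gamma> \<in> (\<lambda>u. u <# \<Gamma>) ` U \<longleftrightarrow> (\<exists>u\<in>U. \<exists>\<gamma>\<in>\<Gamma>. x = u \<otimes> \<gamma>)"
proof
  assume "x <# \<Gamma> \<in> (\<lambda>u. u <# \<Gamma>) ` U"
  then obtain u where "u \<in> U" "x \<in> u <# \<Gamma>" using lcos_self [OF assms(3,1)] by auto
  then show "\<exists>u\<in>U. \<exists>\<gamma>\<in>\<Gamma>. x = u \<otimes> \<gamma>" unfolding l_coset_def by blast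
next
  assume "\<exists>u\<in>U. \<exists>\<gamma>\<in>\<Gamma>. x = u \<otimes> \<gamma>"
  then obtain u where u: "u \<in> U" "x \<in> u <# \<Gamma>" unfolding l_coset_def by blast
  then have "u <# \<Gamma> = x <# \<Gamma>" using assms by (intro l_repr_independence) auto
  then show "x <# \<Gamma> \<in> (\<lambda>u. u <# \<Gamma>) ` U" using u by blast
qed

lemma openin_quotient_image:
  assumes "subgroup \<Gamma> G" "openin T U"
  shows "openin (quotient_space G T \<Gamma>) ((\<lambda>x. x <# \<Gamma>) ` U)"
proof -
  have U: "U \<subseteq> carrier G" using openin_subset [OF assms(2)] topspace_eq by simp
  have "\<Union>((\<lambda>x. x <# \<Gamma>) ` U) = U <#> \<Gamma>" by (auto simp: set_mult_def l_coset_def)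
  then show ?thesis
    using U openin_set_mult_left [OF assms(2) subgroup.subset [OF assms(1)]]
    by (auto simp: openin_quotient_space [OF is_group assms(1)] LCOSETS_def)
qed

text \<open>As \<open>G\<close> may fail to be compactly generated, everything is moved to the
  subgroup \<open>H\<close> generated by \<open>\<tau>\<close> and a compact neighbourhood
  \<open>C\<close> of the identity. It is open, and the dense orbit of \<open>\<tau>\<close> makes
  \<open>H \<Gamma>\<close> the whole group. Compactness of the quotient then provides a finitely
  generated subgroup of \<open>\<Gamma> \<inter> H\<close> that is cocompact in
  \<open>H\<close>.\<close>

lemma translation_rigidity:
  assumes haus: "Hausdorff_space T"
    and loc_compact: "\<And>U. openin T U \<Longrightarrow> \<one> \<in> U \<Longrightarrow>
      \<exists>V C. openin T V \<and> \<one> \<in> V \<and> V \<subseteq> C \<and> compactin T C \<and> C \<subseteq> U"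
    and div: "openin T U\<^sub>0" "\<one> \<in> U\<^sub>0" "\<And>g V. g \<in> U\<^sub>0 \<Longrightarrow> openin T V \<Longrightarrow> \<one> \<in> V \<Longrightarrow>
      \<exists>u\<in>V. \<exists>m::nat. u [^] m = g"
    and d: "lc d = {\<one>}"
    and \<Gamma>: "subgroup \<Gamma> G" "subtopology T \<Gamma> = discrete_topology \<Gamma>"
    and compact: "compact_space (quotient_space G T \<Gamma>)"
    and \<tau>: "\<tau> \<in> carrier G"
    and dense: "\<And>U. openin T U \<Longrightarrow> U \<noteq> {} \<Longrightarrow> \<exists>n::int. \<exists>u\<in>U. \<exists>\<gamma>\<in>\<Gamma>. \<tau> [^] n = u \<otimes> \<gamma>"
    and y: "y \<in> carrier G"
    and approx: "\<And>W. openin T W \<Longrightarrow> \<one> \<in> W \<Longrightarrow> \<exists>n :: nat \<Rightarrow> int. \<forall>I\<subseteq>{..<Suc d}. \<exists>w\<in>W. \<exists>\<gamma>\<in>\<Gamma>.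
      \<tau> [^] (\<Sum>j\<in>I. n j) = w \<otimes> (if I = {..<Suc d} then y else \<one>) \<otimes> \<gamma>"
  shows "y \<in> \<Gamma>"
proof -
  note \<Gamma>m = subgroup.m_closed [OF \<Gamma>(1)] and \<Gamma>i = subgroup.m_inv_closed [OF \<Gamma>(1)]
  note \<Gamma>c = subgroup.mem_carrier [OF \<Gamma>(1)]
  obtain V C where V: "openin T V" "\<one> \<in> V" "V \<subseteq> C" "compactin T C" "C \<subseteq> U\<^sub>0"
    using loc_compact [OF div(1,2)] by blast
  have C: "C \<subseteq> carrier G" using compactin_subset_carrier [OF V(4)] .
  define H where "H = generate G (insert \<tau> C)"
  have H: "subgroup H G" unfolding H_def using C \<tau> by (intro generate_is_subgroup) auto
  note Hm = subgroup.m_closed [OF H] and Hi = subgroup.m_inv_closed [OF H]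
    and Hc = subgroup.mem_carrier [OF H] and H1 = subgroup.one_closed [OF H]
  have CH: "C \<subseteq> H" "\<tau> \<in> H" unfolding H_def by (auto intro: generate.incl)
  have VH: "V \<subseteq> H" using V(3) CH(1) by blast
  have H_open: "openin T H" using openin_subgroup [OF H V(1,2) VH] .
  \<comment> \<open>Some power of \<open>\<tau>\<close> hits the open set \<open>H g\<close> modulo
    \<open>\<Gamma>\<close>, and all powers of \<open>\<tau>\<close> lie in
    \<open>H\<close>.\<close>
  have H_\<Gamma>: "\<exists>h\<in>H. \<exists>\<gamma>\<in>\<Gamma>. g = h \<otimes> \<gamma>" if g: "g \<in> carrier G" for g
  proof -
    have "openin T (H #> g)" using openin_r_coset [OF H_open g] .
    moreover have "H #> g \<noteq> {}" using H1 unfolding r_coset_def by blast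
    ultimately obtain n :: int and h \<gamma> where n: "h \<in> H" "\<gamma> \<in> \<Gamma>" "\<tau> [^] n = h \<otimes> g \<otimes> \<gamma>"
      using dense [of "H #> g"] unfolding r_coset_def by blast
    have c: "h \<in> carrier G" "\<gamma> \<in> carrier G" using n Hc \<Gamma>c by auto
    have "(inv h \<otimes> \<tau> [^] n) \<otimes> inv \<gamma> = g" using c g unfolding n(3) by (simp add: word_simps)
    moreover have "inv h \<otimes> \<tau> [^] n \<in> H"
      using n(1) CH(2) subgroup_int_pow_closed [OF H] Hm Hi by blast
    ultimately show ?thesis using \<Gamma>i [OF n(2)] by metis
  qed
  let ?Q = "quotient_space G T \<Gamma>"
  let ?img = "\<lambda>h. (\<lambda>x. x <# \<Gamma>) ` (h <# V)"
  have "\<exists>\<F>. finite \<F> \<and> \<F> \<subseteq> ?img ` H \<and> topspace ?Q \<subseteq> \<Union>\<F>"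
  proof (rule compact_space_alt [THEN iffD1, OF compact, rule_format], intro conjI ballI)
    fix U assume "U \<in> ?img ` H"
    then show "openin ?Q U"
      using openin_quotient_image [OF \<Gamma>(1)] openin_l_coset [OF V(1)] Hc by blast
  next
    show "topspace ?Q \<subseteq> \<Union>(?img ` H)"
    proof
      fix A assume "A \<in> topspace ?Q"
      then obtain g where g: "g \<in> carrier G" "A = g <# \<Gamma>"
        unfolding topspace_quotient_space [OF \<Gamma>(1)] LCOSETS_def by blast
      obtain h \<gamma> where h: "h \<in> H" "\<gamma> \<in> \<Gamma>" "g = h \<otimes> \<gamma>" using H_\<Gamma> [OF g(1)] by blast
      have "h \<otimes> \<one> \<in> h <# V" using V(2) unfolding l_coset_def by blast
      then have "h \<in> h <# V" using Hc [OF h(1)] by simp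
      moreover have "h <# V \<subseteq> carrier G"
        using VH Hc h(1) unfolding l_coset_def by blast
      ultimately have "g <# \<Gamma> \<in> ?img h"
        using l_coset_in_image_iff [OF \<Gamma>(1) _ g(1)] h by blast
      then show "A \<in> \<Union>(?img ` H)" using h g(2) by blast
    qed
  qed
  then obtain \<F> where \<F>: "finite \<F>" "\<F> \<subseteq> ?img ` H" "lcosets \<Gamma> \<subseteq> \<Union>\<F>"
    unfolding topspace_quotient_space [OF \<Gamma>(1)] by (elim exE conjE)
  obtain D where "D \<subseteq> H" "finite D" "\<F> = ?img ` D" by (rule finite_subset_image [OF \<F>(1,2), THEN exE]) blast
  with \<F>(3) have D: "finite D" "D \<subseteq> H" "lcosets \<Gamma> \<subseteq> \<Union>(?img ` D)" by simp_all
  \<comment> \<open>The set \<open>D C\<close> meets every coset; \<open>\<one>\<close> is added so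
    that the induction along the generators of \<open>H\<close> can start inside
    \<open>K <#> ?F\<close>.\<close>
  define K where "K = insert \<one> (D <#> C)"
  have "compactin T D" using D Hc by (intro finite_imp_compactin) (auto simp: topspace_eq)
  then have "compactin T ({\<one>} \<union> (D <#> C))"
    using compactin_set_mult V(4) by (intro compactin_Un) (auto simp: topspace_eq)
  then have K_compact: "compactin T K" by (simp add: K_def)
  have K_H: "K \<subseteq> H" using D(2) CH(1) Hm H1 unfolding K_def set_mult_def by blast
  have K_cover: "\<exists>k\<in>K. \<exists>\<gamma>\<in>\<Gamma>. g = k \<otimes> \<gamma>" if g: "g \<in> carrier G" for g
  proof -
    have "g <# \<Gamma> \<in> lcosets \<Gamma>" using g unfolding LCOSETS_def by blast
    then obtain h where h: "h \<in> D" "g <# \<Gamma> \<in> ?img h" using D(3) by blast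
    have "h <# V \<subseteq> carrier G" using VH D(2) h(1) Hc unfolding l_coset_def by blast
    from l_coset_in_image_iff [OF \<Gamma>(1) this g, THEN iffD1, OF h(2)]
    obtain x \<gamma> where x: "x \<in> h <# V" "\<gamma> \<in> \<Gamma>" "g = x \<otimes> \<gamma>" by (elim bexE)
    have "x \<in> K" using x(1) h(1) V(3) unfolding K_def l_coset_def set_mult_def by blast
    then show ?thesis using x by blast
  qed
  define S where "S = insert \<tau> C \<union> m_inv G ` insert \<tau> C"
  \<comment> \<open>Generators in the manner of Schreier: the elements \<open>\<gamma>\<close> of
    \<open>\<Gamma>\<close> that occur when a product \<open>s k\<close> is rewritten as
    \<open>k' \<gamma>\<close>. Compactness and discreteness leave finitely many.\<close>
  define F where "F = (m_inv G ` K <#> (S <#> K)) \<inter> \<Gamma>"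
  have "compactin T (insert \<tau> C)"
    using compactin_Un [of T "{\<tau>}" C] V(4) \<tau> by (simp add: topspace_eq)
  then have "compactin T S" unfolding S_def by (intro compactin_Un compactin_m_inv)
  then have "compactin T (m_inv G ` K <#> (S <#> K))"
    by (intro compactin_set_mult compactin_m_inv K_compact)
  then have F_finite: "finite F"
    unfolding F_def by (rule finite_compact_Int_discrete [OF haus \<Gamma>])
  have S_H: "S \<subseteq> H" using CH Hi unfolding S_def by blast
  have mult_H: "A <#> B \<subseteq> H" if "A \<subseteq> H" "B \<subseteq> H" for A B
    using that Hm unfolding set_mult_def by blast
  have "m_inv G ` K \<subseteq> H" using K_H Hi by blast
  then have F_H: "F \<subseteq> H"
    unfolding F_def by (intro le_infI1 mult_H S_H K_H)
  have F_carrier: "F \<subseteq> carrier G" using F_H Hc by blast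
  let ?F = "generate G F"
  have F_\<Gamma>: "?F \<subseteq> \<Gamma>" using \<Gamma>(1) by (intro generate_subgroup_incl) (auto simp: F_def)
  have F_FH: "?F \<subseteq> H" using generate_subgroup_incl [OF F_H H] .
  have step: "s \<otimes> x \<in> K <#> ?F" if s: "s \<in> S" and x: "x \<in> K <#> ?F" for s x
  proof -
    obtain k f where k: "k \<in> K" "f \<in> ?F" "x = k \<otimes> f" using x unfolding set_mult_def by blast
    have c: "s \<in> carrier G" "k \<in> carrier G" "f \<in> carrier G" using s k S_H K_H F_FH Hc by blast+
    obtain k' \<gamma> where k': "k' \<in> K" "\<gamma> \<in> \<Gamma>" "s \<otimes> k = k' \<otimes> \<gamma>" using K_cover [of "s \<otimes> k"] c by auto
    have c': "k' \<in> carrier G" "\<gamma> \<in> carrier G" using k' K_H Hc \<Gamma>c by blast+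
    have "\<gamma> = inv k' \<otimes> (s \<otimes> k)" unfolding k'(3) using c' by (simp add: inv_mult_cancel)
    then have "\<gamma> \<in> F" using k' s k unfolding F_def set_mult_def by blast
    then have "\<gamma> \<otimes> f \<in> ?F" by (rule generate.eng [OF generate.incl k(2)])
    moreover have "s \<otimes> x = k' \<otimes> (\<gamma> \<otimes> f)"
      unfolding k(3) using c c' k'(3) by (simp add: m_assoc [symmetric])
    ultimately show ?thesis using k'(1) unfolding set_mult_def by blast
  qed
  have KF_carrier: "K <#> ?F \<subseteq> carrier G"
    using mult_H [OF K_H F_FH] Hc by blast
  have one_KF: "\<one> \<in> K <#> ?F"
  proof -
    have "\<one> \<otimes> \<one> \<in> K <#> ?F" using generate.one [of G F] unfolding K_def set_mult_def by blast
    then show ?thesis by simp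
  qed
  have "\<forall>x\<in>K <#> ?F. h \<otimes> x \<in> K <#> ?F" if "h \<in> H" for h
    using that unfolding H_def
  proof (induction rule: generate.induct)
    case one
    then show ?case using KF_carrier by auto
  next
    case (incl h)
    then show ?case using step by (auto simp: S_def)
  next
    case (inv h)
    then show ?case using step by (auto simp: S_def)
  next
    case (eng h1 h2)
    then have "h1 \<in> carrier G" "h2 \<in> carrier G" using Hc unfolding H_def by blast+
    then show ?case using eng KF_carrier by (auto simp: m_assoc subset_eq)
  qed
  then have H_KF: "H \<subseteq> K <#> ?F"
    using one_KF Hc by (metis r_one subsetI)
  let ?G = "G\<lparr>carrier := H\<rparr>" and ?T = "subtopology T H"
  interpret HT: topological_group ?G ?T using topological_group_subgroup [OF H] .
  have genF: "generate ?G F = ?F" using generate_consistent [OF F_H H] .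
  interpret HL: cocompact_lattice ?G ?T F K C \<tau>
  proof
    show "closedin ?T B" if "B \<subseteq> generate ?G F" for B
    proof (rule closedin_subset_topspace)
      show "closedin T B"
        using that F_\<Gamma> genF by (intro closedin_subset_discrete [OF haus \<Gamma>]) blast
      show "B \<subseteq> H" using that F_FH genF by blast
    qed
    show "carrier ?G \<subseteq> K <#>\<^bsub>?G\<^esub> generate ?G F" using H_KF genF by simp
    show "generate ?G (insert \<tau> C) = carrier ?G"
      using generate_consistent [OF _ H, of "insert \<tau> C"] CH by (simp add: H_def [symmetric])
    show "\<exists>u\<in>W \<inter> C. \<exists>m::nat. u [^]\<^bsub>?G\<^esub> m = g"
      if gW: "g \<in> C" "openin ?T W" "\<one>\<^bsub>?G\<^esub> \<in> W" for g W
    proof -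
      have "openin T (W \<inter> V)" "\<one> \<in> W \<inter> V"
        using gW V openin_open_subtopology [OF H_open] by auto
      then obtain u and m :: nat where "u \<in> W \<inter> V" "u [^] m = g"
        using div(3) [of g "W \<inter> V"] gW(1) V(5) by blast
      then show ?thesis using V(3) nat_pow_consistent [of u m H] by auto
    qed
  qed (use F_finite F_H K_compact V(4) K_H CH in \<open>auto simp: compactin_subtopology\<close>)
  have H_d: "lower_central ?G d = {\<one>\<^bsub>?G\<^esub>}"
    using lower_central_subgroup_subset [OF is_group H, of d] d HT.lc_one by auto
  have H_sub: "subgroup (\<Gamma> \<inter> H) ?G"
    using subgroups_Inter_pair [OF \<Gamma>(1) H] H by (simp add: subgroup_incl)
  have H_closed: "closedin ?T (\<Gamma> \<inter> H)"
    using closedin_subset_discrete [OF haus \<Gamma> subset_refl] by (auto simp: closedin_subtopology)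
  have H_gen: "generate ?G F \<subseteq> \<Gamma> \<inter> H" using genF F_\<Gamma> F_FH by blast
  \<comment> \<open>The element \<open>y\<close> need not lie in \<open>H\<close>, but modulo
    \<open>\<Gamma>\<close> it can be replaced by \<open>h\<close>.\<close>
  obtain h \<gamma>\<^sub>0 where h: "h \<in> H" "\<gamma>\<^sub>0 \<in> \<Gamma>" "y = h \<otimes> \<gamma>\<^sub>0" using H_\<Gamma> [OF y] by blast
  have H_approx: "\<exists>n :: nat \<Rightarrow> int. \<forall>I\<subseteq>{..<Suc d}. \<exists>w\<in>W. \<exists>\<gamma>\<in>\<Gamma> \<inter> H.
      \<tau> [^]\<^bsub>?G\<^esub> (\<Sum>j\<in>I. n j) =
        w \<otimes>\<^bsub>?G\<^esub> (if I = {..<Suc d} then h else \<one>\<^bsub>?G\<^esub>) \<otimes>\<^bsub>?G\<^esub> \<gamma>"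
    if W: "openin ?T W" "\<one>\<^bsub>?G\<^esub> \<in> W" for W
  proof -
    have W': "openin T W" "W \<subseteq> H" using W openin_open_subtopology [OF H_open] by auto
    then obtain n :: "nat \<Rightarrow> int" where n: "\<And>I. I \<subseteq> {..<Suc d} \<Longrightarrow> \<exists>w\<in>W. \<exists>\<gamma>\<in>\<Gamma>.
      \<tau> [^] (\<Sum>j\<in>I. n j) = w \<otimes> (if I = {..<Suc d} then y else \<one>) \<otimes> \<gamma>"
      using approx [of W] W(2) by auto
    have approx_H: "\<exists>w\<in>W. \<exists>\<gamma>\<in>\<Gamma> \<inter> H.
      \<tau> [^] (\<Sum>j\<in>I. n j) = w \<otimes> (if I = {..<Suc d} then h else \<one>) \<otimes> \<gamma>"
      if I: "I \<subseteq> {..<Suc d}" for I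
    proof -
      let ?v = "if I = {..<Suc d} then h else \<one>"
      obtain w \<gamma> where w: "w \<in> W" "\<gamma> \<in> \<Gamma>"
        "\<tau> [^] (\<Sum>j\<in>I. n j) = w \<otimes> (if I = {..<Suc d} then y else \<one>) \<otimes> \<gamma>"
        using n [OF I] by blast
      let ?\<gamma> = "if I = {..<Suc d} then \<gamma>\<^sub>0 \<otimes> \<gamma> else \<gamma>"
      have c: "w \<in> carrier G" "\<gamma> \<in> carrier G" "h \<in> carrier G" "\<gamma>\<^sub>0 \<in> carrier G"
        using w W' h Hc \<Gamma>c by blast+
      have eq: "\<tau> [^] (\<Sum>j\<in>I. n j) = w \<otimes> ?v \<otimes> ?\<gamma>"
        unfolding w(3) h(3) using c by (simp add: m_assoc)
      have \<gamma>: "?\<gamma> \<in> \<Gamma>" using w h \<Gamma>m by simp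
      have v: "?v \<in> H" using h H1 by simp
      have wH: "w \<in> H" using w W' by blast
      \<comment> \<open>All other factors of the equation lie in \<open>H\<close>, so the one from
        \<open>\<Gamma>\<close> does as well.\<close>
      have "?\<gamma> = inv (w \<otimes> ?v) \<otimes> \<tau> [^] (\<Sum>j\<in>I. n j)"
        unfolding eq using c by (simp add: word_simps)
      also have "\<dots> \<in> H"
        by (intro Hm Hi wH v subgroup_int_pow_closed [OF H] CH)
      finally show ?thesis using w(1) \<gamma> eq by blast
    qed
    show ?thesis
    proof (intro exI [of _ n] allI impI)
      fix I :: "nat set" assume "I \<subseteq> {..<Suc d}"
      from approx_H [OF this] show "\<exists>w\<in>W. \<exists>\<gamma>\<in>\<Gamma> \<inter> H.
        \<tau> [^]\<^bsub>?G\<^esub> (\<Sum>j\<in>I. n j) =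
          w \<otimes>\<^bsub>?G\<^esub> (if I = {..<Suc d} then h else \<one>\<^bsub>?G\<^esub>) \<otimes>\<^bsub>?G\<^esub> \<gamma>"
        by (simp add: int_pow_consistent [OF H CH(2), symmetric] cong: if_cong
            del: lessThan_Suc sum.lessThan_Suc)
    qed
  qed
  have "h \<in> carrier ?G" using h by simp
  from HL.cube_rigidity [OF H_d H_sub H_closed H_gen this H_approx] have "h \<in> \<Gamma> \<inter> H" .
  then show ?thesis using h \<Gamma>m by simp
qed

end

section \<open>Small roots in Lie groups\<close>

lemma Euclidean_space_proj: "continuous_map (Euclidean_space n) euclideanreal (\<lambda>x. x i)"
  unfolding Euclidean_space_def
  by (intro continuous_map_from_subtopology continuous_map_product_projection) simp

lemma Euclidean_space_box:
  assumes "openin (Euclidean_space n) S" "p \<in> S"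
  shows "\<exists>r>0. \<forall>z\<in>topspace (Euclidean_space n). (\<forall>i<n. \<bar>z i - p i\<bar> < r) \<longrightarrow> z \<in> S"
proof -
  obtain S' where S': "openin (powertop_real UNIV) S'" "S = S' \<inter> {x. \<forall>i\<ge>n. x i = 0}"
    using assms(1) unfolding Euclidean_space_def openin_subtopology by blast
  then have "p \<in> S'" "\<And>i. i \<ge> n \<Longrightarrow> p i = 0" using assms(2) by auto
  obtain U where U: "\<And>i. open (U i)" "\<And>i. p i \<in> U i" "\<And>z. (\<And>i. z i \<in> U i) \<Longrightarrow> z \<in> S'"
    using product_topology_open_contains_basis [OF S'(1) \<open>p \<in> S'\<close>]
    by (force simp: PiE_iff subset_eq)
  have "\<exists>r>0. ball (p i) r \<subseteq> U i" for i using U(1,2) open_contains_ball by blast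
  then obtain r where r: "\<And>i. r i > 0" "\<And>i. ball (p i) (r i) \<subseteq> U i" by metis
  let ?r = "Min (insert 1 (r ` {..<n}))"
  have "z \<in> S" if z: "z \<in> topspace (Euclidean_space n)" "\<And>i. i < n \<Longrightarrow> \<bar>z i - p i\<bar> < ?r" for z
  proof -
    have z0: "z i = 0" if "i \<ge> n" for i using z(1) that by (simp add: topspace_Euclidean_space)
    have "z i \<in> U i" for i
    proof (cases "i < n")
      case True
      then have "\<bar>z i - p i\<bar> < r i" using z(2) [of i] by simp
      then have "z i \<in> ball (p i) (r i)" by (simp add: dist_real_def abs_minus_commute)
      then show ?thesis using r(2) by blast
    next
      case False
      then show ?thesis using z0 [of i] \<open>\<And>i. i \<ge> n \<Longrightarrow> p i = 0\<close> [of i] U(2) [of i] by simp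
    qed
    then show ?thesis using U(3) S'(2) z0 by simp
  qed
  moreover have "?r > 0" using r(1) by auto
  ultimately show ?thesis by blast
qed

text \<open>The path from \<open>z'\<close> to \<open>z\<close> changes one coordinate at a time, so
  the mean value estimate for a single variable applies to each leg. \<open>B\<close> is a box
  because a box contains this path along with its endpoints.\<close>

lemma partial_deriv_estimate:
  fixes F :: "(nat \<Rightarrow> real) \<Rightarrow> real" and p :: "nat \<Rightarrow> real" and r :: real and n :: nat
  defines "B \<equiv> {z \<in> topspace (Euclidean_space n). \<forall>i<n. \<bar>z i - p i\<bar> < r}"
  assumes diff: "\<And>z i. z \<in> B \<Longrightarrow> i < n \<Longrightarrow> (\<lambda>t. F (z(i := t))) differentiable (at (z i))"
    and bound: "\<And>z i. z \<in> B \<Longrightarrow> i < n \<Longrightarrow> \<bar>partial_deriv i F z - c i\<bar> \<le> e"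
    and z: "z \<in> B" "z' \<in> B"
  shows "\<bar>F z - F z' - (\<Sum>i<n. c i * (z i - z' i))\<bar> \<le> e * (\<Sum>i<n. \<bar>z i - z' i\<bar>)"
proof -
  define w where "w = (\<lambda>m i. if i < m then z i else z' i)"
  have "\<bar>F (w m) - F z' - (\<Sum>i<m. c i * (z i - z' i))\<bar> \<le> e * (\<Sum>i<m. \<bar>z i - z' i\<bar>)" if "m \<le> n" for m
    using that
  proof (induction m)
    case 0
    then show ?case by (simp add: w_def)
  next
    case (Suc m)
    then have m: "m < n" by simp
    define S where "S = {min (z m) (z' m)..max (z m) (z' m)}"
    have inB: "(w m)(m := t) \<in> B" if "t \<in> S" for t
    proof -
      have "\<bar>t - p m\<bar> < r" "\<bar>z i - p i\<bar> < r" "\<bar>z' i - p i\<bar> < r" if "i < n" for i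
        using z m \<open>t \<in> S\<close> that unfolding B_def S_def by (auto simp: abs_less_iff) (smt (verit))+
      then show ?thesis
        using z m unfolding B_def w_def by (auto simp: topspace_Euclidean_space)
    qed
    let ?g = "\<lambda>t. F ((w m)(m := t)) - c m * t"
    let ?g' = "\<lambda>t. partial_deriv m F ((w m)(m := t)) - c m"
    have deriv: "(?g has_field_derivative ?g' t) (at t within S)" if "t \<in> S" for t
    proof -
      have "(\<lambda>s. F ((w m)(m := s))) differentiable (at t)"
        using diff [OF inB [OF that] m] by simp
      then have "((\<lambda>s. F ((w m)(m := s))) has_field_derivative deriv (\<lambda>s. F ((w m)(m := s))) t) (at t)"
        by (simp add: DERIV_deriv_iff_real_differentiable)
      then have "((\<lambda>s. F ((w m)(m := s))) has_field_derivative partial_deriv m F ((w m)(m := t))) (at t)"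
        by (simp add: partial_deriv_def)
      then have "(?g has_field_derivative partial_deriv m F ((w m)(m := t)) - c m * 1) (at t)"
        by (auto intro!: derivative_eq_intros)
      then show ?thesis by (simp add: has_field_derivative_at_within)
    qed
    have "norm (?g (z m) - ?g (z' m)) \<le> e * norm (z m - z' m)"
    proof (rule field_differentiable_bound [OF _ deriv])
      show "norm (?g' t) \<le> e" if "t \<in> S" for t using bound [OF inB [OF that] m] by simp
    qed (auto simp: S_def)
    moreover have "(w m)(m := z m) = w (Suc m)" "(w m)(m := z' m) = w m"
      by (auto simp: w_def fun_eq_iff less_Suc_eq)
    ultimately have "\<bar>F (w (Suc m)) - F (w m) - c m * (z m - z' m)\<bar> \<le> e * \<bar>z m - z' m\<bar>"
      by (simp add: algebra_simps)
    moreover have "\<bar>F (w m) - F z' - (\<Sum>i<m. c i * (z i - z' i))\<bar> \<le> e * (\<Sum>i<m. \<bar>z i - z' i\<bar>)"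
      using Suc by simp
    ultimately show ?case by (simp add: distrib_left)
  qed
  moreover have "w n = z" using z by (auto simp: w_def fun_eq_iff B_def topspace_Euclidean_space)
  ultimately show ?thesis using order_refl [of n] by fastforce
qed

text \<open>Newton's method with the derivative frozen at twice the identity:
  \<open>g x = x - (f x - y) / 2\<close> contracts distances by the factor \<open>1/4\<close>, and
  its first step from \<open>p\<close> has length \<open>N y p / 2\<close>. The geometric series
  sums to \<open>2/3\<close> of \<open>N y p\<close>; this factor below 1 keeps the iterates in the
  ball and later makes iterated roots shrink.\<close>

lemma contraction_solve:
  fixes f :: "(nat \<Rightarrow> real) \<Rightarrow> nat \<Rightarrow> real" and n :: nat
  defines "E \<equiv> topspace (Euclidean_space n)" and "N \<equiv> \<lambda>x y. \<Sum>i<n. \<bar>x i - y i\<bar>"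
  assumes p: "p \<in> E" "\<And>j. j < n \<Longrightarrow> f p j = p j"
    and est: "\<And>x x'. x \<in> E \<Longrightarrow> x' \<in> E \<Longrightarrow> N x p < r \<Longrightarrow> N x' p < r \<Longrightarrow>
      (\<Sum>j<n. \<bar>f x j - f x' j - 2 * (x j - x' j)\<bar>) \<le> N x x' / 2"
    and y: "N y p < r"
  shows "\<exists>x\<in>E. N x p \<le> 2/3 * N y p \<and> (\<forall>j<n. f x j = y j)"
proof -
  define g where "g = (\<lambda>x j. if j < n then x j - (f x j - y j) / 2 else 0)"
  define s where "s = 2/3 * N y p"
  have N_nonneg: "N x x' \<ge> 0" for x x' unfolding N_def by (simp add: sum_nonneg)
  have tri: "N x x'' \<le> N x x' + N x' x''" for x x' x''
    unfolding N_def sum.distrib [symmetric] by (intro sum_mono) simp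
  have s: "0 \<le> s" "s < r" using N_nonneg [of y p] y by (auto simp: s_def)
  have gE: "g x \<in> E" for x by (simp add: g_def E_def topspace_Euclidean_space)
  have contr: "N (g x) (g x') \<le> N x x' / 4" if "x \<in> E" "x' \<in> E" "N x p < r" "N x' p < r" for x x'
  proof -
    have "N (g x) (g x') = (\<Sum>j<n. \<bar>f x j - f x' j - 2 * (x j - x' j)\<bar> / 2)"
      unfolding N_def by (intro sum.cong) (auto simp: g_def field_simps abs_if)
    then show ?thesis using est [OF that] by (simp add: sum_divide_distrib [symmetric])
  qed
  have gp: "N (g p) p = N y p / 2"
    unfolding N_def sum_divide_distrib by (intro sum.cong) (auto simp: g_def p(2) abs_if field_simps)
  have N0: "N p p = 0" by (simp add: N_def)
  have g_ball: "N (g x) p \<le> s" if "x \<in> E" "N x p \<le> s" for x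
  proof -
    have "N (g x) p \<le> N (g x) (g p) + N (g p) p" by (rule tri)
    also have "N (g x) (g p) \<le> N x p / 4" using that p s by (intro contr) (simp_all add: N0)
    finally show ?thesis using that gp by (simp add: s_def)
  qed
  define x where "x = (\<lambda>k. (g ^^ k) p)"
  have x_Suc: "x (Suc k) = g (x k)" for k by (simp add: x_def)
  have x: "x k \<in> E \<and> N (x k) p \<le> s" for k
  proof (induction k)
    case 0
    then show ?case using p s by (simp add: x_def N0)
  next
    case (Suc k)
    then show ?case using g_ball gE by (simp add: x_Suc)
  qed
  have xr: "N (x k) p < r" for k using x [of k] s by simp
  have step: "N (x (Suc k)) (x k) \<le> s * (1/4) ^ k" for k
  proof (induction k)
    case 0
    then show ?case using x [of 1] by (simp add: x_def)
  next
    case (Suc k)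
    have "N (x (Suc (Suc k))) (x (Suc k)) \<le> N (x (Suc k)) (x k) / 4"
      unfolding x_Suc [of "Suc k"] x_Suc [of k] using x xr by (intro contr) (auto simp: x_Suc [symmetric])
    then show ?case using Suc by simp
  qed
  have "\<exists>l. (\<lambda>k. x k i) \<longlonglongrightarrow> l" if i: "i < n" for i
  proof -
    have bound: "norm (x (Suc k) i - x k i) \<le> s * (1/4) ^ k" for k
    proof -
      have "\<bar>x (Suc k) i - x k i\<bar> \<le> N (x (Suc k)) (x k)"
        unfolding N_def using i by (intro member_le_sum) auto
      then show ?thesis using step [of k] by simp
    qed
    have "summable (\<lambda>k. s * (1/4) ^ k)" by (intro summable_mult summable_geometric) simp
    then have "summable (\<lambda>k. x (Suc k) i - x k i)"
      using bound by (rule summable_comparison_test')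
    then have "convergent (\<lambda>m. \<Sum>k<m. x (Suc k) i - x k i)"
      by (simp add: summable_iff_convergent)
    then have "convergent (\<lambda>m. x m i - x 0 i)"
      by (simp add: sum_lessThan_telescope [of "\<lambda>k. x k i"])
    then have "convergent (\<lambda>m. (x m i - x 0 i) + x 0 i)" by (intro convergent_add convergent_const)
    then show ?thesis by (simp add: convergent_def)
  qed
  then obtain l where l: "\<And>i. i < n \<Longrightarrow> (\<lambda>k. x k i) \<longlonglongrightarrow> l i" by metis
  define L where "L = (\<lambda>i. if i < n then l i else 0)"
  have LE: "L \<in> E" by (simp add: L_def E_def topspace_Euclidean_space)
  have "(\<lambda>k. N (x k) v) \<longlonglongrightarrow> N L v" for v
    unfolding N_def L_def using l by (intro tendsto_intros) auto
  then have lim: "(\<lambda>k. N (x k) v) \<longlonglongrightarrow> N L v" for v .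
  have Ls: "N L p \<le> s" using x by (intro LIMSEQ_le_const2 [OF lim]) auto
  have "N (g L) L \<le> 0"
  proof (rule LIMSEQ_le_const [of "\<lambda>k. N (x k) L / 4 + N (x (Suc k)) L"])
    have "(\<lambda>k. N (x k) L / 4 + N (x (Suc k)) L) \<longlonglongrightarrow> N L L / 4 + N L L"
      by (intro tendsto_intros lim LIMSEQ_Suc [OF lim]) simp
    then show "(\<lambda>k. N (x k) L / 4 + N (x (Suc k)) L) \<longlonglongrightarrow> 0" by (simp add: N_def)
    have "N (g L) L \<le> N (x k) L / 4 + N (x (Suc k)) L" for k
    proof -
      have "N (g L) (g (x k)) \<le> N L (x k) / 4" using LE Ls s x xr by (intro contr) auto
      moreover have "N L (x k) = N (x k) L" by (simp add: N_def abs_minus_commute)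
      ultimately show ?thesis using tri [of "g L" L "g (x k)"] by (simp add: x_Suc)
    qed
    then show "\<exists>K. \<forall>k\<ge>K. N (g L) L \<le> N (x k) L / 4 + N (x (Suc k)) L" by blast
  qed
  then have "N (g L) L = 0" using N_nonneg [of "g L" L] by simp
  then have "\<bar>g L j - L j\<bar> = 0" if "j < n" for j
    using that unfolding N_def by (subst (asm) sum_nonneg_eq_0_iff) auto
  then have "f L j = y j" if "j < n" for j
    using that by (force simp: g_def)
  then show ?thesis using LE Ls s_def by blast
qed

lemma sum_lessThan_add: "(\<Sum>i<n + m. f i) = (\<Sum>i<n. f i) + (\<Sum>i<m. f (n + i :: nat) :: real)"
  by (induction m) (simp_all add: algebra_simps)

section \<open>Lie groups in charts\<close>

lemma lie_group_topological_group:
  assumes "lie_group G T"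
  shows "topological_group G T"
proof -
  interpret group G using assms by (simp add: lie_group_def)
  show ?thesis
    using assms by unfold_locales (auto simp: lie_group_def smooth_map_def)
qed

lemma smooth_atlas_chart:
  assumes "smooth_atlas n T \<A>" "x \<in> topspace T"
  obtains U \<phi> where "(U, \<phi>) \<in> \<A>" "x \<in> U" "openin T U" "openin (Euclidean_space n) (\<phi> ` U)"
    "homeomorphic_map (subtopology T U) (subtopology (Euclidean_space n) (\<phi> ` U)) \<phi>"
proof -
  have "x \<in> (\<Union>(U, \<phi>)\<in>\<A>. U)" using assms unfolding smooth_atlas_def by blast
  then obtain U \<phi> where U: "(U, \<phi>) \<in> \<A>" "x \<in> U" by blast
  have "openin T U \<and> openin (Euclidean_space n) (\<phi> ` U) \<and>
    homeomorphic_map (subtopology T U) (subtopology (Euclidean_space n) (\<phi> ` U)) \<phi>"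
    using assms(1) U(1) unfolding smooth_atlas_def by blast
  then show ?thesis using that U by blast
qed

lemma lie_group_locally_compact:
  assumes "lie_group G T"
  shows "locally_compact_space T"
proof -
  obtain n \<A> where A: "smooth_atlas n T \<A>" using assms by (auto simp: lie_group_def)
  show ?thesis
    unfolding locally_compact_space_def
  proof
    fix x assume "x \<in> topspace T"
    then obtain U \<phi> where U: "x \<in> U" and
      chart: "openin T U" "openin (Euclidean_space n) (\<phi> ` U)"
      "homeomorphic_map (subtopology T U) (subtopology (Euclidean_space n) (\<phi> ` U)) \<phi>"
      by (rule smooth_atlas_chart [OF A])
    have "locally_compact_space (subtopology (Euclidean_space n) (\<phi> ` U))"
      using chart(2) locally_compact_Euclidean_space Hausdorff_Euclidean_space
      by (intro locally_compact_space_open_subset) auto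
    then have "locally_compact_space (subtopology T U)"
      using chart(3) homeomorphic_locally_compact_space homeomorphic_map_imp_homeomorphic_space by blast
    moreover have "x \<in> topspace (subtopology T U)" using U chart openin_subset by auto
    ultimately obtain V K where V: "openin (subtopology T U) V" "compactin (subtopology T U) K"
      "x \<in> V" "V \<subseteq> K"
      unfolding locally_compact_space_def by blast
    then show "\<exists>V K. openin T V \<and> compactin T K \<and> x \<in> V \<and> V \<subseteq> K"
      using chart(1) openin_open_subtopology compactin_subtopology by metis
  qed
qed

text \<open>In a chart around the identity, squaring has derivative 2 at the identity, so it can be inverted
  there by a contraction whose solution is closer to the identity than the given element.\<close>

lemma lie_group_square_root:
  fixes G (structure)
  assumes lie: "lie_group G T"
  obtains n U \<phi> r where "openin T U" "\<one> \<in> U" "r > 0" "openin (Euclidean_space n) (\<phi> ` U)"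
    "homeomorphic_map (subtopology T U) (subtopology (Euclidean_space n) (\<phi> ` U)) \<phi>"
    "\<And>g. g \<in> U \<Longrightarrow> (\<Sum>i<n. \<bar>\<phi> g i - \<phi> \<one> i\<bar>) < r \<Longrightarrow>
      \<exists>h\<in>U. h \<otimes> h = g \<and> (\<Sum>i<n. \<bar>\<phi> h i - \<phi> \<one> i\<bar>) \<le> 2/3 * (\<Sum>i<n. \<bar>\<phi> g i - \<phi> \<one> i\<bar>)"
proof -
  interpret topological_group G T using lie_group_topological_group [OF lie] .
  obtain n \<A> where A: "smooth_atlas n T \<A>"
    "smooth_map (n + n) (prod_topology T T) (prod_atlas n \<A> \<A>) n T \<A> (\<lambda>(x, y). x \<otimes> y)"
    using lie by (auto simp: lie_group_def)
  have "\<one> \<in> topspace T" by (simp add: topspace_eq)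
  then obtain U \<phi> where U: "(U, \<phi>) \<in> \<A>" "\<one> \<in> U" and
    chart: "openin T U" "openin (Euclidean_space n) (\<phi> ` U)"
    "homeomorphic_map (subtopology T U) (subtopology (Euclidean_space n) (\<phi> ` U)) \<phi>"
    by (rule smooth_atlas_chart [OF A(1)])
  have Uc: "U \<subseteq> carrier G" using openin_subset [OF chart(1)] topspace_eq by simp
  have inj: "inj_on \<phi> U"
    using homeomorphic_imp_injective_map [OF chart(3)] Uc by (simp add: topspace_eq Int_absorb1)
  let ?E = "topspace (Euclidean_space n)" and ?E2 = "topspace (Euclidean_space (n + n))"
  have \<phi>E: "\<phi> g \<in> ?E" if "g \<in> U" for g using openin_subset [OF chart(2)] that by blast
  define p where "p = \<phi> \<one>"
  define pair where "pair = (\<lambda>x y :: nat \<Rightarrow> real. \<lambda>i. if i < n then x i else y (i - n))"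
  define \<psi> where "\<psi> = (\<lambda>(x, y) i. if i < n then \<phi> x i else \<phi> y (i - n))"
  define D where "D = \<psi> ` {z \<in> U \<times> U. (case z of (x, y) \<Rightarrow> x \<otimes> y) \<in> U}"
  define F where "F = (\<lambda>j z. \<phi> (case inv_into (U \<times> U) \<psi> z of (x, y) \<Rightarrow> x \<otimes> y) j)"
  have "(U \<times> U, \<psi>) \<in> prod_atlas n \<A> \<A>"
    using U(1) unfolding prod_atlas_def \<psi>_def by fastforce
  then have "smooth_on_Rn (n + n) n D (\<phi> \<circ> (\<lambda>(x, y). x \<otimes> y) \<circ> inv_into (U \<times> U) \<psi>)"
    using A(2) U(1) unfolding smooth_map_def D_def by fastforce
  then have C1: "C_k_on (n + n) D (Suc 0) (F j)" if "j < n" for j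
    using that unfolding smooth_on_Rn_def F_def comp_def by blast
  have \<psi>_eq: "\<psi> (g, h) = pair (\<phi> g) (\<phi> h)" for g h
    by (auto simp: \<psi>_def pair_def)
  have pair_inj: "x = x' \<and> y = y'"
    if "pair x y = pair x' y'" "x \<in> ?E" "y \<in> ?E" "x' \<in> ?E" "y' \<in> ?E" for x y x' y'
  proof -
    have eq: "pair x y i = pair x' y' i" for i using that(1) by simp
    have "x i = x' i" for i
      using eq [of i] that(2-) by (cases "i < n") (auto simp: pair_def topspace_Euclidean_space)
    moreover have "y i = y' i" for i
      using eq [of "n + i"] by (simp add: pair_def)
    ultimately show ?thesis by blast
  qed
  have inj_\<psi>: "inj_on \<psi> (U \<times> U)"
  proof (rule inj_onI)
    fix z z' assume z: "z \<in> U \<times> U" "z' \<in> U \<times> U" "\<psi> z = \<psi> z'"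
    obtain g h g' h' where gh: "z = (g, h)" "z' = (g', h')" by (metis prod.exhaust)
    have mem: "g \<in> U" "h \<in> U" "g' \<in> U" "h' \<in> U" using z gh by auto
    have "pair (\<phi> g) (\<phi> h) = pair (\<phi> g') (\<phi> h')" using z(3) by (simp add: gh \<psi>_eq)
    from pair_inj [OF this] have "\<phi> g = \<phi> g'" "\<phi> h = \<phi> h'" using mem \<phi>E by blast+
    then show "z = z'" using inj_onD [OF inj] mem gh by blast
  qed
  have F_eq: "F j (pair (\<phi> g) (\<phi> h)) = \<phi> (g \<otimes> h) j" if "g \<in> U" "h \<in> U" for g h j
    unfolding F_def using inv_into_f_f [OF inj_\<psi>, of "(g, h)"] that by (simp add: \<psi>_eq)
  have D_mem: "pair (\<phi> g) (\<phi> h) \<in> D" if "g \<in> U" "h \<in> U" "g \<otimes> h \<in> U" for g h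
    unfolding D_def using that by (intro image_eqI [of _ _ "(g, h)"]) (auto simp: \<psi>_eq)
  let ?P = "pair p p"
  have PD: "?P \<in> D" using D_mem [of \<one> \<one>] U(2) by (simp add: p_def)
  have pE: "p \<in> ?E" using \<phi>E U(2) by (simp add: p_def)
  have P2: "?P \<in> ?E2" using pE by (auto simp: pair_def topspace_Euclidean_space)
  \<comment> \<open>The Jacobian of multiplication at the identity: component \<open>j\<close> has
    derivative 1 along coordinate \<open>j\<close> of either factor and 0 along all others.\<close>
  define c where "c = (\<lambda>j i. if i = j \<or> i = n + j then 1 else 0 :: real)"
  obtain r0 where r0: "r0 > 0" "\<And>z. z \<in> ?E \<Longrightarrow> (\<And>i. i < n \<Longrightarrow> \<bar>z i - p i\<bar> < r0) \<Longrightarrow> z \<in> \<phi> ` U"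
    using Euclidean_space_box [OF chart(2), of p] U(2) unfolding p_def by blast
  \<comment> \<open>While a single coordinate moves, one factor stays at the identity and the
    product is the other factor.\<close>
  have pd_P: "partial_deriv i (F j) ?P = c j i" if ij: "i < n + n" "j < n" for i j
  proof -
    have ev: "\<forall>\<^sub>F t in nhds (?P i). \<bar>t - ?P i\<bar> < r0"
      using r0(1) eventually_nhds_metric [of "\<lambda>t. \<bar>t - ?P i\<bar> < r0" "?P i"]
      by (auto simp: dist_real_def)
    have "\<forall>\<^sub>F t in nhds (?P i). F j (?P(i := t)) = (if c j i = 1 then t else p j)"
      using ev
    proof eventually_elim
      case (elim t)
      show ?case
      proof (cases "i < n")
        case True
        have "p(i := t) \<in> \<phi> ` U"
          using pE elim True r0 by (intro r0(2)) (auto simp: topspace_Euclidean_space pair_def)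
        then obtain g where g: "g \<in> U" "p(i := t) = \<phi> g" by blast
        have "?P(i := t) = pair (p(i := t)) p" using True by (auto simp: pair_def)
        then have "F j (?P(i := t)) = \<phi> (g \<otimes> \<one>) j" using F_eq g U(2) by (simp add: p_def)
        also have "\<dots> = (p(i := t)) j" using g Uc by auto
        finally show ?thesis using True ij by (auto simp: c_def)
      next
        case False
        have "p(i - n := t) \<in> \<phi> ` U"
          using pE elim False ij r0 by (intro r0(2)) (auto simp: topspace_Euclidean_space pair_def)
        then obtain g where g: "g \<in> U" "p(i - n := t) = \<phi> g" by blast
        have "?P(i := t) = pair p (p(i - n := t))" using False by (auto simp: pair_def fun_eq_iff)
        then have "F j (?P(i := t)) = \<phi> (\<one> \<otimes> g) j" using F_eq g U(2) by (simp add: p_def)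
        also have "\<dots> = (p(i - n := t)) j" using g Uc by auto
        finally show ?thesis using False ij by (auto simp: c_def)
      qed
    qed
    then have "partial_deriv i (F j) ?P = deriv (\<lambda>t. if c j i = 1 then t else p j) (?P i)"
      unfolding partial_deriv_def by (intro deriv_cong_ev) auto
    also have "\<dots> = c j i" by (cases "c j i = 1") (auto simp: c_def split: if_splits)
    finally show ?thesis .
  qed
  \<comment> \<open>Each of the \<open>n\<close> components of squaring errs by at most
    \<open>2 e N\<close>, in total \<open>2 n e N \<le> N / 2\<close>, the tolerance of
    \<open>contraction_solve\<close>. \<open>Suc n\<close> covers \<open>n = 0\<close>.\<close>
  define e where "e = 1 / (4 * real (Suc n))"
  have e: "e > 0" by (simp add: e_def)
  have "\<exists>r>0. \<forall>z\<in>?E2. (\<forall>k<n + n. \<bar>z k - ?P k\<bar> < r) \<longrightarrow> z \<in> D \<longrightarrow>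
      \<bar>partial_deriv i (F j) z - c j i\<bar> \<le> e" if ij: "i < n + n" "j < n" for i j
  proof -
    let ?X = "subtopology (Euclidean_space (n + n)) D"
    have "continuous_map ?X euclideanreal (partial_deriv i (F j))"
      using C1 [OF ij(2)] ij(1) by simp
    then have "openin ?X {z \<in> topspace ?X. partial_deriv i (F j) z \<in> ball (c j i) e}"
      by (rule openin_continuous_map_preimage) simp
    then obtain V where V: "openin (Euclidean_space (n + n)) V"
      "{z \<in> topspace ?X. partial_deriv i (F j) z \<in> ball (c j i) e} = V \<inter> D"
      unfolding openin_subtopology by blast
    have "?P \<in> {z \<in> topspace ?X. partial_deriv i (F j) z \<in> ball (c j i) e}"
      using P2 PD pd_P [OF ij] e by simp
    then have "?P \<in> V" using V(2) by blast
    then obtain r where r: "r > 0" "\<forall>z\<in>?E2. (\<forall>k<n + n. \<bar>z k - ?P k\<bar> < r) \<longrightarrow> z \<in> V"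
      using Euclidean_space_box [OF V(1)] by blast
    have "\<bar>partial_deriv i (F j) z - c j i\<bar> \<le> e" if "z \<in> V" "z \<in> D" for z
    proof -
      have "partial_deriv i (F j) z \<in> ball (c j i) e" using V(2) that by blast
      then show ?thesis by (simp add: dist_real_def abs_minus_commute)
    qed
    then show ?thesis using r by blast
  qed
  then obtain r1 where r1: "\<And>i j. i < n + n \<Longrightarrow> j < n \<Longrightarrow> r1 i j > 0"
    "\<And>i j z. i < n + n \<Longrightarrow> j < n \<Longrightarrow> z \<in> ?E2 \<Longrightarrow> (\<And>k. k < n + n \<Longrightarrow> \<bar>z k - ?P k\<bar> < r1 i j) \<Longrightarrow>
      z \<in> D \<Longrightarrow> \<bar>partial_deriv i (F j) z - c j i\<bar> \<le> e" by metis
  have cont: "continuous_map (prod_topology T T) T (\<lambda>(x, y). x \<otimes> y)" by (rule continuous_mult)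
  have "openin (prod_topology T T) {z \<in> topspace (prod_topology T T). (case z of (x, y) \<Rightarrow> x \<otimes> y) \<in> U}"
    using openin_continuous_map_preimage [OF cont chart(1)] .
  then have "\<exists>V W. openin T V \<and> openin T W \<and> \<one> \<in> V \<and> \<one> \<in> W \<and>
      V \<times> W \<subseteq> {z \<in> topspace (prod_topology T T). (case z of (x, y) \<Rightarrow> x \<otimes> y) \<in> U}"
    by (rule openin_prod_topology_alt [THEN iffD1, rule_format]) (use U(2) topspace_eq in simp)
  then obtain V W where VW: "openin T V" "openin T W" "\<one> \<in> V" "\<one> \<in> W" and
    sub: "V \<times> W \<subseteq> {z \<in> topspace (prod_topology T T). (case z of (x, y) \<Rightarrow> x \<otimes> y) \<in> U}"
    by (elim exE conjE)
  have VW_mult: "g \<otimes> h \<in> U" if "g \<in> V" "h \<in> W" for g h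
  proof -
    have "(g, h) \<in> V \<times> W" using that by simp
    then show ?thesis using sub by auto
  qed
  \<comment> \<open>Products of two points of \<open>?V\<close> stay in the chart \<open>U\<close>,
    so a coordinate box for \<open>?V\<close> in both factors lies in the domain
    \<open>D\<close>.\<close>
  let ?V = "U \<inter> V \<inter> W"
  have "openin (subtopology T U) ?V"
    using chart(1) VW by (auto simp: openin_open_subtopology)
  then have "openin (subtopology (Euclidean_space n) (\<phi> ` U)) (\<phi> ` ?V)"
    using homeomorphic_imp_open_map [OF chart(3)] by (simp add: open_map_def)
  then have "openin (Euclidean_space n) (\<phi> ` ?V)"
    using chart(2) openin_open_subtopology by blast
  moreover have "p \<in> \<phi> ` ?V" using U(2) VW by (auto simp: p_def)
  ultimately obtain r2 where r2: "r2 > 0"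
    "\<And>z. z \<in> ?E \<Longrightarrow> (\<And>i. i < n \<Longrightarrow> \<bar>z i - p i\<bar> < r2) \<Longrightarrow> z \<in> \<phi> ` ?V"
    using Euclidean_space_box by metis
  \<comment> \<open>The remaining radii form an empty set if \<open>n = 0\<close>; \<open>r2\<close>
    keeps the minimum defined.\<close>
  define r where "r = Min (insert r2 ((\<lambda>(i, j). r1 i j) ` ({..<n + n} \<times> {..<n})))"
  have r: "r > 0" using r1(1) r2(1) by (auto simp: r_def)
  have r_le: "r \<le> r2" "\<And>i j. i < n + n \<Longrightarrow> j < n \<Longrightarrow> r \<le> r1 i j"
    unfolding r_def by (auto intro!: Min_le)
  let ?B = "{z \<in> ?E2. \<forall>i<n + n. \<bar>z i - ?P i\<bar> < r}"
  have B_D: "z \<in> D" if z: "z \<in> ?B" for z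
  proof -
    define x y where "x = (\<lambda>i. if i < n then z i else 0)" and "y = (\<lambda>i. z (n + i))"
    have "x \<in> \<phi> ` ?V"
    proof (intro r2(2))
      show "x \<in> ?E" by (simp add: x_def topspace_Euclidean_space)
      show "\<bar>x i - p i\<bar> < r2" if "i < n" for i
      proof -
        have "\<bar>z i - ?P i\<bar> < r" using z that by auto
        then show ?thesis using r_le(1) that by (simp add: x_def pair_def)
      qed
    qed
    moreover have "y \<in> \<phi> ` ?V"
    proof (intro r2(2))
      show "y \<in> ?E" using z by (auto simp: y_def topspace_Euclidean_space)
      show "\<bar>y i - p i\<bar> < r2" if "i < n" for i
      proof -
        have "\<bar>z (n + i) - ?P (n + i)\<bar> < r" using z that by auto
        then show ?thesis using r_le(1) by (simp add: y_def pair_def)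
      qed
    qed
    ultimately obtain g h where g: "g \<in> ?V" "x = \<phi> g" and h: "h \<in> ?V" "y = \<phi> h" by blast
    have "z = pair x y" by (auto simp: x_def y_def pair_def)
    then show ?thesis using D_mem [of g h] g h VW_mult [of g h] by auto
  qed
  have est: "\<bar>F j z - F j z' - (\<Sum>i<n + n. c j i * (z i - z' i))\<bar> \<le> e * (\<Sum>i<n + n. \<bar>z i - z' i\<bar>)"
    if j: "j < n" and z: "z \<in> ?B" "z' \<in> ?B" for j z z'
  proof (rule partial_deriv_estimate [OF _ _ z])
    show "(\<lambda>t. F j (z(i := t))) differentiable at (z i)" if "z \<in> ?B" "i < n + n" for z i
      using C1 [OF j] that B_D by auto
    show "\<bar>partial_deriv i (F j) z - c j i\<bar> \<le> e" if "z \<in> ?B" "i < n + n" for z i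
      using that j B_D r_le(2) by (intro r1(2)) fastforce+
  qed
  let ?N = "\<lambda>x y :: nat \<Rightarrow> real. \<Sum>i<n. \<bar>x i - y i\<bar>"
  let ?f = "\<lambda>x j. F j (pair x x)"
  have ball_B: "pair x x \<in> ?B" if x: "x \<in> ?E" "?N x p < r" for x
  proof -
    have "\<bar>x i - p i\<bar> < r" if "i < n" for i
    proof -
      have "\<bar>x i - p i\<bar> \<le> ?N x p" using that by (intro member_le_sum) auto
      then show ?thesis using x by simp
    qed
    then show ?thesis using x(1) by (auto simp: pair_def topspace_Euclidean_space)
  qed
  have square: "(\<Sum>j<n. \<bar>?f x j - ?f x' j - 2 * (x j - x' j)\<bar>) \<le> ?N x x' / 2"
    if x: "x \<in> ?E" "x' \<in> ?E" "?N x p < r" "?N x' p < r" for x x'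
  proof -
    have "\<bar>?f x j - ?f x' j - 2 * (x j - x' j)\<bar> \<le> e * (2 * ?N x x')" if j: "j < n" for j
    proof -
      have "(\<Sum>i<n + n. c j i * (pair x x i - pair x' x' i)) =
          (\<Sum>i<n. c j i * (x i - x' i)) + (\<Sum>i<n. c j (n + i) * (x i - x' i))"
        unfolding sum_lessThan_add by (intro arg_cong2 [of _ _ _ _ "(+)"] sum.cong) (auto simp: pair_def)
      also have "(\<Sum>i<n. c j i * (x i - x' i)) = (\<Sum>i<n. if i = j then x i - x' i else 0)"
        by (intro sum.cong) (auto simp: c_def)
      also have "(\<Sum>i<n. c j (n + i) * (x i - x' i)) = (\<Sum>i<n. if i = j then x i - x' i else 0)"
        using j by (intro sum.cong) (auto simp: c_def)
      finally have 1: "(\<Sum>i<n + n. c j i * (pair x x i - pair x' x' i)) = 2 * (x j - x' j)"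
        using j by simp
      have "(\<Sum>i<n + n. \<bar>pair x x i - pair x' x' i\<bar>) = ?N x x' + ?N x x'"
        unfolding sum_lessThan_add by (intro arg_cong2 [of _ _ _ _ "(+)"] sum.cong) (auto simp: pair_def)
      then show ?thesis using est [OF j ball_B ball_B, of x x'] x 1 by simp
    qed
    then have "(\<Sum>j<n. \<bar>?f x j - ?f x' j - 2 * (x j - x' j)\<bar>) \<le> (\<Sum>j<n. e * (2 * ?N x x'))"
      by (intro sum_mono) simp
    also have "\<dots> = (real n / real (Suc n)) * (?N x x' / 2)"
      by (simp add: e_def divide_simps)
    also have "\<dots> \<le> 1 * (?N x x' / 2)"
      by (intro mult_right_mono) (auto simp: sum_nonneg)
    finally show ?thesis by simp
  qed
  have "\<exists>h\<in>U. h \<otimes> h = g \<and> ?N (\<phi> h) p \<le> 2/3 * ?N (\<phi> g) p" if g: "g \<in> U" "?N (\<phi> g) p < r" for g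
  proof -
    have "?f p j = p j" for j using F_eq [of \<one> \<one> j] U(2) by (simp add: p_def)
    then obtain x where x: "x \<in> ?E" "?N x p \<le> 2/3 * ?N (\<phi> g) p" "\<And>j. j < n \<Longrightarrow> ?f x j = \<phi> g j"
      using contraction_solve [OF pE _ square g(2)] by blast
    have "?N (\<phi> g) p \<ge> 0" by (simp add: sum_nonneg)
    then have "?N x p < r" using x(2) g(2) by linarith
    have "x \<in> \<phi> ` ?V"
    proof (intro r2(2) x(1))
      show "\<bar>x i - p i\<bar> < r2" if "i < n" for i
      proof -
        have "\<bar>x i - p i\<bar> \<le> ?N x p" using that by (intro member_le_sum) auto
        then show ?thesis using \<open>?N x p < r\<close> r_le(1) by simp
      qed
    qed
    then obtain h where h: "h \<in> ?V" "x = \<phi> h" by blast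
    have hh: "h \<otimes> h \<in> U" using h VW_mult by blast
    have "\<phi> (h \<otimes> h) j = \<phi> g j" for j
    proof (cases "j < n")
      case True
      then show ?thesis using x(3) [of j] F_eq [of h h j] h by simp
    next
      case False
      then show ?thesis using \<phi>E [OF hh] \<phi>E [OF g(1)] by (simp add: topspace_Euclidean_space)
    qed
    then have "h \<otimes> h = g" using inj_onD [OF inj _ hh g(1)] by blast
    then show ?thesis using h x by blast
  qed
  then show ?thesis unfolding p_def by (rule that [OF chart(1) U(2) r chart(2,3)])
qed

text \<open>Taking square roots \<open>k\<close> times gives a root of order \<open>2 ^ k\<close>
  whose coordinate distance to \<open>\<one>\<close> has shrunk by \<open>(2/3) ^ k\<close>. As
  distances only decrease, every intermediate root stays where the next square root exists.\<close>

lemma lie_group_small_roots: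
  fixes G (structure)
  assumes lie: "lie_group G T"
  obtains U where "openin T U" "\<one> \<in> U" "\<And>g V. g \<in> U \<Longrightarrow> openin T V \<Longrightarrow> \<one> \<in> V \<Longrightarrow>
    \<exists>u\<in>V. \<exists>m::nat. u [^] m = g"
proof -
  interpret topological_group G T using lie_group_topological_group [OF lie] .
  obtain n U \<phi> r where U: "openin T U" "\<one> \<in> U" "r > 0" "openin (Euclidean_space n) (\<phi> ` U)"
    and homeo: "homeomorphic_map (subtopology T U) (subtopology (Euclidean_space n) (\<phi> ` U)) \<phi>"
    and root: "\<And>g. g \<in> U \<Longrightarrow> (\<Sum>i<n. \<bar>\<phi> g i - \<phi> \<one> i\<bar>) < r \<Longrightarrow>
      \<exists>h\<in>U. h \<otimes> h = g \<and> (\<Sum>i<n. \<bar>\<phi> h i - \<phi> \<one> i\<bar>) \<le> 2/3 * (\<Sum>i<n. \<bar>\<phi> g i - \<phi> \<one> i\<bar>)"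
    by (rule lie_group_square_root [OF lie]) (rule that)
  define N where "N = (\<lambda>g. \<Sum>i<n. \<bar>\<phi> g i - \<phi> \<one> i\<bar>)"
  have N_nonneg: "N g \<ge> 0" for g by (simp add: N_def sum_nonneg)
  have Uc: "U \<subseteq> carrier G" using openin_subset [OF U(1)] topspace_eq by simp
  have inj: "inj_on \<phi> U"
    using homeomorphic_imp_injective_map [OF homeo] Uc by (simp add: topspace_eq Int_absorb1)
  let ?U = "{g \<in> topspace (subtopology T U). N g \<in> {..<r}}"
  have cont: "continuous_map (subtopology T U) (Euclidean_space n) \<phi>"
    using homeomorphic_imp_continuous_map [OF homeo] continuous_map_into_fulltopology by blast
  have "continuous_map (subtopology T U) euclideanreal (\<lambda>g. \<phi> g i)" for i
    using continuous_map_compose [OF cont Euclidean_space_proj] by (simp add: comp_def)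
  then have "continuous_map (subtopology T U) euclideanreal N"
    unfolding N_def by (intro continuous_intros) auto
  then have "openin (subtopology T U) ?U"
    by (rule openin_continuous_map_preimage) simp
  then have "openin T ?U" using openin_open_subtopology [OF U(1)] by blast
  moreover have "\<one> \<in> ?U" using U by (simp add: N_def topspace_eq)
  moreover have "\<exists>u\<in>V. \<exists>m::nat. u [^] m = g" if g: "g \<in> ?U" and V: "openin T V" "\<one> \<in> V" for g V
  proof -
    have gU: "g \<in> U" "N g < r" using g by auto
    have roots: "\<exists>h\<in>U. h [^] ((2::nat) ^ k) = g \<and> N h \<le> (2/3) ^ k * N g" for k
    proof (induction k)
      case 0
      then show ?case using gU Uc by (intro bexI [of _ g]) auto
    next
      case (Suc k)
      then obtain h where h: "h \<in> U" "h [^] ((2::nat) ^ k) = g" "N h \<le> (2/3) ^ k * N g" by blast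
      have "(2/3) ^ k * N g \<le> 1 * N g"
        using N_nonneg by (intro mult_right_mono) (auto intro: power_le_one)
      then have "N h < r" using h(3) gU(2) by simp
      then obtain h' where h': "h' \<in> U" "h' \<otimes> h' = h" "N h' \<le> 2/3 * N h"
        using root [OF h(1)] unfolding N_def by blast
      have c: "h' \<in> carrier G" using h' Uc by blast
      have "h' [^] ((2::nat) ^ Suc k) = (h' [^] (2::nat)) [^] ((2::nat) ^ k)"
        using c by (simp add: nat_pow_pow)
      also have "h' [^] (2::nat) = h" using c h'(2) by (simp add: numeral_2_eq_2)
      finally have "h' [^] ((2::nat) ^ Suc k) = g" using h(2) by simp
      moreover have "N h' \<le> (2/3) ^ Suc k * N g" using h'(3) h(3) by simp
      ultimately show ?case using h'(1) by blast
    qed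
    have "openin (subtopology T U) (U \<inter> V)"
      using U(1) V by (auto simp: openin_open_subtopology)
    then have "openin (subtopology (Euclidean_space n) (\<phi> ` U)) (\<phi> ` (U \<inter> V))"
      using homeomorphic_imp_open_map [OF homeo] by (simp add: open_map_def)
    then have "openin (Euclidean_space n) (\<phi> ` (U \<inter> V))"
      using U(4) openin_open_subtopology by blast
    then obtain s where s: "s > 0" "\<And>z. z \<in> topspace (Euclidean_space n) \<Longrightarrow>
        (\<And>i. i < n \<Longrightarrow> \<bar>z i - \<phi> \<one> i\<bar> < s) \<Longrightarrow> z \<in> \<phi> ` (U \<inter> V)"
      using Euclidean_space_box [of n "\<phi> ` (U \<inter> V)" "\<phi> \<one>"] U(2) V(2) by blast
    have "(\<lambda>k. (2/3) ^ k * N g) \<longlonglongrightarrow> 0 * N g"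
      by (intro tendsto_intros LIMSEQ_power_zero) simp
    then have "\<forall>\<^sub>F k in sequentially. (2/3) ^ k * N g < s"
      using s(1) by (intro order_tendstoD(2)) auto
    then obtain k where k: "(2/3) ^ k * N g < s" by (auto simp: eventually_sequentially)
    obtain h where h: "h \<in> U" "h [^] ((2::nat) ^ k) = g" "N h \<le> (2/3) ^ k * N g"
      using roots by blast
    have "\<phi> h \<in> \<phi> ` (U \<inter> V)"
    proof (rule s(2))
      show "\<phi> h \<in> topspace (Euclidean_space n)" using openin_subset [OF U(4)] h(1) by blast
      show "\<bar>\<phi> h i - \<phi> \<one> i\<bar> < s" if "i < n" for i
      proof -
        have "\<bar>\<phi> h i - \<phi> \<one> i\<bar> \<le> N h" unfolding N_def using that by (intro member_le_sum) auto
        then show ?thesis using h(3) k by simp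
      qed
    qed
    then have "h \<in> V" using inj_onD [OF inj] h(1) by blast
    then show ?thesis using h(2) by blast
  qed
  ultimately show ?thesis by (rule that)
qed

section \<open>Rigidity of minimal nilsystems\<close>

text \<open>\<open>a\<close> is a two-sided orbit. The hypothesis on \<open>V\<close> and \<open>W\<close> says that the cube with last vertex
  \<open>z\<close> and all other vertices \<open>a 0\<close> is a limit of cubes \<open>I \<mapsto> a (\<Sum>j\<in>I. n j)\<close>.\<close>

definition cube_rigid :: "nat \<Rightarrow> 'a topology \<Rightarrow> ('a \<Rightarrow> 'a) \<Rightarrow> bool" where
  "cube_rigid d Y S \<longleftrightarrow> (\<forall>(a :: int \<Rightarrow> 'a) z.
     (\<forall>m. a m \<in> topspace Y \<and> a (m + 1) = S (a m)) \<longrightarrow> z \<in> topspace Y \<longrightarrow>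
     (\<forall>V W. openin Y V \<longrightarrow> openin Y W \<longrightarrow> a 0 \<in> V \<longrightarrow> z \<in> W \<longrightarrow>
        (\<exists>n :: nat \<Rightarrow> int. \<forall>I\<subseteq>{..<Suc d}.
           a (\<Sum>j\<in>I. n j) \<in> (if I = {..<Suc d} then W else V))) \<longrightarrow>
     z = a 0)"

lemma (in group) conj_int_pow:
  assumes "g \<in> carrier G" "x \<in> carrier G"
  shows "(inv g \<otimes> x \<otimes> g) [^] (n::int) = inv g \<otimes> x [^] n \<otimes> g"
proof -
  have "(\<lambda>x. inv g \<otimes> x \<otimes> g) \<in> hom G G"
    using assms(1) by (intro homI) (simp_all add: word_simps)
  from hom_int_pow [OF this assms(2) is_group is_group] show ?thesis by simp
qed

text \<open>Conjugation carries the base point \<open>a 0 = g \<Gamma>\<close> to the identity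
  coset: with \<open>\<tau>' = g^-1 \<tau> g\<close> one has
  \<open>a m = g \<tau>'^m \<Gamma>\<close>, so left translation by \<open>g\<close> turns
  neighbourhoods of the identity into neighbourhoods of \<open>a 0\<close>, and the statement
  becomes \<open>translation_rigidity\<close> for \<open>\<tau>'\<close> and
  \<open>y = g^-1 h\<close>.\<close>

lemma minimal_translation_cube_rigid:
  fixes G (structure)
  assumes lie: "lie_group G T" and nilp: "nilpotent_group d G"
    and \<Gamma>: "subgroup \<Gamma> G" "subtopology T \<Gamma> = discrete_topology \<Gamma>"
    and compact: "compact_space (quotient_space G T \<Gamma>)" and \<tau>: "\<tau> \<in> carrier G"
    and Y: "Y = quotient_space G T \<Gamma>" and S: "\<And>C. C \<in> topspace Y \<Longrightarrow> S C = \<tau> <# C"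
    and min: "minimal_system Y S"
  shows "cube_rigid d Y S"
  unfolding cube_rigid_def
proof (intro allI impI)
  fix a :: "int \<Rightarrow> 'a set" and z
  assume a: "\<forall>m. a m \<in> topspace Y \<and> a (m + 1) = S (a m)" and z: "z \<in> topspace Y"
    and approx: "\<forall>V W. openin Y V \<longrightarrow> openin Y W \<longrightarrow> a 0 \<in> V \<longrightarrow> z \<in> W \<longrightarrow>
        (\<exists>n :: nat \<Rightarrow> int. \<forall>I\<subseteq>{..<Suc d}. a (\<Sum>j\<in>I. n j) \<in> (if I = {..<Suc d} then W else V))"
  interpret topological_group G T using lie_group_topological_group [OF lie] .
  have \<Gamma>c: "\<Gamma> \<subseteq> carrier G" using subgroup.subset [OF \<Gamma>(1)] .
  have topY: "topspace Y = lcosets \<Gamma>" unfolding Y by (rule topspace_quotient_space [OF \<Gamma>(1)])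
  have coset: "\<exists>k. k \<in> carrier G \<and> u = k <# \<Gamma>" if "u \<in> topspace Y" for u
    using that topY unfolding LCOSETS_def by blast
  obtain g where g: "g \<in> carrier G" "a 0 = g <# \<Gamma>" using a topY unfolding LCOSETS_def by blast
  obtain h where h: "h \<in> carrier G" "z = h <# \<Gamma>" using z topY unfolding LCOSETS_def by blast
  have S_coset: "S (x <# \<Gamma>) = (\<tau> \<otimes> x) <# \<Gamma>" if "x \<in> carrier G" for x
    using S [of "x <# \<Gamma>"] that topY lcos_m_assoc [OF \<Gamma>c \<tau> that] unfolding LCOSETS_def by auto
  have S_inj: "x <# \<Gamma> = (inv \<tau> \<otimes> x') <# \<Gamma>"
    if "S (x <# \<Gamma>) = x' <# \<Gamma>" "x \<in> carrier G" "x' \<in> carrier G" for x x'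
  proof -
    have "inv \<tau> <# ((\<tau> \<otimes> x) <# \<Gamma>) = inv \<tau> <# (x' <# \<Gamma>)" using that S_coset by simp
    then show ?thesis
      using that \<tau> lcos_m_assoc [OF \<Gamma>c, of "inv \<tau>"] by (simp add: inv_mult_cancel)
  qed
  have a_eq: "a m = (\<tau> [^] m \<otimes> g) <# \<Gamma>" for m
  proof (induction m rule: int_induct [of _ 0])
    case base
    then show ?case using g by simp
  next
    case (step1 i)
    have "a (i + 1) = S ((\<tau> [^] i \<otimes> g) <# \<Gamma>)" using a step1 by simp
    also have "\<dots> = (\<tau> \<otimes> (\<tau> [^] i \<otimes> g)) <# \<Gamma>" using S_coset g \<tau> by simp
    also have "\<tau> \<otimes> (\<tau> [^] i \<otimes> g) = \<tau> [^] (i + 1) \<otimes> g"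
      using g \<tau> int_pow_mult [of \<tau> 1 i] by (simp add: m_assoc add.commute)
    finally show ?case .
  next
    case (step2 i)
    obtain x where x: "x \<in> carrier G" "a (i - 1) = x <# \<Gamma>"
      using a topY unfolding LCOSETS_def by blast
    have "S (x <# \<Gamma>) = (\<tau> [^] i \<otimes> g) <# \<Gamma>" using a [rule_format, of "i - 1"] x step2 by simp
    then have "x <# \<Gamma> = (inv \<tau> \<otimes> (\<tau> [^] i \<otimes> g)) <# \<Gamma>" using S_inj x g \<tau> by simp
    also have "inv \<tau> \<otimes> (\<tau> [^] i \<otimes> g) = \<tau> [^] (i - 1) \<otimes> g"
      using g \<tau> int_pow_mult [of \<tau> "-1" i] by (simp add: m_assoc int_pow_neg)
    finally show ?case using x by simp
  qed
  define \<tau>' y where "\<tau>' = inv g \<otimes> \<tau> \<otimes> g" and "y = inv g \<otimes> h"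
  have \<tau>'_pow: "\<tau>' [^] m = inv g \<otimes> \<tau> [^] m \<otimes> g" for m :: int
    unfolding \<tau>'_def by (rule conj_int_pow [OF g(1) \<tau>])
  have open_img: "openin Y ((\<lambda>x. x <# \<Gamma>) ` (g <# U))" if "openin T U" for U
    unfolding Y by (intro openin_quotient_image \<Gamma>(1) openin_l_coset that g(1))
  have in_img: "\<exists>u\<in>U. \<exists>\<gamma>\<in>\<Gamma>. \<tau>' [^] m = u \<otimes> \<gamma>"
    if m: "a m \<in> (\<lambda>x. x <# \<Gamma>) ` (g <# U)" and U: "U \<subseteq> carrier G" for U and m :: int
  proof -
    have "g <# U \<subseteq> carrier G" using U g by (intro l_coset_subset_G)
    then obtain x \<gamma> where "x \<in> g <# U" "\<gamma> \<in> \<Gamma>" "\<tau> [^] m \<otimes> g = x \<otimes> \<gamma>"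
      using l_coset_in_image_iff [OF \<Gamma>(1), of "g <# U" "\<tau> [^] m \<otimes> g"] m a_eq \<tau> g(1) by auto
    then obtain u where u: "u \<in> U" "\<gamma> \<in> \<Gamma>" "\<tau> [^] m \<otimes> g = g \<otimes> u \<otimes> \<gamma>"
      unfolding l_coset_def by blast
    have c: "u \<in> carrier G" "\<gamma> \<in> carrier G" using u U \<Gamma>c by auto
    have "\<tau>' [^] m = inv g \<otimes> (\<tau> [^] m \<otimes> g)" using g \<tau> by (simp add: \<tau>'_pow m_assoc)
    also have "\<dots> = u \<otimes> \<gamma>" unfolding u(3) using g c by (simp add: word_simps)
    finally show ?thesis using u by blast
  qed
  obtain U\<^sub>0 where U0: "openin T U\<^sub>0" "\<one> \<in> U\<^sub>0" "\<And>g V. g \<in> U\<^sub>0 \<Longrightarrow> openin T V \<Longrightarrow> \<one> \<in> V \<Longrightarrow>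
      \<exists>u\<in>V. \<exists>m::nat. u [^] m = g"
    by (rule lie_group_small_roots [OF lie]) (rule that)
  have haus: "Hausdorff_space T" using lie by (simp add: lie_group_def)
  have "y \<in> \<Gamma>"
  proof (rule translation_rigidity [OF haus _ U0 _ \<Gamma> compact])
    show "\<exists>V C. openin T V \<and> \<one> \<in> V \<and> V \<subseteq> C \<and> compactin T C \<and> C \<subseteq> U"
      if "openin T U" "\<one> \<in> U" for U
      using lie_group_locally_compact [OF lie] locally_compact_space_neighbourhood_base [of T] haus that
      unfolding neighbourhood_base_of by blast
    show "lc d = {\<one>}" using nilp by (simp add: nilpotent_group_def)
    show "\<tau>' \<in> carrier G" "y \<in> carrier G" using g h \<tau> by (auto simp: \<tau>'_def y_def)
    show "\<exists>n::int. \<exists>u\<in>U. \<exists>\<gamma>\<in>\<Gamma>. \<tau>' [^] n = u \<otimes> \<gamma>" if U: "openin T U" "U \<noteq> {}" for U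
    proof -
      have Uc: "U \<subseteq> carrier G" using openin_subset [OF U(1)] topspace_eq by simp
      let ?V = "(\<lambda>x. x <# \<Gamma>) ` (g <# U)"
      have "?V \<noteq> {}" using U(2) by (auto simp: l_coset_def)
      moreover have V: "openin Y ?V" using open_img [OF U(1)] .
      moreover have "Y closure_of orbit_of Y S (a 0) = topspace Y"
        using min a unfolding minimal_system_def by blast
      ultimately have "?V \<inter> Y closure_of orbit_of Y S (a 0) \<noteq> {}"
        using openin_subset [OF V] by auto
      then have "?V \<inter> orbit_of Y S (a 0) \<noteq> {}"
        using openin_Int_closure_of_eq_empty [OF V] by simp
      then obtain x where x: "x \<in> ?V" "x \<in> orbit_of Y S (a 0)" by blast
      have fwd: "(S ^^ n) (a m) = a (m + int n)" for n m
      proof (induction n)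
        case (Suc n)
        have "a (m + int n + 1) = S (a (m + int n))" using a by blast
        then show ?case using Suc by (simp add: algebra_simps)
      qed simp
      \<comment> \<open>\<open>orbit_of\<close> expresses negative times through preimages;
        injectivity of the iterates of \<open>S\<close> identifies these with values of
        \<open>a\<close>.\<close>
      have bwd: "w = a (- int n)" if "w \<in> topspace Y" "(S ^^ n) w = a 0" for w n
      proof -
        note tr = lcosets_translation [OF \<Gamma>(1) \<tau>, folded topY]
        have S_inj': "u = v" if uv: "u \<in> topspace Y" "v \<in> topspace Y" "S u = S v" for u v
          using tr(2) [OF uv(1), folded S [OF uv(1)]] tr(2) [OF uv(2), folded S [OF uv(2)]] uv(3) by metis
        have S_top: "S u \<in> topspace Y" if u: "u \<in> topspace Y" for u
          using tr(1) [OF u] by (simp add: S u)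
        have "\<forall>u\<in>topspace Y. \<forall>v\<in>topspace Y. (S ^^ n) u = (S ^^ n) v \<longrightarrow> u = v"
        proof (induction n)
          case (Suc n)
          then show ?case using S_inj' S_top by (metis funpow_Suc_right comp_apply)
        qed simp
        then show ?thesis using that a fwd [of n "- int n"] by simp
      qed
      have "\<exists>m. x = a m"
        using x(2) fwd [of _ 0] bwd [of x] unfolding orbit_of_def by auto
      then show ?thesis using in_img [OF _ Uc] x(1) by blast
    qed
    show "\<exists>n :: nat \<Rightarrow> int. \<forall>I\<subseteq>{..<Suc d}. \<exists>w\<in>W. \<exists>\<gamma>\<in>\<Gamma>.
      \<tau>' [^] (\<Sum>j\<in>I. n j) = w \<otimes> (if I = {..<Suc d} then y else \<one>) \<otimes> \<gamma>"
      if W: "openin T W" "\<one> \<in> W" for W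
    proof -
      have Wc: "W \<subseteq> carrier G" using openin_subset [OF W(1)] topspace_eq by simp
      have yc: "y \<in> carrier G" using g h by (simp add: y_def)
      \<comment> \<open>\<open>W #> y\<close> is a neighbourhood of \<open>y\<close> whose points
        have the form \<open>w \<otimes> y\<close> that \<open>translation_rigidity\<close> asks
        for.\<close>
      let ?V1 = "(\<lambda>x. x <# \<Gamma>) ` (g <# W)" and ?V2 = "(\<lambda>x. x <# \<Gamma>) ` (g <# (W #> y))"
      have "g \<otimes> \<one> \<in> g <# W" "g \<otimes> (\<one> \<otimes> y) \<in> g <# (W #> y)"
        using W(2) unfolding l_coset_def r_coset_def by blast+
      then have "g \<in> g <# W" "h \<in> g <# (W #> y)"
        using g h by (simp_all add: y_def mult_inv_cancel)
      then have "a 0 \<in> ?V1" "z \<in> ?V2" using g h by blast+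
      moreover have "openin Y ?V1" "openin Y ?V2"
        using open_img W(1) openin_r_coset yc by blast+
      ultimately obtain n :: "nat \<Rightarrow> int" where n: "\<And>I. I \<subseteq> {..<Suc d} \<Longrightarrow>
          a (\<Sum>j\<in>I. n j) \<in> (if I = {..<Suc d} then ?V2 else ?V1)"
        using approx by meson
      have "\<exists>w\<in>W. \<exists>\<gamma>\<in>\<Gamma>. \<tau>' [^] (\<Sum>j\<in>I. n j) = w \<otimes> (if I = {..<Suc d} then y else \<one>) \<otimes> \<gamma>"
        if I: "I \<subseteq> {..<Suc d}" for I
      proof (cases "I = {..<Suc d}")
        case True
        have "W #> y \<subseteq> carrier G" using Wc yc by (rule r_coset_subset_G)
        then obtain u \<gamma> where "u \<in> W #> y" "\<gamma> \<in> \<Gamma>" "\<tau>' [^] (\<Sum>j\<in>I. n j) = u \<otimes> \<gamma>"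
          using in_img n [OF I] True by (metis (full_types))
        then show ?thesis using True unfolding r_coset_def by auto
      next
        case False
        then obtain w \<gamma> where w: "w \<in> W" "\<gamma> \<in> \<Gamma>" "\<tau>' [^] (\<Sum>j\<in>I. n j) = w \<otimes> \<gamma>"
          using in_img [OF _ Wc] n [OF I] by (metis (full_types))
        have "w \<otimes> \<one> = w" using w Wc by auto
        then show ?thesis unfolding if_not_P [OF False] using w by metis
      qed
      then show ?thesis by blast
    qed
  qed
  then obtain \<gamma> where \<gamma>: "\<gamma> \<in> \<Gamma>" "inv g \<otimes> h = \<gamma>" by (simp add: y_def)
  then have "h = g \<otimes> \<gamma>" using g h by (auto simp: mult_inv_cancel)
  then have "h \<in> g <# \<Gamma>" using \<gamma>(1) unfolding l_coset_def by blast
  then show "z = a 0" unfolding g(2) h(2) using l_repr_independence [OF _ g(1) \<Gamma>(1)] by blast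
qed

lemma nilsystem_cube_rigid:
  fixes Y :: "'a set topology"
  assumes "nilsystem d Y S" "minimal_system Y S"
  shows "cube_rigid d Y S"
proof -
  obtain G :: "'a monoid" and T \<Gamma> \<tau> where
    "lie_group G T \<and> nilpotent_group d G \<and> subgroup \<Gamma> G \<and>
      subtopology T \<Gamma> = discrete_topology \<Gamma> \<and> compact_space (quotient_space G T \<Gamma>) \<and>
      \<tau> \<in> carrier G \<and> Y = quotient_space G T \<Gamma> \<and> (\<forall>C\<in>topspace Y. S C = \<tau> <#\<^bsub>G\<^esub> C)"
    using assms(1) unfolding nilsystem_def by (elim exE)
  then show ?thesis
    by (intro minimal_translation_cube_rigid [of G T d \<Gamma> \<tau> Y S] assms(2)) (elim conjE; simp)+
qed

section \<open>Automorphisms of minimal systems\<close>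

lemma Aut_group_carrier:
  "carrier (Aut_group X T) = {\<phi> \<in> extensional (topspace X).
    homeomorphic_map X X \<phi> \<and> (\<forall>x\<in>topspace X. \<phi> (T x) = T (\<phi> x))}"
  by (simp add: Aut_group_def)

lemma subgroup_Aut_group:
  assumes "homeomorphic_map X X T"
  shows "subgroup (carrier (Aut_group X T)) (BijGroup (topspace X))"
proof -
  let ?S = "topspace X" and ?A = "carrier (Aut_group X T)"
  interpret B: group "BijGroup ?S" by (rule group_BijGroup)
  have T: "T x \<in> ?S" if "x \<in> ?S" for x
    using homeomorphic_imp_surjective_map [OF assms] that by blast
  have bij: "\<phi> \<in> Bij ?S" if "\<phi> \<in> ?A" for \<phi>
    using that homeomorphic_imp_injective_map homeomorphic_imp_surjective_map
    by (fastforce simp: Bij_def Aut_group_carrier bij_betw_def)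
  have maps: "\<phi> x \<in> ?S" if "\<phi> \<in> ?A" "x \<in> ?S" for \<phi> x
    using bij [OF that(1)] that(2) Bij_imp_funcset by blast
  show ?thesis
  proof (rule subgroup.intro)
    show "?A \<subseteq> carrier (BijGroup ?S)" using bij by (auto simp: BijGroup_def)
    show "\<one>\<^bsub>BijGroup ?S\<^esub> \<in> ?A"
      using T by (auto simp: BijGroup_def Aut_group_carrier intro: homeomorphic_map_eq [OF iffD2 [OF homeomorphic_map_id refl]])
  next
    fix \<phi> \<psi> assume \<phi>: "\<phi> \<in> ?A" and \<psi>: "\<psi> \<in> ?A"
    have "homeomorphic_map X X (\<phi> \<circ> \<psi>)"
      using \<phi> \<psi> by (auto simp: Aut_group_carrier intro: homeomorphic_map_compose)
    then have "homeomorphic_map X X (compose ?S \<phi> \<psi>)"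
      by (rule homeomorphic_map_eq) (simp add: compose_def)
    moreover have "compose ?S \<phi> \<psi> (T x) = T (compose ?S \<phi> \<psi> x)" if "x \<in> ?S" for x
      using \<phi> \<psi> that T maps [OF \<psi>] by (simp add: Aut_group_carrier compose_def)
    ultimately show "\<phi> \<otimes>\<^bsub>BijGroup ?S\<^esub> \<psi> \<in> ?A"
      using bij \<phi> \<psi> by (simp add: BijGroup_def Aut_group_carrier)
  next
    fix \<phi> assume \<phi>: "\<phi> \<in> ?A"
    let ?\<psi> = "\<lambda>x\<in>?S. inv_into ?S \<phi> x"
    have inv: "inv\<^bsub>BijGroup ?S\<^esub> \<phi> = ?\<psi>" using inv_BijGroup bij [OF \<phi>] by blast
    have img: "\<phi> ` ?S = ?S" and inj: "inj_on \<phi> ?S"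
      using bij [OF \<phi>] by (auto simp: Bij_def bij_betw_def)
    obtain g where g: "homeomorphic_maps X X \<phi> g"
      using \<phi> unfolding Aut_group_carrier homeomorphic_map_maps by blast
    have "g x = ?\<psi> x" if "x \<in> ?S" for x
    proof -
      have "\<phi> (g x) = x" "g x \<in> ?S"
        using g that by (auto simp: homeomorphic_maps_def continuous_map_def)
      then show ?thesis using that inj by (metis inv_into_f_f restrict_apply')
    qed
    moreover have "homeomorphic_map X X g"
      using g homeomorphic_maps_map by blast
    ultimately have "homeomorphic_map X X ?\<psi>" using homeomorphic_map_eq by blast
    moreover have "?\<psi> (T x) = T (?\<psi> x)" if x: "x \<in> ?S" for x
    proof -
      have y: "inv_into ?S \<phi> x \<in> ?S" "\<phi> (inv_into ?S \<phi> x) = x"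
        using img x by (auto simp: inv_into_into f_inv_into_f)
      have "inv_into ?S \<phi> (T x) = inv_into ?S \<phi> (\<phi> (T (inv_into ?S \<phi> x)))"
        using \<phi> y by (simp add: Aut_group_carrier)
      also have "\<dots> = T (inv_into ?S \<phi> x)" using inj T y by simp
      finally show ?thesis using x T by simp
    qed
    ultimately show "inv\<^bsub>BijGroup ?S\<^esub> \<phi> \<in> ?A" by (simp add: inv Aut_group_carrier)
  qed
qed

lemma Aut_group_alt: "Aut_group X T = (BijGroup (topspace X))\<lparr>carrier := carrier (Aut_group X T)\<rparr>"
  by (simp add: Aut_group_def)

lemma group_Aut_group:
  assumes "homeomorphic_map X X T"
  shows "group (Aut_group X T)"
  by (subst Aut_group_alt)
    (rule group.subgroup_imp_group [OF group_BijGroup subgroup_Aut_group [OF assms]])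

locale minimal_homeo =
  fixes X :: "'a topology" and T :: "'a \<Rightarrow> 'a"
  assumes homeo: "homeomorphic_map X X T" and minimal: "minimal_system X T"
begin

abbreviation "A \<equiv> Aut_group X T"

sublocale A: group A by (rule group_Aut_group [OF homeo])

lemma Aut_Bij: "\<phi> \<in> carrier A \<Longrightarrow> \<phi> \<in> Bij (topspace X)"
  using subgroup.subset [OF subgroup_Aut_group [OF homeo]] by (auto simp: BijGroup_def)

lemma Aut_maps: "\<phi> \<in> carrier A \<Longrightarrow> x \<in> topspace X \<Longrightarrow> \<phi> x \<in> topspace X"
  using Aut_Bij Bij_imp_funcset by blast

lemma Aut_continuous: "\<phi> \<in> carrier A \<Longrightarrow> continuous_map X X \<phi>"
  by (auto simp: Aut_group_carrier intro: homeomorphic_imp_continuous_map)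

lemma Aut_mult:
  "\<phi> \<in> carrier A \<Longrightarrow> \<psi> \<in> carrier A \<Longrightarrow> x \<in> topspace X \<Longrightarrow> (\<phi> \<otimes>\<^bsub>A\<^esub> \<psi>) x = \<phi> (\<psi> x)"
proof -
  assume "\<phi> \<in> carrier A" "\<psi> \<in> carrier A" and x: "x \<in> topspace X"
  then have "\<phi> \<in> Bij (topspace X)" "\<psi> \<in> Bij (topspace X)" using Aut_Bij by blast+
  then have "\<phi> \<otimes>\<^bsub>A\<^esub> \<psi> = compose (topspace X) \<phi> \<psi>" by (simp add: Aut_group_def BijGroup_def)
  then show ?thesis using x by (simp add: compose_def)
qed

lemma Aut_one: "x \<in> topspace X \<Longrightarrow> \<one>\<^bsub>A\<^esub> x = x"
  by (simp add: Aut_group_def BijGroup_def)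

lemma Aut_inv:
  assumes "\<phi> \<in> carrier A" "x \<in> topspace X"
  shows "(inv\<^bsub>A\<^esub> \<phi>) (\<phi> x) = x" "\<phi> ((inv\<^bsub>A\<^esub> \<phi>) x) = x"
  using assms Aut_mult [of "inv\<^bsub>A\<^esub> \<phi>" \<phi> x] Aut_mult [of \<phi> "inv\<^bsub>A\<^esub> \<phi>" x] by (simp_all add: Aut_one)

text \<open>Outside the space \<open>T\<close> may take any values; its restriction is an element of
  the automorphism group, whose integer powers give the two-sided orbits.\<close>

definition t :: "'a \<Rightarrow> 'a" where "t = restrict T (topspace X)"

lemma T_maps: "x \<in> topspace X \<Longrightarrow> T x \<in> topspace X"
  using homeomorphic_imp_surjective_map [OF homeo] by blast

lemma t_carrier: "t \<in> carrier A"
  using homeomorphic_map_eq [OF homeo, of t] T_maps by (auto simp: Aut_group_carrier t_def)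

lemma t_apply: "x \<in> topspace X \<Longrightarrow> t x = T x"
  by (simp add: t_def)

abbreviation tpow :: "int \<Rightarrow> 'a \<Rightarrow> 'a" where "tpow n \<equiv> t [^]\<^bsub>A\<^esub> n"

lemma tpow_carrier: "tpow n \<in> carrier A"
  using t_carrier by simp

lemma tpow_add: "x \<in> topspace X \<Longrightarrow> tpow (m + n) x = tpow m (tpow n x)"
  using A.int_pow_mult [OF t_carrier] Aut_mult tpow_carrier by simp

lemma tpow_0: "x \<in> topspace X \<Longrightarrow> tpow 0 x = x"
  by (simp add: Aut_one)

lemma tpow_Suc: "x \<in> topspace X \<Longrightarrow> tpow (m + 1) x = T (tpow m x)"
  using tpow_add [of x 1 m] t_carrier Aut_maps [OF tpow_carrier]
  by (simp add: t_apply add.commute)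

lemma tpow_funpow: "x \<in> topspace X \<Longrightarrow> tpow (int n) x = (T ^^ n) x"
proof (induction n)
  case (Suc n)
  then show ?case using tpow_Suc [of x "int n"] by (simp add: add.commute)
qed (simp add: tpow_0 Aut_one)

lemma Aut_tpow:
  assumes "\<phi> \<in> carrier A" "x \<in> topspace X"
  shows "\<phi> (tpow n x) = tpow n (\<phi> x)"
proof -
  have "\<phi> \<otimes>\<^bsub>A\<^esub> t = t \<otimes>\<^bsub>A\<^esub> \<phi>"
  proof (rule extensionalityI [of _ "topspace X"])
    show "\<phi> \<otimes>\<^bsub>A\<^esub> t \<in> extensional (topspace X)" "t \<otimes>\<^bsub>A\<^esub> \<phi> \<in> extensional (topspace X)"
      using A.m_closed assms(1) t_carrier by (auto simp: Aut_group_carrier)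
    show "(\<phi> \<otimes>\<^bsub>A\<^esub> t) x = (t \<otimes>\<^bsub>A\<^esub> \<phi>) x" if "x \<in> topspace X" for x
      using that assms(1) t_carrier Aut_maps [OF assms(1) that]
      by (simp add: Aut_mult t_apply) (simp add: Aut_group_carrier)
  qed
  then have "inv\<^bsub>A\<^esub> \<phi> \<otimes>\<^bsub>A\<^esub> t \<otimes>\<^bsub>A\<^esub> \<phi> = inv\<^bsub>A\<^esub> \<phi> \<otimes>\<^bsub>A\<^esub> (\<phi> \<otimes>\<^bsub>A\<^esub> t)"
    using assms(1) t_carrier by (simp add: A.m_assoc)
  then have "inv\<^bsub>A\<^esub> \<phi> \<otimes>\<^bsub>A\<^esub> t \<otimes>\<^bsub>A\<^esub> \<phi> = t"
    using assms(1) t_carrier by (simp add: A.inv_mult_cancel)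
  then have "tpow n = inv\<^bsub>A\<^esub> \<phi> \<otimes>\<^bsub>A\<^esub> tpow n \<otimes>\<^bsub>A\<^esub> \<phi>"
    using A.conj_int_pow [OF assms(1) t_carrier, of n] by simp
  then have "\<phi> \<otimes>\<^bsub>A\<^esub> tpow n = tpow n \<otimes>\<^bsub>A\<^esub> \<phi>"
    using assms(1) tpow_carrier by (metis A.inv_closed A.inv_solve_left A.m_assoc A.m_closed)
  then show ?thesis using Aut_mult assms tpow_carrier by metis
qed

lemma orbit_dense:
  assumes "x \<in> topspace X"
  shows "X closure_of (range (\<lambda>n. tpow n x)) = topspace X"
proof -
  have "orbit_of X T x \<subseteq> range (\<lambda>n. tpow n x)"
  proof
    fix y assume "y \<in> orbit_of X T x"
    then consider n where "y = (T ^^ n) x" | n where "y \<in> topspace X" "(T ^^ n) y = x"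
      unfolding orbit_of_def by blast
    then show "y \<in> range (\<lambda>n. tpow n x)"
    proof cases
      case 1
      then show ?thesis using tpow_funpow [OF assms] by (metis rangeI)
    next
      case (2 n)
      then have "y = tpow (- int n) x"
        using tpow_funpow [of y n] tpow_add [of y "- int n" "int n"] tpow_0 [of y] by simp
      then show ?thesis by blast
    qed
  qed
  then have "topspace X \<subseteq> X closure_of (range (\<lambda>n. tpow n x))"
    using minimal assms closure_of_mono unfolding minimal_system_def by blast
  then show ?thesis using closure_of_subset_topspace [of X] by blast
qed

section \<open>Face actions and the closure of the orbit cubes\<close>

definition apply_face :: "nat set \<Rightarrow> ('a \<Rightarrow> 'a) \<Rightarrow> (nat set \<Rightarrow> 'a) \<Rightarrow> nat set \<Rightarrow> 'a" where
  "apply_face J \<phi> q = (\<lambda>I. if J \<subseteq> I then \<phi> (q I) else q I)"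

text \<open>The point reached from the constant cube \<open>x\<close> by the face actions of
  \<open>T\<close> with exponents \<open>n j\<close>; intersecting with \<open>{..<k}\<close>
  extends it to all index sets.\<close>

definition orbit_cube :: "nat \<Rightarrow> 'a \<Rightarrow> (nat \<Rightarrow> int) \<Rightarrow> nat set \<Rightarrow> 'a" where
  "orbit_cube k x n = (\<lambda>I. tpow (\<Sum>j\<in>I \<inter> {..<k}. n j) x)"

abbreviation cube_space :: "(nat set \<Rightarrow> 'a) topology" where
  "cube_space \<equiv> product_topology (\<lambda>_. X) UNIV"

definition cube_closure :: "nat \<Rightarrow> 'a \<Rightarrow> (nat set \<Rightarrow> 'a) set" where
  "cube_closure k x = cube_space closure_of range (orbit_cube k x)"

lemma topspace_cube_space: "q \<in> topspace cube_space \<longleftrightarrow> (\<forall>I. q I \<in> topspace X)"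
  by (auto simp: PiE_iff)

lemma continuous_cube_map:
  assumes "\<And>I. continuous_map X X (f I)"
  shows "continuous_map cube_space cube_space (\<lambda>q I. f I (q I))"
  unfolding continuous_map_componentwise_UNIV
proof
  fix I
  have "continuous_map cube_space X (\<lambda>q. q I)"
    by (rule continuous_map_product_projection) simp
  then show "continuous_map cube_space X (\<lambda>q. f I (q I))"
    using continuous_map_compose [OF _ assms [of I]] by (fastforce simp: comp_def)
qed

lemma continuous_apply_face:
  assumes "\<phi> \<in> carrier A"
  shows "continuous_map cube_space cube_space (apply_face J \<phi>)"
proof -
  have "continuous_map X X (\<lambda>x. if J \<subseteq> I then \<phi> x else x)" for I
    using Aut_continuous [OF assms] by (cases "J \<subseteq> I") simp_all
  from continuous_cube_map [OF this] show ?thesis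
    unfolding apply_face_def [abs_def] by (rule continuous_map_eq) auto
qed

lemma cube_closure_image:
  assumes "continuous_map cube_space cube_space f"
    and "\<And>n. f (orbit_cube k x n) \<in> cube_closure k x" and "q \<in> cube_closure k x"
  shows "f q \<in> cube_closure k x"
proof -
  have "f ` cube_closure k x \<subseteq> cube_space closure_of (f ` range (orbit_cube k x))"
    unfolding cube_closure_def by (rule continuous_map_image_closure_subset [OF assms(1)])
  also have "\<dots> \<subseteq> cube_closure k x"
    using assms(2) unfolding cube_closure_def
    by (intro closure_of_minimal closedin_closure_of) auto
  finally show ?thesis using assms(3) by blast
qed

lemma orbit_cube_in_topspace: "x \<in> topspace X \<Longrightarrow> orbit_cube k x n \<in> topspace cube_space"
  using Aut_maps [OF tpow_carrier] by (simp add: topspace_cube_space orbit_cube_def del: topspace_product_topology)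

lemma orbit_cube_in_closure: "x \<in> topspace X \<Longrightarrow> orbit_cube k x n \<in> cube_closure k x"
  unfolding cube_closure_def
proof (rule subsetD [OF closure_of_subset])
  assume "x \<in> topspace X"
  then show "range (orbit_cube k x) \<subseteq> topspace cube_space"
    using orbit_cube_in_topspace by (intro image_subsetI)
qed simp

lemma cube_closure_topspace: "q \<in> cube_closure k x \<Longrightarrow> q I \<in> topspace X"
  unfolding cube_closure_def
proof -
  assume "q \<in> cube_space closure_of range (orbit_cube k x)"
  then have "q \<in> topspace cube_space" by (rule subsetD [OF closure_of_subset_topspace])
  then show "q I \<in> topspace X" unfolding topspace_cube_space by (rule spec)
qed

lemma apply_codim1_face:
  assumes x: "x \<in> topspace X" and \<phi>: "\<phi> \<in> carrier A" and m: "m < k"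
    and q: "q \<in> cube_closure k x"
  shows "apply_face {m} \<phi> q \<in> cube_closure k x"
proof (rule cube_closure_image [OF continuous_apply_face [OF \<phi>] _ q])
  \<comment> \<open>The cube \<open>?\<iota> z\<close> has \<open>z\<close> on the face of the
    vertices containing \<open>m\<close> and \<open>x\<close> elsewhere. The dense orbit of
    \<open>x\<close> is taken to orbit cubes, hence every point of \<open>X\<close> into the
    closure.\<close>
  let ?\<iota> = "\<lambda>z I. if m \<in> I then z else x"
  have cont: "continuous_map X cube_space ?\<iota>"
    unfolding continuous_map_componentwise_UNIV
  proof
    show "continuous_map X X (\<lambda>z. ?\<iota> z I)" for I using x by (cases "m \<in> I") simp_all
  qed
  have "?\<iota> (tpow n x) = orbit_cube k x (\<lambda>j. if j = m then n else 0)" for n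
    using m x by (auto simp: orbit_cube_def fun_eq_iff tpow_0 Aut_one)
  then have "?\<iota> ` range (\<lambda>n. tpow n x) \<subseteq> range (orbit_cube k x)" by blast
  then have "cube_space closure_of (?\<iota> ` range (\<lambda>n. tpow n x)) \<subseteq> cube_closure k x"
    unfolding cube_closure_def by (rule closure_of_mono)
  moreover have "?\<iota> ` (X closure_of range (\<lambda>n. tpow n x)) \<subseteq>
      cube_space closure_of (?\<iota> ` range (\<lambda>n. tpow n x))"
    by (rule continuous_map_image_closure_subset [OF cont])
  ultimately have face: "?\<iota> (\<phi> x) \<in> cube_closure k x"
    using orbit_dense [OF x] Aut_maps [OF \<phi> x] by blast
  fix n
  \<comment> \<open>Since \<open>\<phi>\<close> commutes with \<open>T\<close>, the face actions of
    \<open>T\<close> turn this one cube into the image of an arbitrary orbit cube under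
    \<open>\<phi>\<close> on the face.\<close>
  let ?f = "\<lambda>q I. tpow (\<Sum>j\<in>I \<inter> {..<k}. n j) (q I)"
  have "continuous_map cube_space cube_space ?f"
    by (intro continuous_cube_map Aut_continuous tpow_carrier)
  moreover have "?f (orbit_cube k x n') = orbit_cube k x (\<lambda>j. n j + n' j)" for n'
    using x by (simp add: orbit_cube_def fun_eq_iff sum.distrib tpow_add)
  then have "?f (orbit_cube k x n') \<in> cube_closure k x" for n'
    using orbit_cube_in_closure [OF x] by simp
  ultimately have "?f (?\<iota> (\<phi> x)) \<in> cube_closure k x"
    using face by (rule cube_closure_image)
  moreover have "?f (?\<iota> (\<phi> x)) = apply_face {m} \<phi> (orbit_cube k x n)"
    using \<phi> x by (auto simp: apply_face_def orbit_cube_def fun_eq_iff Aut_tpow)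
  ultimately show "apply_face {m} \<phi> (orbit_cube k x n) \<in> cube_closure k x" by simp
qed

text \<open>The commutator of \<open>g\<close> acting on a face and \<open>h\<close> acting on another is their commutator acting on
  the intersection of the two faces.\<close>

lemma apply_face_lower_central:
  assumes x: "x \<in> topspace X"
  shows "\<phi> \<in> lower_central A j \<Longrightarrow> J \<subseteq> {..<k} \<Longrightarrow> card J = Suc j \<Longrightarrow> q \<in> cube_closure k x \<Longrightarrow>
    apply_face J \<phi> q \<in> cube_closure k x"
proof (induction j arbitrary: \<phi> J q)
  case 0
  have "card J = 1" using 0(3) by simp
  then obtain m where "J = {m}" by (rule card_1_singletonE)
  then show ?case using 0 apply_codim1_face [OF x, of \<phi> m k q] by simp
next
  case (Suc j)
  obtain m where m: "m \<in> J" using Suc.prems(3) by (cases "J = {}") auto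
  \<comment> \<open>The codimension of a face equals the index of the term in the usual numbering:
    \<open>g\<close> acts on the face of \<open>m\<close>, \<open>h\<close> on that of
    \<open>?J\<close>, and their common face is that of \<open>J\<close>.\<close>
  let ?J = "J - {m}"
  have J: "?J \<subseteq> {..<k}" "card ?J = Suc j" "m < k"
    using Suc.prems(2,3) m by (auto simp: card_Diff_singleton)
  have J_iff: "J \<subseteq> I \<longleftrightarrow> m \<in> I \<and> ?J \<subseteq> I" for I using m by blast
  let ?Q = "\<lambda>\<phi>. \<forall>q\<in>cube_closure k x. apply_face J \<phi> q \<in> cube_closure k x"
  \<comment> \<open>Mapping the closure into itself does not obviously pass to inverses, so both
    directions are recorded to obtain a subgroup. For generators this is no loss: the inverse of
    \<open>[g, h]\<close> is \<open>[h, g]\<close>.\<close>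
  let ?S = "{\<phi> \<in> carrier A. ?Q \<phi> \<and> ?Q (inv\<^bsub>A\<^esub> \<phi>)}"
  have mult: "?Q (\<phi> \<otimes>\<^bsub>A\<^esub> \<psi>)" if "\<phi> \<in> carrier A" "\<psi> \<in> carrier A" "?Q \<phi>" "?Q \<psi>" for \<phi> \<psi>
  proof
    fix q assume q: "q \<in> cube_closure k x"
    have "apply_face J (\<phi> \<otimes>\<^bsub>A\<^esub> \<psi>) q = apply_face J \<phi> (apply_face J \<psi> q)"
      using that cube_closure_topspace [OF q] by (auto simp: apply_face_def fun_eq_iff Aut_mult)
    then show "apply_face J (\<phi> \<otimes>\<^bsub>A\<^esub> \<psi>) q \<in> cube_closure k x" using that q by simp
  qed
  have "subgroup ?S A"
  proof (rule subgroup.intro)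
    show "\<phi> \<otimes>\<^bsub>A\<^esub> \<psi> \<in> ?S" if "\<phi> \<in> ?S" "\<psi> \<in> ?S" for \<phi> \<psi>
      using that mult by (simp add: A.inv_mult_group)
    have "apply_face J \<one>\<^bsub>A\<^esub> q = q" if "q \<in> cube_closure k x" for q
      using cube_closure_topspace [OF that] by (simp add: apply_face_def fun_eq_iff Aut_one)
    then show "\<one>\<^bsub>A\<^esub> \<in> ?S" by simp
  qed auto
  moreover have comm: "?Q (commutator A g h) \<and> ?Q (commutator A h g)"
    if g: "g \<in> carrier A" and h: "h \<in> lower_central A j" for g h
  proof -
    have hc: "h \<in> carrier A" using A.lc_closed h by blast
    have h': "inv\<^bsub>A\<^esub> h \<in> lower_central A j" using A.lc_inv h by blast
    have c: "inv\<^bsub>A\<^esub> g \<in> carrier A" "inv\<^bsub>A\<^esub> h \<in> carrier A" using g hc by auto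
    let ?g = "apply_face {m} g" and ?g' = "apply_face {m} (inv\<^bsub>A\<^esub> g)"
      and ?h = "apply_face ?J h" and ?h' = "apply_face ?J (inv\<^bsub>A\<^esub> h)"
    have closed: "?g q \<in> cube_closure k x" "?g' q \<in> cube_closure k x"
      "?h q \<in> cube_closure k x" "?h' q \<in> cube_closure k x" if "q \<in> cube_closure k x" for q
      using that apply_codim1_face [OF x _ J(3)] g c Suc.IH [OF h J(1,2)] Suc.IH [OF h' J(1,2)] by auto
    have "apply_face J (commutator A g h) q = ?g (?h (?g' (?h' q)))"
      "apply_face J (commutator A h g) q = ?h (?g (?h' (?g' q)))" if "q \<in> cube_closure k x" for q
      using cube_closure_topspace [OF that] g hc c
      by (auto simp: apply_face_def J_iff fun_eq_iff commutator_def Aut_mult Aut_inv Aut_maps)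
    then show ?thesis using closed by simp
  qed
  have "{commutator A g h |g h. g \<in> carrier A \<and> h \<in> lower_central A j} \<subseteq> ?S"
    using comm A.lc_closed by (auto simp: A.inv_commutator)
  ultimately have "lower_central A (Suc j) \<subseteq> ?S"
    unfolding A.lc_Suc_alt by (intro A.generate_subgroup_incl)
  then show ?case using Suc.prems by blast
qed

text \<open>Stated for any separating family of equivariant maps into rigid systems; the coordinates
  of the inverse limit form one. An element of \<open>lower_central A d\<close> may act on a face of
  codimension \<open>d + 1\<close>, which in a cube of that dimension is the last vertex
  alone.\<close>

lemma nilpotent_Aut_group:
  assumes cont: "\<And>i. continuous_map X (Y i) (p i)"
    and equiv: "\<And>i x. x \<in> topspace X \<Longrightarrow> p i (T x) = S i (p i x)"
    and sep: "\<And>x y. x \<in> topspace X \<Longrightarrow> y \<in> topspace X \<Longrightarrow> (\<And>i. p i x = p i y) \<Longrightarrow> x = y"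
    and rigid: "\<And>i. cube_rigid d (Y i) (S i)"
  shows "nilpotent_group d A"
proof -
  let ?k = "Suc d"
  have fixes_point: "\<phi> x = x" if \<phi>: "\<phi> \<in> lower_central A d" and x: "x \<in> topspace X" for \<phi> x
  proof (rule sep)
    have \<phi>c: "\<phi> \<in> carrier A" using A.lc_closed \<phi> by blast
    show "\<phi> x \<in> topspace X" "x \<in> topspace X" using Aut_maps \<phi>c x by auto
    fix i
    let ?a = "\<lambda>m. p i (tpow m x)"
    have p_maps: "p i y \<in> topspace (Y i)" if "y \<in> topspace X" for y
      using cont [of i] that by (auto simp: continuous_map_def)
    have orbit: "\<forall>m. ?a m \<in> topspace (Y i) \<and> ?a (m + 1) = S i (?a m)"
      using p_maps Aut_maps [OF tpow_carrier x] equiv by (simp add: tpow_Suc x)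
    have "(\<lambda>I. x) = orbit_cube ?k x (\<lambda>_. 0)" using x by (simp add: orbit_cube_def tpow_0 Aut_one)
    then have "(\<lambda>I. x) \<in> cube_closure ?k x" using orbit_cube_in_closure [OF x] by simp
    then have cube: "apply_face {..<?k} \<phi> (\<lambda>I. x) \<in> cube_closure ?k x"
      using apply_face_lower_central [OF x \<phi>] by simp
    have "\<exists>n :: nat \<Rightarrow> int. \<forall>I\<subseteq>{..<?k}. ?a (\<Sum>j\<in>I. n j) \<in> (if I = {..<?k} then W else V)"
      if V: "openin (Y i) V" "?a 0 \<in> V" and W: "openin (Y i) W" "p i (\<phi> x) \<in> W" for V W
    proof -
      let ?O = "\<lambda>I. {q \<in> topspace cube_space. p i (q I) \<in> (if I = {..<?k} then W else V)}"
      have "openin cube_space (?O I)" for I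
      proof (rule openin_continuous_map_preimage)
        have "continuous_map cube_space X (\<lambda>q. q I)"
          by (rule continuous_map_product_projection) simp
        then show "continuous_map cube_space (Y i) (\<lambda>q. p i (q I))"
          using continuous_map_compose [OF _ cont [of i]] by (fastforce simp: comp_def)
        show "openin (Y i) (if I = {..<?k} then W else V)" using V W by simp
      qed
      then have op: "openin cube_space (\<Inter>I\<in>Pow {..<?k}. ?O I)"
        by (intro openin_INT2) (auto simp del: topspace_product_topology)
      have "apply_face {..<?k} \<phi> (\<lambda>I. x) \<in> ?O I" if "I \<subseteq> {..<?k}" for I
      proof -
        have "apply_face {..<?k} \<phi> (\<lambda>I. x) \<in> topspace cube_space"
          using cube cube_closure_topspace topspace_cube_space by blast
        moreover have "apply_face {..<?k} \<phi> (\<lambda>I. x) I = (if I = {..<?k} then \<phi> x else x)"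
          using that by (auto simp: apply_face_def)
        ultimately show ?thesis using V(2) W(2) x by (simp add: tpow_0 Aut_one)
      qed
      then have "apply_face {..<?k} \<phi> (\<lambda>I. x) \<in> (\<Inter>I\<in>Pow {..<?k}. ?O I)" by blast
      then obtain n where n: "orbit_cube ?k x n \<in> (\<Inter>I\<in>Pow {..<?k}. ?O I)"
        using cube op unfolding cube_closure_def in_closure_of by blast
      have "?a (\<Sum>j\<in>I. n j) \<in> (if I = {..<?k} then W else V)" if "I \<subseteq> {..<?k}" for I
      proof -
        have "I \<inter> {..<?k} = I" using that by blast
        then show ?thesis using INT_D [OF n, of I] that unfolding orbit_cube_def by auto
      qed
      then show ?thesis by blast
    qed
    then have "\<forall>V W. openin (Y i) V \<longrightarrow> openin (Y i) W \<longrightarrow> ?a 0 \<in> V \<longrightarrow> p i (\<phi> x) \<in> W \<longrightarrow>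
        (\<exists>n :: nat \<Rightarrow> int. \<forall>I\<subseteq>{..<?k}. ?a (\<Sum>j\<in>I. n j) \<in> (if I = {..<?k} then W else V))"
      by (intro allI impI)
    with rigid [of i, unfolded cube_rigid_def, THEN spec, of ?a, THEN spec, of "p i (\<phi> x)",
        THEN mp, OF orbit, THEN mp, OF p_maps [OF Aut_maps [OF \<phi>c x]]]
    have "p i (\<phi> x) = ?a 0" by (rule mp)
    then show "p i (\<phi> x) = p i x" using x by (simp add: Aut_one)
  qed
  have "lower_central A d \<subseteq> {\<one>\<^bsub>A\<^esub>}"
  proof
    fix \<phi> assume \<phi>: "\<phi> \<in> lower_central A d"
    have "\<phi> \<in> carrier A" using A.lc_closed \<phi> by blast
    then have "\<phi> = \<one>\<^bsub>A\<^esub>"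
      using fixes_point [OF \<phi>] A.one_closed Aut_one
      by (intro extensionalityI [of _ "topspace X"]) (auto simp: Aut_group_carrier)
    then show "\<phi> \<in> {\<one>\<^bsub>A\<^esub>}" by simp
  qed
  then show ?thesis
    using A.lc_one A.is_group unfolding nilpotent_group_def by blast
qed

end

section \<open>Inverse limits\<close>

lemma nilsystem_bij:
  assumes "nilsystem d Y S"
  shows "inj_on S (topspace Y)" "C \<in> topspace Y \<Longrightarrow> S C \<in> topspace Y"
proof -
  obtain G :: "'a monoid" and T \<Gamma> \<tau> where G: "lie_group G T" "subgroup \<Gamma> G" "\<tau> \<in> carrier G"
    "Y = quotient_space G T \<Gamma>" "\<forall>C\<in>topspace Y. S C = \<tau> <#\<^bsub>G\<^esub> C"
    using assms unfolding nilsystem_def by (elim exE conjE) (rule that)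
  interpret topological_group G T using lie_group_topological_group [OF G(1)] .
  have topY: "topspace Y = lcosets\<^bsub>G\<^esub> \<Gamma>" unfolding G(4) by (rule topspace_quotient_space [OF G(2)])
  note tr = lcosets_translation [OF G(2,3), folded topY]
  have "inv\<^bsub>G\<^esub> \<tau> <#\<^bsub>G\<^esub> S C = C" if "C \<in> topspace Y" for C
    using that G(5) tr(2) by simp
  then show "inj_on S (topspace Y)" by (metis inj_onI)
  show "S C \<in> topspace Y" if "C \<in> topspace Y"
    using that G(5) tr(1) by simp
qed

lemma directed_finite:
  fixes I :: "'i::order set"
  assumes "\<And>i j::'i. \<exists>k. i \<le> k \<and> j \<le> k" "finite I"
  shows "\<exists>k. \<forall>i\<in>I. i \<le> k"
  using assms(2)
proof (induction I)
  case (insert i I)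
  then obtain k where k: "\<forall>i\<in>I. i \<le> k" by blast
  obtain l where "i \<le> l" "k \<le> l" using assms(1) by blast
  then show ?case using k order_trans by blast
qed simp

text \<open>A basic open set constrains finitely many coordinates, and by directedness these are all
  functions of a single coordinate \<open>k\<close>, where minimality of \<open>Y k\<close> applies.
  The orbit point found there lifts to the orbit point of \<open>X\<close> at the same time.\<close>

lemma minimal_inverse_limit:
  fixes Y :: "'i::order \<Rightarrow> 'b topology" and p :: "'i \<Rightarrow> 'i \<Rightarrow> 'b \<Rightarrow> 'b"
  assumes inv: "inverse_system Y S p" and min: "\<And>i. minimal_system (Y i) (S i)"
    and S_inj: "\<And>i. inj_on (S i) (topspace (Y i))"
    and S_maps: "\<And>i y. y \<in> topspace (Y i) \<Longrightarrow> S i y \<in> topspace (Y i)"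
    and T: "homeomorphic_map X X T"
    and h: "homeomorphic_map X (inverse_limit Y p) h"
    and hT: "\<And>x. x \<in> topspace X \<Longrightarrow> h (T x) = inverse_limit_map S (h x)"
  shows "minimal_system X T"
  unfolding minimal_system_def
proof
  fix x assume x: "x \<in> topspace X"
  let ?P = "product_topology Y UNIV" and ?L = "inverse_limit Y p"
  have h_lim: "h z \<in> topspace ?P" "i \<le> j \<Longrightarrow> p i j (h z j) = h z i"
    if "z \<in> topspace X" for z i j
    using homeomorphic_imp_surjective_map [OF h] that unfolding inverse_limit_def by auto
  have h_top: "h z i \<in> topspace (Y i)" if "z \<in> topspace X" for z i
    using h_lim(1) [OF that] by (auto simp: PiE_iff)
  have T_maps: "(T ^^ n) z \<in> topspace X" if "z \<in> topspace X" for z n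
    using homeomorphic_imp_surjective_map [OF T] that by (induction n) auto
  have h_pow: "h ((T ^^ n) z) i = (S i ^^ n) (h z i)" if "z \<in> topspace X" for z n i
    using that by (induction n) (simp_all add: hT T_maps inverse_limit_map_def)
  have T_surj: "\<exists>w\<in>topspace X. (T ^^ n) w = z" if "z \<in> topspace X" for z n
    using that
  proof (induction n arbitrary: z)
    case (Suc n)
    then have "z \<in> T ` topspace X" using homeomorphic_imp_surjective_map [OF T] by simp
    then obtain w where "w \<in> topspace X" "T w = z" by blast
    then show ?case using Suc.IH [of w] by auto
  qed simp
  have S_pow_inj: "u = v"
    if "u \<in> topspace (Y i)" "v \<in> topspace (Y i)" "(S i ^^ n) u = (S i ^^ n) v" for i n u v
    using that
  proof (induction n arbitrary: u v)
    case (Suc n)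
    then have "S i u = S i v"
      using S_maps Suc.IH [of "S i u" "S i v"] by (simp add: funpow_swap1)
    then show ?case using inj_onD [OF S_inj] Suc.prems by blast
  qed simp
  have meets: "\<exists>y\<in>orbit_of X T x. y \<in> U" if U: "openin X U" "z \<in> U" for z U
  proof -
    have Ux: "U \<subseteq> topspace X" using openin_subset [OF U(1)] .
    have "openin ?L (h ` U)"
      using homeomorphic_imp_open_map [OF h] U(1) by (simp add: open_map_def)
    then obtain U' where U': "openin ?P U'" "h ` U = U' \<inter> {y. \<forall>i j. i \<le> j \<longrightarrow> p i j (y j) = y i}"
      unfolding inverse_limit_def openin_subtopology by (elim exE conjE)
    have "h z \<in> U'" using U' U(2) by blast
    from product_topology_open_contains_basis [OF U'(1) this]
    obtain B where B: "h z \<in> (\<Pi>\<^sub>E i\<in>UNIV. B i)" "\<And>i. openin (Y i) (B i)"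
      "finite {i. B i \<noteq> topspace (Y i)}" "(\<Pi>\<^sub>E i\<in>UNIV. B i) \<subseteq> U'" by (elim exE conjE) simp
    let ?I = "{i. B i \<noteq> topspace (Y i)}"
    obtain k where k: "\<And>i. i \<in> ?I \<Longrightarrow> i \<le> k"
      using directed_finite [OF _ B(3)] inv unfolding inverse_system_def by meson
    let ?V = "topspace (Y k) \<inter> (\<Inter>i\<in>?I. {v \<in> topspace (Y k). p i k v \<in> B i})"
    have "openin (Y k) {v \<in> topspace (Y k). p i k v \<in> B i}" if "i \<in> ?I" for i
    proof (rule openin_continuous_map_preimage [OF _ B(2)])
      show "continuous_map (Y k) (Y i) (p i k)"
        using inv k [OF that] unfolding inverse_system_def factor_map_def by blast
    qed
    then have V: "openin (Y k) ?V"
      using B(3) by (cases "?I = {}") (auto intro!: openin_Int openin_INT2)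
    have zX: "z \<in> topspace X" using U(2) Ux by blast
    have "h z k \<in> ?V"
      using B(1) h_top [OF zX] h_lim(2) [OF zX k] by (auto simp: PiE_iff)
    moreover have "Y k closure_of orbit_of (Y k) (S k) (h x k) = topspace (Y k)"
      using min h_top [OF x] unfolding minimal_system_def by blast
    ultimately have "h z k \<in> ?V \<inter> Y k closure_of orbit_of (Y k) (S k) (h x k)"
      using h_top [OF zX] by (intro IntI) simp_all
    then have "?V \<inter> Y k closure_of orbit_of (Y k) (S k) (h x k) \<noteq> {}" by (metis empty_iff)
    then have "?V \<inter> orbit_of (Y k) (S k) (h x k) \<noteq> {}"
      using openin_Int_closure_of_eq_empty [OF V] by blast
    then obtain v where v: "v \<in> ?V" "v \<in> orbit_of (Y k) (S k) (h x k)" by blast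
    have "\<exists>y\<in>orbit_of X T x. y \<in> topspace X \<and> h y k = v"
    proof -
      consider n where "v = (S k ^^ n) (h x k)"
        | n where "v \<in> topspace (Y k)" "(S k ^^ n) v = h x k"
        using v(2) unfolding orbit_of_def by blast
      then show ?thesis
      proof cases
        case (1 n)
        have "(T ^^ n) x \<in> orbit_of X T x" unfolding orbit_of_def by blast
        then show ?thesis using h_pow [OF x] T_maps [OF x] 1 by blast
      next
        case (2 n)
        \<comment> \<open>At negative times the orbit in \<open>X\<close> is followed back to
          \<open>w\<close>; injectivity of the iterates of \<open>S k\<close> forces coordinate
          \<open>k\<close> of \<open>h w\<close> to be \<open>v\<close>.\<close>
        obtain w where w: "w \<in> topspace X" "(T ^^ n) w = x" using T_surj [OF x] by blast
        have "(S k ^^ n) (h w k) = (S k ^^ n) v" using h_pow [OF w(1), of n k] w(2) 2(2) by simp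
        then have "h w k = v" using S_pow_inj h_top [OF w(1)] 2(1) by blast
        moreover have "w \<in> orbit_of X T x" using w unfolding orbit_of_def by blast
        ultimately show ?thesis using w(1) by blast
      qed
    qed
    then obtain y where y: "y \<in> orbit_of X T x" "y \<in> topspace X" "h y k = v" by blast
    have "h y i \<in> B i" for i
    proof (cases "i \<in> ?I")
      case True
      then have "p i k (h y k) \<in> B i" using v(1) y(3) by blast
      then show ?thesis using h_lim(2) [OF y(2) k [OF True]] by simp
    next
      case False
      then show ?thesis using h_top [OF y(2)] by blast
    qed
    then have "h y \<in> U'" using B(4) by (auto simp: PiE_iff)
    then have "h y \<in> h ` U" using U'(2) h_lim(2) [OF y(2)] by blast
    then have "y \<in> U"
      using homeomorphic_imp_injective_map [OF h] y(2) Ux by (auto simp: inj_on_def subset_eq)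
    then show ?thesis using y(1) by blast
  qed
  show "X closure_of orbit_of X T x = topspace X"
  proof (rule subset_antisym [OF closure_of_subset_topspace])
    show "topspace X \<subseteq> X closure_of orbit_of X T x"
    proof
      fix z assume z: "z \<in> topspace X"
      have "\<exists>y. y \<in> orbit_of X T x \<and> y \<in> U" if "z \<in> U \<and> openin X U" for U
        using meets [of U z] that by (elim conjE) (simp add: Bex_def)
      then show "z \<in> X closure_of orbit_of X T x" using z unfolding in_closure_of by (intro conjI allI impI)
    qed
  qed
qed

theorem theorem5p5:
  fixes d :: nat
    and X :: "'a topology" and T :: "'a \<Rightarrow> 'a"
    and Y :: "'i::order \<Rightarrow> 'g set topology" and S :: "'i \<Rightarrow> 'g set \<Rightarrow> 'g set"
    and p :: "'i \<Rightarrow> 'i \<Rightarrow> 'g set \<Rightarrow> 'g set"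
  assumes "d \<ge> 1"
    and "dynamical_system X T"
    and "\<And>i. nilsystem d (Y i) (S i)"
    and "\<And>i. minimal_system (Y i) (S i)"
    and "inverse_system Y S p"
    and "topologically_conjugate X T (inverse_limit Y p) (inverse_limit_map S)"
  shows "nilpotent_group d (Aut_group X T)"
proof -
  have T: "homeomorphic_map X X T" using assms(2) by (simp add: dynamical_system_def)
  obtain h where h: "homeomorphic_map X (inverse_limit Y p) h"
    and hT: "\<And>x. x \<in> topspace X \<Longrightarrow> h (T x) = inverse_limit_map S (h x)"
    using assms(6) unfolding topologically_conjugate_def by blast
  have "minimal_system X T"
    by (rule minimal_inverse_limit
        [OF assms(5,4) nilsystem_bij(1) [OF assms(3)] nilsystem_bij(2) [OF assms(3)] T h hT])
  with T interpret minimal_homeo X T by unfold_locales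
  show ?thesis
  proof (rule nilpotent_Aut_group)
    have "continuous_map X (product_topology Y UNIV) h"
      using homeomorphic_imp_continuous_map [OF h] continuous_map_into_fulltopology
      unfolding inverse_limit_def by blast
    then show "continuous_map X (Y i) (\<lambda>x. h x i)" for i
      by (simp add: continuous_map_componentwise_UNIV)
    show "h (T x) i = S i (h x i)" if "x \<in> topspace X" for i x
      using hT [OF that] by (simp add: inverse_limit_map_def)
    show "x = y" if "x \<in> topspace X" "y \<in> topspace X" "\<And>i. h x i = h y i" for x y
      using inj_onD [OF homeomorphic_imp_injective_map [OF h]] that by blast
    show "cube_rigid d (Y i) (S i)" for i
      using nilsystem_cube_rigid assms(3,4) by blast
  qed
qed

end
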